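(* There exists an absolute constant $\eta>0$ with the following property. Let $n\in\{2,3\}$, $\nu>0$ and $m>n/2+1$. Suppose there exist $T_*>0$ and vector fields $V,B:\mathbb{R}^n\to\mathbb{R}^n$ such that a solution $(v,b)$ of the zero-resistivity MHD system with viscosity $\nu$ (written out in the context) is represented, for all $t\in(0,T_* )$ and $x\in\mathbb{R}^n$, by $$v(x,t)=\frac{1}{\sqrt{T_*-t}}\,V\!\left(\frac{x}{\sqrt{T_*-t}}\right),\qquad b(x,t)=\frac{1}{\sqrt{T_*-t}}\,B\!\left(\frac{x}{\sqrt{T_*-t}}\right),$$ where $(V,B)$ satisfies: (i) $V,B\in H^m(\mathbb{R}^n)$; (ii) $\|\nabla V\|_{L^\infty}+\|\nabla B\|_{L^\infty}<\eta$. Then $V=B=0$.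
   Context: The MHD system with viscosity $\nu>0$ and zero resistivity on $\mathbb{R}^n$ is $$\frac{\partial v}{\partial t}+(v\cdot\nabla)v=\nu\Delta v-\nabla\Big(p+\tfrac12|b|^2\Big)+(b\cdot\nabla)b,$$ $$\frac{\partial b}{\partial t}+(v\cdot\nabla)b=(b\cdot\nabla)v,\qquad \operatorname{div}v=\operatorname{div}b=0,$$ $$v(x,0)=v_0(x),\qquad b(x,0)=b_0(x),$$ for the velocity $v(x,t)\in\mathbb{R}^n$, the magnetic field $b(x,t)\in\mathbb{R}^n$ and the scalar pressure $p(x,t)$, with divergence-free initial data $v_0,b_0$. A pair $(v,b)$ is called a solution if there is a scalar function $p$ for which these equations hold. $H^m(\mathbb{R}^n)$ is the usual $L^2$-based Sobolev space of (integer) order $m$, with norm $\|f\|_{H^m}^2=\sum_{|\alpha|\le m}\|D^\alpha f\|_{L^2}^2$, used componentwise for vector fields. $\|\nabla V\|_{L^\infty}$ is the essential supremum of the Euclidean norm of the matrix $\nabla V(y)$. *)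

theory Defs
  imports "HOL-Analysis.Analysis" "HOL-Probability.Essential_Supremum"
begin

section \<open>Weak derivatives and Sobolev spaces\<close>

text \<open>A list \<open>[e\<^sub>1, \<dots>, e\<^sub>k]\<close> of directions stands for the differential operator
  \<open>\<partial>\<^bsub>e\<^sub>1\<^esub> \<dots> \<partial>\<^bsub>e\<^sub>k\<^esub>\<close>.  The lists of length \<open>k\<close> over \<^const>\<open>Basis\<close> represent, with
  repetitions, all multi-indices of order \<open>k\<close>.\<close>

fun iter_deriv :: "'a::euclidean_space list \<Rightarrow> ('a \<Rightarrow> real) \<Rightarrow> 'a \<Rightarrow> real" where
  "iter_deriv [] \<phi> = \<phi>"
| "iter_deriv (e # es) \<phi> = (\<lambda>x. frechet_derivative (iter_deriv es \<phi>) (at x) e)"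

definition smooth :: "('a::euclidean_space \<Rightarrow> real) \<Rightarrow> bool" where
  "smooth \<phi> \<longleftrightarrow> (\<forall>es\<in>lists Basis. \<forall>x. iter_deriv es \<phi> differentiable (at x))"

definition test_function :: "'a::euclidean_space set \<Rightarrow> ('a \<Rightarrow> real) \<Rightarrow> bool" where
  "test_function \<Omega> \<phi> \<longleftrightarrow> smooth \<phi> \<and> (\<exists>K. compact K \<and> K \<subseteq> \<Omega> \<and> (\<forall>x. x \<notin> K \<longrightarrow> \<phi> x = 0))"

definition locally_integrable :: "'a::euclidean_space set \<Rightarrow> ('a \<Rightarrow> real) \<Rightarrow> bool" where
  "locally_integrable \<Omega> f \<longleftrightarrow> (\<forall>K. compact K \<and> K \<subseteq> \<Omega> \<longrightarrow> set_integrable lebesgue K f)"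

definition has_weak_deriv ::
    "'a::euclidean_space set \<Rightarrow> 'a list \<Rightarrow> ('a \<Rightarrow> real) \<Rightarrow> ('a \<Rightarrow> real) \<Rightarrow> bool" where
  "has_weak_deriv \<Omega> es f g \<longleftrightarrow>
     locally_integrable \<Omega> f \<and> locally_integrable \<Omega> g \<and>
     (\<forall>\<phi>. test_function \<Omega> \<phi> \<longrightarrow>
        (LINT x:\<Omega>|lebesgue. f x * iter_deriv es \<phi> x) =
        (- 1) ^ length es * (LINT x:\<Omega>|lebesgue. g x * \<phi> x))"

definition weakly_differentiable :: "'a::euclidean_space set \<Rightarrow> 'a list \<Rightarrow> ('a \<Rightarrow> real) \<Rightarrow> bool" where
  "weakly_differentiable \<Omega> es f \<longleftrightarrow> (\<exists>g. has_weak_deriv \<Omega> es f g)"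

text \<open>A representative of the weak derivative, which on an open set is unique up to null sets;
  meaningful only if \<^const>\<open>weakly_differentiable\<close> holds.\<close>

definition weak_deriv :: "'a::euclidean_space set \<Rightarrow> 'a list \<Rightarrow> ('a \<Rightarrow> real) \<Rightarrow> 'a \<Rightarrow> real" where
  "weak_deriv \<Omega> es f = (SOME g. has_weak_deriv \<Omega> es f g)"

definition square_integrable :: "('a::euclidean_space \<Rightarrow> real) \<Rightarrow> bool" where
  "square_integrable f \<longleftrightarrow> f \<in> borel_measurable lebesgue \<and> integrable lebesgue (\<lambda>x. (f x)\<^sup>2)"

definition sobolev_H :: "nat \<Rightarrow> ('a::euclidean_space \<Rightarrow> real) set" where
  "sobolev_H m = {f. square_integrable f \<and>
     (\<forall>es\<in>lists Basis. length es \<le> m \<longrightarrow> (\<exists>g. has_weak_deriv UNIV es f g \<and> square_integrable g))}"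

definition sobolev_H_vec :: "nat \<Rightarrow> (real^'n \<Rightarrow> real^'n) set" where
  "sobolev_H_vec m = {V. \<forall>i. (\<lambda>y. V y $ i) \<in> sobolev_H m}"

definition weak_gradient :: "(real^'n \<Rightarrow> real^'n) \<Rightarrow> real^'n \<Rightarrow> real^'n^'n" where
  "weak_gradient V y = (\<chi> i j. weak_deriv UNIV [axis j 1] (\<lambda>z. V z $ i) y)"

text \<open>The norm of the type \<open>real^'n^'n\<close> is the Euclidean (Frobenius) norm of a matrix.\<close>

definition grad_Linf_norm :: "(real^'n \<Rightarrow> real^'n) \<Rightarrow> ereal" where
  "grad_Linf_norm V = esssup lebesgue (\<lambda>y. ereal (norm (weak_gradient V y)))"


section \<open>The zero-resistivity MHD system\<close>

definition divergence_free :: "(real^'n \<Rightarrow> real^'n) \<Rightarrow> bool" where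
  "divergence_free u \<longleftrightarrow>
     (\<forall>i. weakly_differentiable UNIV [axis i 1] (\<lambda>x. u x $ i)) \<and>
     (AE x in lebesgue. (\<Sum>i\<in>UNIV. weak_deriv UNIV [axis i 1] (\<lambda>x. u x $ i) x) = 0)"

text \<open>Space-time points are pairs \<open>(t, x)\<close>.\<close>

definition slab :: "real \<Rightarrow> (real \<times> (real^'n)) set" where
  "slab T = {0<..<T} \<times> UNIV"

definition e_t :: "real \<times> (real^'n)" where
  "e_t = (1, 0)"

definition e_x :: "'n \<Rightarrow> real \<times> (real^'n)" where
  "e_x i = (0, axis i 1)"

definition attains_initial_data :: "(real \<Rightarrow> real^'n \<Rightarrow> real^'n) \<Rightarrow> (real^'n \<Rightarrow> real^'n) \<Rightarrow> bool" where
  "attains_initial_data u u0 \<longleftrightarrow>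
     (\<forall>x. u 0 x = u0 x) \<and>
     (\<forall>\<phi> k. test_function UNIV \<phi> \<longrightarrow>
        ((\<lambda>t. LINT x|lebesgue. u t x $ k * \<phi> x) \<longlongrightarrow> (LINT x|lebesgue. u0 x $ k * \<phi> x)) (at_right 0))"

text \<open>All derivatives are weak derivatives on the space-time domain and the equations hold almost
  everywhere there; in particular classical solutions are included.  The gradient acts on the
  total pressure \<open>p + \<bar>b\<bar>\<^sup>2/2\<close> as in the system itself.\<close>

definition mhd_solution ::
    "real \<Rightarrow> real \<Rightarrow> (real^'n \<Rightarrow> real^'n) \<Rightarrow> (real^'n \<Rightarrow> real^'n) \<Rightarrow>
     (real \<Rightarrow> real^'n \<Rightarrow> real^'n) \<Rightarrow> (real \<Rightarrow> real^'n \<Rightarrow> real^'n) \<Rightarrow> bool" where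
  "mhd_solution \<nu> T v0 b0 v b \<longleftrightarrow>
    (let D = weak_deriv (slab T);
         W = weakly_differentiable (slab T);
         vc = (\<lambda>k (t, x). v t x $ k);
         bc = (\<lambda>k (t, x). b t x $ k)
     in
       divergence_free v0 \<and> divergence_free b0 \<and>
       attains_initial_data v v0 \<and> attains_initial_data b b0 \<and>
       (\<forall>k. W [e_t] (vc k) \<and> W [e_t] (bc k)) \<and>
       (\<forall>k i. W [e_x i] (vc k) \<and> W [e_x i, e_x i] (vc k) \<and> W [e_x i] (bc k)) \<and>
       (\<exists>p. let q = (\<lambda>(t, x). p t x + (norm (b t x))\<^sup>2 / 2)
            in
          (\<forall>k. W [e_x k] q) \<and>
          (AE z in lebesgue. z \<in> slab T \<longrightarrow>
             (\<forall>k. D [e_t] (vc k) z + (\<Sum>i\<in>UNIV. vc i z * D [e_x i] (vc k) z)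
                  = \<nu> * (\<Sum>i\<in>UNIV. D [e_x i, e_x i] (vc k) z) - D [e_x k] q z
                    + (\<Sum>i\<in>UNIV. bc i z * D [e_x i] (bc k) z)) \<and>
             (\<forall>k. D [e_t] (bc k) z + (\<Sum>i\<in>UNIV. vc i z * D [e_x i] (bc k) z)
                  = (\<Sum>i\<in>UNIV. bc i z * D [e_x i] (vc k) z)) \<and>
             (\<Sum>i\<in>UNIV. D [e_x i] (vc i) z) = 0 \<and>
             (\<Sum>i\<in>UNIV. D [e_x i] (bc i) z) = 0)))"

text \<open>\<open>self_similar T V u\<close>: on \<open>(0, T)\<close>, \<open>u\<close> is the backward self-similar field with profile \<open>V\<close>.\<close>

definition self_similar ::
    "real \<Rightarrow> (real^'n \<Rightarrow> real^'n) \<Rightarrow> (real \<Rightarrow> real^'n \<Rightarrow> real^'n) \<Rightarrow> bool" where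
  "self_similar T V u \<longleftrightarrow>
     (\<forall>t\<in>{0<..<T}. \<forall>x. u t x = (1 / sqrt (T - t)) *\<^sub>R V ((1 / sqrt (T - t)) *\<^sub>R x))"

end

theory Submission
  imports Defs
begin

text \<open>
  Inserting the self-similar ansatz turns the system into stationary equations for the profiles:
  with \<open>F = (V + y \<cdot> \<nabla>V) / 2 + V \<cdot> \<nabla>V - \<nu> \<Delta>V - B \<cdot> \<nabla>B\<close>, the velocity equation says that \<open>F\<close> is
  a gradient, and \<open>(B + y \<cdot> \<nabla>B) / 2 + V \<cdot> \<nabla>B - B \<cdot> \<nabla>V = 0\<close>.  For a pair of indices \<open>j, k\<close> put
  \<open>w = \<partial>\<^sub>jV\<^sub>k - \<partial>\<^sub>kV\<^sub>j\<close> and \<open>J = \<partial>\<^sub>jB\<^sub>k - \<partial>\<^sub>kB\<^sub>j\<close>.  The curl removes the pressure and leaves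
  \<open>w + (y / 2 + V) \<cdot> \<nabla>w + P = \<nu> \<Delta>w + B \<cdot> \<nabla>J\<close> and
  \<open>J + (y / 2 + V) \<cdot> \<nabla>J + R = B \<cdot> \<nabla>w\<close>, where \<open>P\<close> and \<open>R\<close> are quadratic in \<open>\<nabla>V, \<nabla>B\<close>.

  Multiply by \<open>w\<close> and \<open>J\<close>, add and integrate.  The transport by \<open>V\<close> drops out since
  \<open>div V = 0\<close>, the two terms with \<open>B\<close> add up to \<open>B \<cdot> \<nabla>(w J)\<close>, which integrates to zero since
  \<open>div B = 0\<close>, the viscous term has a favourable sign, and the dilation field \<open>y / 2\<close>, whose divergence is \<open>n / 2\<close>, contributes
  \<open>- n / 4 \<integral> (w\<^sup>2 + J\<^sup>2)\<close>.  Hence \<open>(1 - n / 4) \<integral> (w\<^sup>2 + J\<^sup>2) \<le> - \<integral> (P w + R J)\<close>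
  (lemma \<open>enstrophy_estimate\<close>).  For \<open>n \<le> 3\<close> the factor on the left is positive.  The right-hand
  side is at most a constant times \<open>sup (|\<nabla>V| + |\<nabla>B|) \<integral> (|\<nabla>V|\<^sup>2 + |\<nabla>B|\<^sup>2)\<close>, and for
  divergence-free fields \<open>\<integral> |\<nabla>V|\<^sup>2\<close> is half the sum of \<open>\<integral> w\<^sup>2\<close> over all pairs
  (\<open>divergence_free_gradient_identity\<close>).  So a small gradient must vanish, and a square-integrable
  field with vanishing gradient is zero (\<open>profile_rigidity\<close>).  The viscosity enters only through its
  sign, which is why \<open>\<eta>\<close> is absolute.

  In both dimensions \<open>m > n / 2 + 1\<close> forces \<open>m \<ge> 3\<close>.  Then \<open>w\<close> and \<open>J\<close> have two square-integrable weak
  derivatives, and they are bounded because the gradients are, so that \<open>w\<^sup>2 + J\<^sup>2\<close> and \<open>w J\<close>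
  are again square-integrable with their first derivatives.  All integrations by parts therefore
  follow from one product rule, for square-integrable factors with square-integrable derivatives
  (\<open>weak_product_rule\<close>), tested against cutoffs that are dilated to infinity.

  To pass from space-time to the profiles, the weak derivatives of a self-similar field are computed
  by a change of variables on each time slice (\<open>slab_spatial_derivative\<close>,
  \<open>slab_time_derivative\<close>).  The pressure is only known to have weak first derivatives.
  By the equation these are the rescaled components of \<open>- F\<close>, which have weak derivatives of their
  own, and the symmetry of mixed weak derivatives of the pressure says exactly that \<open>F\<close> is curl-free
  (\<open>self_similar_profile_equations\<close>).
\<close>

section \<open>Smooth functions and test functions\<close>

lemma iter_deriv_append: "iter_deriv (es @ fs) \<phi> = iter_deriv es (iter_deriv fs \<phi>)"
  by (induction es) auto

lemma smooth_iter_deriv: "smooth \<phi> \<Longrightarrow> es \<in> lists Basis \<Longrightarrow> smooth (iter_deriv es \<phi>)"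
  unfolding smooth_def by (simp add: iter_deriv_append[symmetric])

lemma smooth_differentiable: "smooth \<phi> \<Longrightarrow> \<phi> differentiable (at x)"
  unfolding smooth_def by (drule bspec[where x="[]"]) auto

text \<open>Smooth functions form the largest class of differentiable functions that is closed under partial
  derivatives.  Closure properties are obtained by exhibiting such a class.\<close>

lemma smooth_coinduct:
  assumes "P \<phi>"
    and diff: "\<And>\<phi> x. P \<phi> \<Longrightarrow> \<phi> differentiable (at x)"
    and deriv: "\<And>\<phi> e. P \<phi> \<Longrightarrow> e \<in> Basis \<Longrightarrow> P (iter_deriv [e] \<phi>)"
  shows "smooth \<phi>"
proof -
  have "P (iter_deriv es \<phi>)" if "es \<in> lists Basis" for es
    using that
  proof (induction es)
    case Nil
    then show ?case using \<open>P \<phi>\<close> by simp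
  next
    case (Cons e es)
    then show ?case using deriv[of "iter_deriv es \<phi>" e] by simp
  qed
  then show ?thesis unfolding smooth_def using diff by blast
qed

lemma iter_deriv_eqI:
  assumes "\<And>x. (\<phi> has_derivative \<phi>' x) (at x)"
  shows "iter_deriv [e] \<phi> = (\<lambda>x. \<phi>' x e)"
proof
  show "iter_deriv [e] \<phi> x = \<phi>' x e" for x
    using frechet_derivative_at[OF assms[of x]] by simp
qed

lemma frechet_derivative_worksI:
  "f differentiable (at x) \<Longrightarrow> (f has_derivative frechet_derivative f (at x)) (at x)"
  by (simp add: frechet_derivative_works)

lemma smooth_has_derivative:
  fixes \<phi> :: "'a::euclidean_space \<Rightarrow> real"
  assumes "smooth \<phi>"
  shows "(\<phi> has_derivative (\<lambda>h. \<Sum>b\<in>Basis. (h \<bullet> b) * iter_deriv [b] \<phi> x)) (at x)"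
proof -
  let ?D = "frechet_derivative \<phi> (at x)"
  have D: "(\<phi> has_derivative ?D) (at x)"
    using smooth_differentiable[OF assms] by (simp add: frechet_derivative_worksI)
  then have lin: "linear ?D"
    using has_derivative_bounded_linear bounded_linear.linear by blast
  have "?D h = (\<Sum>b\<in>Basis. (h \<bullet> b) * iter_deriv [b] \<phi> x)" for h
  proof -
    have "?D h = ?D (\<Sum>b\<in>Basis. (h \<bullet> b) *\<^sub>R b)"
      by (simp add: euclidean_representation)
    also have "\<dots> = (\<Sum>b\<in>Basis. (h \<bullet> b) * ?D b)"
      by (simp add: linear_sum[OF lin] linear_scale[OF lin])
    finally show ?thesis by simp
  qed
  then have eq: "?D = (\<lambda>h. \<Sum>b\<in>Basis. (h \<bullet> b) * iter_deriv [b] \<phi> x)" by (rule ext)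
  show ?thesis by (rule D[unfolded eq])
qed

lemma smooth_continuous_on: "smooth \<phi> \<Longrightarrow> continuous_on A \<phi>"
  by (intro continuous_at_imp_continuous_on ballI differentiable_imp_continuous_within
      smooth_differentiable)

lemma smooth_isCont: "smooth \<phi> \<Longrightarrow> isCont \<phi> x"
  by (intro differentiable_imp_continuous_within smooth_differentiable)


lemma smooth_borel_measurable: "smooth \<phi> \<Longrightarrow> \<phi> \<in> borel_measurable borel"
  by (intro borel_measurable_continuous_onI smooth_continuous_on)

lemma iter_deriv_add:
  assumes "\<And>x. \<phi> differentiable (at x)" "\<And>x. \<psi> differentiable (at x)"
  shows "iter_deriv [e] (\<lambda>x. \<phi> x + \<psi> x) = (\<lambda>x. iter_deriv [e] \<phi> x + iter_deriv [e] \<psi> x)"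
  unfolding iter_deriv_eqI[OF has_derivative_add[OF assms[THEN frechet_derivative_worksI]]]
  by simp

lemma iter_deriv_mult:
  assumes "\<And>x. \<phi> differentiable (at x)" "\<And>x. \<psi> differentiable (at x)"
  shows "iter_deriv [e] (\<lambda>x. \<phi> x * \<psi> x) =
         (\<lambda>x. \<phi> x * iter_deriv [e] \<psi> x + iter_deriv [e] \<phi> x * \<psi> x)"
  unfolding iter_deriv_eqI[OF has_derivative_mult[OF assms[THEN frechet_derivative_worksI]]]
  by simp

declare iter_deriv.simps(2) [simp del]

lemma smooth_const: "smooth (\<lambda>x. c)"
  by (rule smooth_coinduct[where P="\<lambda>\<phi>. \<exists>c. \<phi> = (\<lambda>x. c)"]) (auto simp: iter_deriv.simps)

lemma smooth_inner: "smooth (\<lambda>x. x \<bullet> v)"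
proof -
  have "iter_deriv [e] (\<lambda>x. x \<bullet> v) = (\<lambda>x. e \<bullet> v)" for e :: 'a
    by (rule iter_deriv_eqI) (auto intro!: derivative_eq_intros)
  then show ?thesis
    by (intro smooth_coinduct[where P="\<lambda>\<phi>. \<phi> = (\<lambda>x. x \<bullet> v) \<or> (\<exists>c. \<phi> = (\<lambda>x. c))"])
       (auto simp: differentiable_def iter_deriv.simps intro!: derivative_eq_intros)
qed

text \<open>By the Leibniz rule this class is closed under partial derivatives, unlike the class of single
  products.\<close>

inductive sum_of_products :: "('a::euclidean_space \<Rightarrow> real) \<Rightarrow> bool" where
  prod: "smooth \<phi> \<Longrightarrow> smooth \<psi> \<Longrightarrow> sum_of_products (\<lambda>x. \<phi> x * \<psi> x)"
| sum: "sum_of_products \<phi> \<Longrightarrow> sum_of_products \<psi> \<Longrightarrow> sum_of_products (\<lambda>x. \<phi> x + \<psi> x)"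

lemma sum_of_products_differentiable: "sum_of_products \<phi> \<Longrightarrow> \<phi> differentiable (at x)"
  by (induction rule: sum_of_products.induct)
     (auto intro: smooth_differentiable differentiable_add differentiable_mult)

lemma sum_of_products_smooth: "sum_of_products \<phi> \<Longrightarrow> smooth \<phi>"
proof (rule smooth_coinduct[where P=sum_of_products])
  fix \<phi> :: "'a \<Rightarrow> real" and e :: 'a
  assume "sum_of_products \<phi>" "e \<in> Basis"
  then show "sum_of_products (iter_deriv [e] \<phi>)"
  proof (induction rule: sum_of_products.induct)
    case (prod \<phi> \<psi>)
    have "smooth (iter_deriv [e] \<phi>)" "smooth (iter_deriv [e] \<psi>)"
      using prod smooth_iter_deriv[of _ "[e]"] by auto
    then show ?case
      unfolding iter_deriv_mult[OF prod(1,2)[THEN smooth_differentiable]]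
      using prod by (intro sum_of_products.intros)
  next
    case (sum \<phi> \<psi>)
    have "iter_deriv [e] (\<lambda>x. \<phi> x + \<psi> x) = (\<lambda>x. iter_deriv [e] \<phi> x + iter_deriv [e] \<psi> x)"
      using sum by (intro iter_deriv_add sum_of_products_differentiable)
    then show ?case using sum sum_of_products.sum by metis
  qed
qed (auto intro: sum_of_products_differentiable)

lemma smooth_mult: "smooth \<phi> \<Longrightarrow> smooth \<psi> \<Longrightarrow> smooth (\<lambda>x. \<phi> x * \<psi> x)"
  by (rule sum_of_products_smooth[OF sum_of_products.prod])

lemma smooth_add:
  assumes "smooth \<phi>" "smooth \<psi>"
  shows "smooth (\<lambda>x. \<phi> x + \<psi> x)"
proof -
  have "sum_of_products (\<lambda>x. \<phi> x * 1 + \<psi> x * 1)"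
    by (intro sum_of_products.intros assms smooth_const)
  then show ?thesis using sum_of_products_smooth by force
qed

lemma smooth_cmult: "smooth \<phi> \<Longrightarrow> smooth (\<lambda>x. c * \<phi> x)"
  by (intro smooth_mult smooth_const)

lemma smooth_sum: "(\<And>i. i \<in> I \<Longrightarrow> smooth (f i)) \<Longrightarrow> smooth (\<lambda>x. \<Sum>i\<in>I. f i x)"
  by (induction I rule: infinite_finite_induct) (auto intro: smooth_const smooth_add)

lemma smooth_prod: "(\<And>i. i \<in> I \<Longrightarrow> smooth (f i)) \<Longrightarrow> smooth (\<lambda>x. \<Prod>i\<in>I. f i x)"
  by (induction I rule: infinite_finite_induct) (auto intro: smooth_const smooth_mult)

lemma iter_deriv_affine:
  fixes \<psi> :: "'b::euclidean_space \<Rightarrow> real" and A :: "'a::euclidean_space \<Rightarrow> 'b"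
  assumes "smooth \<psi>" and A: "linear A"
  shows "iter_deriv [e] (\<lambda>x. \<psi> (c + A x)) =
         (\<lambda>x. \<Sum>b\<in>Basis. (A e \<bullet> b) * iter_deriv [b] \<psi> (c + A x))"
    and "(\<lambda>x. \<psi> (c + A x)) differentiable (at x)"
proof -
  have "((\<lambda>x. c + A x) has_derivative A) (at x)" for x
    using A by (auto intro!: derivative_eq_intros linear_imp_has_derivative)
  then have *: "((\<lambda>x. \<psi> (c + A x)) has_derivative
      (\<lambda>h. \<Sum>b\<in>Basis. (A h \<bullet> b) * iter_deriv [b] \<psi> (c + A x))) (at x)" for x
    by (rule has_derivative_compose) (rule smooth_has_derivative[OF \<open>smooth \<psi>\<close>])
  show "iter_deriv [e] (\<lambda>x. \<psi> (c + A x)) =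
         (\<lambda>x. \<Sum>b\<in>Basis. (A e \<bullet> b) * iter_deriv [b] \<psi> (c + A x))"
    by (rule iter_deriv_eqI[OF *])
  show "(\<lambda>x. \<psi> (c + A x)) differentiable (at x)"
    using * unfolding differentiable_def by blast
qed

lemma smooth_affine:
  fixes \<psi> :: "'b::euclidean_space \<Rightarrow> real" and A :: "'a::euclidean_space \<Rightarrow> 'b"
  assumes "smooth \<psi>" and A: "linear A"
  shows "smooth (\<lambda>x. \<psi> (c + A x))"
proof (rule smooth_coinduct[where P="\<lambda>\<phi>. \<exists>\<psi>. smooth \<psi> \<and> \<phi> = (\<lambda>x. \<psi> (c + A x))"])
  show "\<exists>\<psi>'. smooth \<psi>' \<and> (\<lambda>x. \<psi> (c + A x)) = (\<lambda>x. \<psi>' (c + A x))"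
    using assms by blast
next
  fix \<phi> :: "'a \<Rightarrow> real" and x
  assume "\<exists>\<psi>. smooth \<psi> \<and> \<phi> = (\<lambda>x. \<psi> (c + A x))"
  then show "\<phi> differentiable (at x)" using iter_deriv_affine(2)[OF _ A] by auto
next
  fix \<phi> :: "'a \<Rightarrow> real" and e :: 'a
  assume "\<exists>\<psi>. smooth \<psi> \<and> \<phi> = (\<lambda>x. \<psi> (c + A x))"
  then obtain \<psi> where \<psi>: "smooth \<psi>" "\<phi> = (\<lambda>x. \<psi> (c + A x))" by blast
  let ?\<psi>' = "\<lambda>z. \<Sum>b\<in>Basis. (A e \<bullet> b) * iter_deriv [b] \<psi> z"
  have "smooth ?\<psi>'"
    using \<psi> smooth_iter_deriv[of \<psi> "[_]"] by (intro smooth_sum smooth_cmult) auto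
  moreover have "iter_deriv [e] \<phi> = (\<lambda>x. ?\<psi>' (c + A x))"
    using iter_deriv_affine(1)[OF \<psi>(1) A] \<psi>(2) by simp
  ultimately show "\<exists>\<psi>. smooth \<psi> \<and> iter_deriv [e] \<phi> = (\<lambda>x. \<psi> (c + A x))"
    by (intro exI[of _ ?\<psi>']) blast
qed

subsection \<open>A bump function\<close>

text \<open>All derivatives of \<open>exp (- 1 / x)\<close>, extended by zero to \<open>x \<le> 0\<close>, are linear combinations
  of these functions, and each of them is flat at \<open>0\<close> because the exponential beats every power.\<close>

definition flat_monomial :: "nat \<Rightarrow> real \<Rightarrow> real" where
  "flat_monomial k x = (if x > 0 then inverse x ^ k * exp (- inverse x) else 0)"

lemma flat_monomial_has_derivative:
  "(flat_monomial k has_real_derivative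
     flat_monomial (k + 2) x - real k * flat_monomial (k + 1) x) (at x)"
proof -
  consider "x > 0" | "x < 0" | "x = 0" by linarith
  then show ?thesis
  proof cases
    case 1
    have inv: "(inverse has_real_derivative - (inverse x ^ 2)) (at x)"
      using DERIV_inverse[of x] 1 by (simp add: numeral_2_eq_2)
    have "((\<lambda>x. inverse x ^ k * exp (- inverse x)) has_real_derivative
        real k * (- (inverse x ^ 2) * inverse x ^ (k - Suc 0)) * exp (- inverse x) +
        (exp (- inverse x) * - (- (inverse x ^ 2))) * inverse x ^ k) (at x)"
      by (intro DERIV_mult DERIV_power DERIV_fun_exp DERIV_minus inv)
    also have "real k * (- (inverse x ^ 2) * inverse x ^ (k - Suc 0)) * exp (- inverse x) +
        (exp (- inverse x) * - (- (inverse x ^ 2))) * inverse x ^ k =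
        inverse x ^ (k + 2) * exp (- inverse x) - real k * (inverse x ^ (k + 1) * exp (- inverse x))"
      by (cases k) (simp_all add: algebra_simps power2_eq_square)
    finally have "((\<lambda>x. inverse x ^ k * exp (- inverse x)) has_real_derivative
        inverse x ^ (k + 2) * exp (- inverse x) - real k * (inverse x ^ (k + 1) * exp (- inverse x))) (at x)" .
    moreover have "\<forall>\<^sub>F y in nhds x. flat_monomial k y = inverse y ^ k * exp (- inverse y)"
      using 1 by (auto simp: eventually_nhds flat_monomial_def intro!: exI[of _ "{0<..}"])
    ultimately show ?thesis
      using 1 by (subst DERIV_cong_ev[OF refl _ refl]) (auto simp: flat_monomial_def)
  next
    case 2
    have "\<forall>\<^sub>F y in nhds x. flat_monomial k y = 0"
      using 2 by (auto simp: eventually_nhds flat_monomial_def intro!: exI[of _ "{..<0}"])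
    then show ?thesis
      using 2 by (subst DERIV_cong_ev[OF refl _ refl]) (auto simp: flat_monomial_def)
  next
    case 3
    have "((\<lambda>h. flat_monomial k h / h) \<longlongrightarrow> 0) (at 0)"
    proof -
      have "((\<lambda>u. u ^ (k + 1) / exp u) \<longlongrightarrow> 0) (at_top :: real filter)"
        by (rule tendsto_power_div_exp_0)
      then have "((\<lambda>h::real. inverse h ^ (k + 1) / exp (inverse h)) \<longlongrightarrow> 0) (at_right 0)"
        by (rule filterlim_compose[OF _ filterlim_inverse_at_top_right])
      moreover have "\<forall>\<^sub>F h::real in at_right 0. inverse h ^ (k + 1) / exp (inverse h) = flat_monomial k h / h"
        by (auto simp: eventually_at_filter flat_monomial_def exp_minus field_simps)
      ultimately have "((\<lambda>h. flat_monomial k h / h) \<longlongrightarrow> 0) (at_right 0)"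
        using filterlim_cong[OF refl refl] by fast
      moreover have "((\<lambda>h. flat_monomial k h / h) \<longlongrightarrow> 0) (at_left 0)"
        by (rule tendsto_eventually) (auto simp: eventually_at_filter flat_monomial_def)
      ultimately show ?thesis by (rule filterlim_split_at[rotated])
    qed
    then show ?thesis using 3 by (simp add: DERIV_def flat_monomial_def)
  qed
qed

inductive flat_span :: "(real \<Rightarrow> real) \<Rightarrow> bool" where
  monomial: "flat_span (\<lambda>x. c * flat_monomial k x)"
| sum: "flat_span \<phi> \<Longrightarrow> flat_span \<psi> \<Longrightarrow> flat_span (\<lambda>x. \<phi> x + \<psi> x)"

lemma flat_span_has_derivative:
  "flat_span \<phi> \<Longrightarrow> \<exists>\<phi>'. flat_span \<phi>' \<and> (\<forall>x. (\<phi> has_real_derivative \<phi>' x) (at x))"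
proof (induction rule: flat_span.induct)
  case (monomial c k)
  have "((\<lambda>x. c * flat_monomial k x) has_real_derivative
      c * flat_monomial (k + 2) x + (- c * real k) * flat_monomial (k + 1) x) (at x)" for x
    using DERIV_cmult[OF flat_monomial_has_derivative, of c k x] by (simp add: algebra_simps)
  moreover have "flat_span (\<lambda>x. c * flat_monomial (k + 2) x + (- c * real k) * flat_monomial (k + 1) x)"
    by (intro flat_span.intros)
  ultimately show ?case by (intro exI conjI allI)
next
  case (sum \<phi> \<psi>)
  then obtain \<phi>' \<psi>' where "flat_span \<phi>'" "flat_span \<psi>'"
    and "\<And>x. (\<phi> has_real_derivative \<phi>' x) (at x)" "\<And>x. (\<psi> has_real_derivative \<psi>' x) (at x)"
    by metis
  then show ?case
    by (intro exI[of _ "\<lambda>x. \<phi>' x + \<psi>' x"] conjI allI flat_span.sum DERIV_add)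
qed

lemma smooth_flat_monomial: "smooth (flat_monomial k)"
proof (rule smooth_coinduct[where P=flat_span])
  show "flat_span (flat_monomial k)" using flat_span.monomial[of 1 k] by simp
next
  fix \<phi> x assume "flat_span \<phi>"
  then show "\<phi> differentiable (at x)"
    using flat_span_has_derivative unfolding differentiable_def has_field_derivative_def by blast
next
  fix \<phi> and e :: real assume "flat_span \<phi>" "e \<in> Basis"
  then obtain \<phi>' where \<phi>': "flat_span \<phi>'" "\<And>x. (\<phi> has_real_derivative \<phi>' x) (at x)"
    using flat_span_has_derivative by blast
  have "iter_deriv [e] \<phi> = (\<lambda>x. \<phi>' x * e)"
    by (rule iter_deriv_eqI) (rule \<phi>'(2)[unfolded has_field_derivative_def])
  then show "flat_span (iter_deriv [e] \<phi>)" using \<phi>'(1) \<open>e \<in> Basis\<close> by simp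
qed

lemma bump_exists:
  fixes a :: "'a::euclidean_space"
  assumes "r > 0"
  obtains \<phi> where "test_function (ball a r) \<phi>" "\<And>x. 0 \<le> \<phi> x" "\<And>x. \<phi> x \<le> 1" "\<phi> a > 0"
proof -
  \<comment> \<open>The product below vanishes outside the cube of half-width \<open>s\<close> around \<open>a\<close>, which by the
    \<open>l\<^sup>1\<close> bound on the norm lies in the ball of radius \<open>r / 2\<close>.\<close>
  define s where "s = r / (2 * DIM('a))"
  have s: "s > 0" using assms by (simp add: s_def)
  let ?h = "flat_monomial 0"
  have h: "0 \<le> ?h t" "?h t \<le> 1" "t > 0 \<Longrightarrow> 0 < ?h t" "t \<le> 0 \<Longrightarrow> ?h t = 0" for t
    by (auto simp: flat_monomial_def)
  define \<phi> where "\<phi> = (\<lambda>x. \<Prod>b\<in>Basis. ?h (s + (- (a \<bullet> b) + x \<bullet> b)) * ?h (s + (a \<bullet> b - x \<bullet> b)))"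
  have "smooth \<phi>"
  proof -
    have "smooth (\<lambda>x. ?h ((s - a \<bullet> b) + x \<bullet> b))" "smooth (\<lambda>x. ?h ((s + a \<bullet> b) + (- (x \<bullet> b))))" for b
      by (rule smooth_affine[OF smooth_flat_monomial];
          auto simp: linear_iff algebra_simps)+
    then show ?thesis
      unfolding \<phi>_def by (intro smooth_prod smooth_mult) (auto simp: algebra_simps)
  qed
  moreover have "\<phi> x = 0" if "x \<notin> cball a (r / 2)" for x
  proof -
    have "\<exists>b\<in>Basis. \<bar>(x - a) \<bullet> b\<bar> > s"
    proof (rule ccontr)
      assume "\<not> ?thesis"
      then have "(\<Sum>b\<in>Basis. \<bar>(x - a) \<bullet> b\<bar>) \<le> (\<Sum>b\<in>(Basis :: 'a set). s)"
        by (intro sum_mono) auto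
      then have "norm (x - a) \<le> r / 2"
        using norm_le_l1[of "x - a"] by (auto simp: s_def field_simps)
      then show False using that by (simp add: dist_norm norm_minus_commute)
    qed
    then obtain b where b: "b \<in> Basis" "\<bar>(x - a) \<bullet> b\<bar> > s" by blast
    then have "?h (s + (- (a \<bullet> b) + x \<bullet> b)) * ?h (s + (a \<bullet> b - x \<bullet> b)) = 0"
      using h(4) by (auto simp: inner_diff_left abs_real_def split: if_splits)
    then show ?thesis unfolding \<phi>_def using b(1) by (intro prod_zero) auto
  qed
  ultimately have "test_function (ball a r) \<phi>"
    unfolding test_function_def using assms
    by (intro conjI exI[of _ "cball a (r / 2)"]) auto
  moreover have "0 \<le> \<phi> x" "\<phi> x \<le> 1" for x
    unfolding \<phi>_def by (auto intro!: prod_nonneg prod_le_1 mult_nonneg_nonneg mult_le_one h)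
  moreover have "\<phi> a > 0"
    unfolding \<phi>_def using h s by (auto intro!: prod_pos)
  ultimately show ?thesis using that by blast
qed

subsection \<open>Test functions\<close>

lemma test_functionI:
  "smooth \<phi> \<Longrightarrow> compact K \<Longrightarrow> K \<subseteq> \<Omega> \<Longrightarrow> (\<And>x. x \<notin> K \<Longrightarrow> \<phi> x = 0) \<Longrightarrow> test_function \<Omega> \<phi>"
  unfolding test_function_def by blast

lemma test_function_smooth: "test_function \<Omega> \<phi> \<Longrightarrow> smooth \<phi>"
  by (auto simp: test_function_def)

lemma test_function_mono: "test_function \<Omega> \<phi> \<Longrightarrow> \<Omega> \<subseteq> \<Omega>' \<Longrightarrow> test_function \<Omega>' \<phi>"
  unfolding test_function_def by blast

lemma test_function_mult: "smooth \<psi> \<Longrightarrow> test_function \<Omega> \<phi> \<Longrightarrow> test_function \<Omega> (\<lambda>x. \<psi> x * \<phi> x)"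
  unfolding test_function_def by (auto intro: smooth_mult)

lemma iter_deriv_zero_outside:
  assumes "closed K" "\<And>x. x \<notin> K \<Longrightarrow> \<phi> x = 0" "x \<notin> K"
  shows "iter_deriv es \<phi> x = 0"
  using \<open>x \<notin> K\<close>
proof (induction es arbitrary: x)
  case Nil
  then show ?case using assms by simp
next
  case (Cons e es)
  have "((\<lambda>_. 0) has_derivative (\<lambda>_. 0)) (at x)" by simp
  then have "(iter_deriv es \<phi> has_derivative (\<lambda>_. 0)) (at x)"
    by (rule has_derivative_transform_within_open[where s="- K"])
       (use Cons assms(1) in auto)
  then show ?case by (simp add: iter_deriv.simps frechet_derivative_at[symmetric])
qed

lemma test_function_iter_deriv:
  assumes "test_function \<Omega> \<phi>" "es \<in> lists Basis"
  shows "test_function \<Omega> (iter_deriv es \<phi>)"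
proof -
  obtain K where K: "smooth \<phi>" "compact K" "K \<subseteq> \<Omega>" "\<And>x. x \<notin> K \<Longrightarrow> \<phi> x = 0"
    using assms(1) unfolding test_function_def by blast
  then show ?thesis
    using assms(2) by (intro test_functionI[OF smooth_iter_deriv K(2,3)] iter_deriv_zero_outside)
      (auto intro: compact_imp_closed)
qed

lemma test_function_bounded:
  assumes "test_function \<Omega> \<phi>"
  obtains C where "\<And>x. \<bar>\<phi> x\<bar> \<le> C"
proof -
  obtain K where K: "smooth \<phi>" "compact K" "K \<subseteq> \<Omega>" "\<And>x. x \<notin> K \<Longrightarrow> \<phi> x = 0"
    using assms(1) unfolding test_function_def by blast
  have "bounded (\<phi> ` K)"
    using K by (intro compact_imp_bounded compact_continuous_image smooth_continuous_on)
  then obtain C where C: "\<And>x. x \<in> K \<Longrightarrow> \<bar>\<phi> x\<bar> \<le> C"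
    unfolding bounded_iff by auto
  have "\<bar>\<phi> x\<bar> \<le> max C 0" for x
    using C[of x] K(4)[of x] by (cases "x \<in> K") auto
  then show ?thesis by (rule that)
qed


lemma test_function_affine:
  fixes \<phi> :: "'a::euclidean_space \<Rightarrow> real"
  assumes "test_function UNIV \<phi>" "s \<noteq> 0"
  shows "test_function UNIV (\<lambda>x. \<phi> (c + s *\<^sub>R x))"
proof -
  obtain K where K: "smooth \<phi>" "compact K" "\<And>x. x \<notin> K \<Longrightarrow> \<phi> x = 0"
    using assms(1) unfolding test_function_def by blast
  let ?K = "(\<lambda>y. (1 / s) *\<^sub>R (y - c)) ` K"
  have "smooth (\<lambda>x. \<phi> (c + s *\<^sub>R x))"
    by (rule smooth_affine[OF K(1)]) (simp add: linear_iff algebra_simps)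
  moreover have "compact ?K"
    by (intro compact_continuous_image K continuous_intros)
  moreover have "\<phi> (c + s *\<^sub>R x) = 0" if "x \<notin> ?K" for x
  proof (rule K(3), rule notI)
    assume "c + s *\<^sub>R x \<in> K"
    then have "x \<in> ?K" using assms(2) by (intro image_eqI[of _ _ "c + s *\<^sub>R x"]) auto
    then show False using that by simp
  qed
  ultimately show ?thesis by (intro test_functionI) auto
qed

lemma sum_Basis_inner_left:
  assumes "e \<in> (Basis :: 'a::euclidean_space set)"
  shows "(\<Sum>b\<in>Basis. ((s *\<^sub>R e) \<bullet> b) * f b) = s * f e"
proof -
  have "(\<Sum>b\<in>Basis. ((s *\<^sub>R e) \<bullet> b) * f b) = (\<Sum>b\<in>Basis. if b = e then s * f e else 0)"
    using assms by (intro sum.cong) (auto simp: inner_Basis)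
  then show ?thesis using assms by simp
qed

lemma iter_deriv_scale:
  assumes "smooth \<phi>" "e \<in> Basis"
  shows "iter_deriv [e] (\<lambda>x. \<phi> (c + s *\<^sub>R x)) = (\<lambda>x. s * iter_deriv [e] \<phi> (c + s *\<^sub>R x))"
proof -
  have "linear (\<lambda>x::'a. s *\<^sub>R x)" by (simp add: linear_iff algebra_simps)
  note iter_deriv_affine(1)[OF assms(1) this, of e c]
  also have "(\<lambda>x. \<Sum>b\<in>Basis. ((s *\<^sub>R e) \<bullet> b) * iter_deriv [b] \<phi> (c + s *\<^sub>R x)) =
     (\<lambda>x. s * iter_deriv [e] \<phi> (c + s *\<^sub>R x))"
    by (simp only: sum_Basis_inner_left[OF assms(2)])
  finally show ?thesis .
qed

lemma smooth_line_derivative: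
  fixes \<phi> :: "'a::euclidean_space \<Rightarrow> real"
  assumes "smooth \<phi>" "e \<in> Basis"
  shows "((\<lambda>s. \<phi> (x + s *\<^sub>R e)) has_real_derivative iter_deriv [e] \<phi> (x + s *\<^sub>R e)) (at s)"
proof -
  have "((\<lambda>s. x + s *\<^sub>R e) has_derivative (\<lambda>h. h *\<^sub>R e)) (at s)"
    by (auto intro!: derivative_eq_intros)
  then have "((\<lambda>s. \<phi> (x + s *\<^sub>R e)) has_derivative
      (\<lambda>h. \<Sum>b\<in>Basis. ((h *\<^sub>R e) \<bullet> b) * iter_deriv [b] \<phi> (x + s *\<^sub>R e))) (at s)"
    by (rule has_derivative_compose) (rule smooth_has_derivative[OF assms(1)])
  also have "(\<lambda>h. \<Sum>b\<in>Basis. ((h *\<^sub>R e) \<bullet> b) * iter_deriv [b] \<phi> (x + s *\<^sub>R e)) =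
      (*) (iter_deriv [e] \<phi> (x + s *\<^sub>R e))"
    by (rule ext) (subst mult.commute, rule sum_Basis_inner_left[OF assms(2)])
  finally show ?thesis unfolding has_field_derivative_def .
qed

text \<open>Two applications of the mean value theorem turn the second difference quotient into a mixed
  second derivative at a nearby point; the quotient is symmetric in the two directions.\<close>

lemma smooth_second_difference:
  fixes \<phi> :: "'a::euclidean_space \<Rightarrow> real"
  assumes "smooth \<phi>" "a \<in> Basis" "b \<in> Basis" "h > 0"
  shows "\<exists>y. dist y x \<le> 2 * h \<and>
    \<phi> (x + h *\<^sub>R a + h *\<^sub>R b) - \<phi> (x + h *\<^sub>R a) - \<phi> (x + h *\<^sub>R b) + \<phi> x
      = h * h * iter_deriv [b, a] \<phi> y"
proof -
  let ?u = "\<lambda>s. \<phi> ((x + h *\<^sub>R b) + s *\<^sub>R a) - \<phi> (x + s *\<^sub>R a)"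
  have "(?u has_real_derivative iter_deriv [a] \<phi> ((x + h *\<^sub>R b) + s *\<^sub>R a) - iter_deriv [a] \<phi> (x + s *\<^sub>R a)) (at s)" for s
    using assms by (intro DERIV_diff smooth_line_derivative)
  then have "\<exists>s>0. s < h \<and>
    ?u h - ?u 0 = (h - 0) * (iter_deriv [a] \<phi> ((x + h *\<^sub>R b) + s *\<^sub>R a) - iter_deriv [a] \<phi> (x + s *\<^sub>R a))"
    by (intro MVT2 assms(4))
  then obtain s where s: "0 < s" "s < h"
    "?u h - ?u 0 = (h - 0) * (iter_deriv [a] \<phi> ((x + h *\<^sub>R b) + s *\<^sub>R a) - iter_deriv [a] \<phi> (x + s *\<^sub>R a))"
    by (elim exE conjE)
  have "smooth (iter_deriv [a] \<phi>)" by (rule smooth_iter_deriv) (use assms in auto)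
  then have "((\<lambda>t. iter_deriv [a] \<phi> ((x + s *\<^sub>R a) + t *\<^sub>R b)) has_real_derivative
      iter_deriv [b] (iter_deriv [a] \<phi>) ((x + s *\<^sub>R a) + t *\<^sub>R b)) (at t)" for t
    using assms by (intro smooth_line_derivative)
  then have "\<exists>t>0. t < h \<and>
    iter_deriv [a] \<phi> ((x + s *\<^sub>R a) + h *\<^sub>R b) - iter_deriv [a] \<phi> ((x + s *\<^sub>R a) + 0 *\<^sub>R b) =
      (h - 0) * iter_deriv [b] (iter_deriv [a] \<phi>) ((x + s *\<^sub>R a) + t *\<^sub>R b)"
    by (intro MVT2[where f="\<lambda>t. iter_deriv [a] \<phi> ((x + s *\<^sub>R a) + t *\<^sub>R b)"] assms(4))
  then obtain t where t: "0 < t" "t < h"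
    "iter_deriv [a] \<phi> ((x + s *\<^sub>R a) + h *\<^sub>R b) - iter_deriv [a] \<phi> ((x + s *\<^sub>R a) + 0 *\<^sub>R b) =
      (h - 0) * iter_deriv [b] (iter_deriv [a] \<phi>) ((x + s *\<^sub>R a) + t *\<^sub>R b)"
    by (elim exE conjE)
  have "dist (x + s *\<^sub>R a + t *\<^sub>R b) x \<le> 2 * h"
  proof -
    have "norm (s *\<^sub>R a + t *\<^sub>R b) \<le> norm (s *\<^sub>R a) + norm (t *\<^sub>R b)" by (rule norm_triangle_ineq)
    also have "\<dots> \<le> 2 * h" using s t assms by simp
    finally show ?thesis by (simp add: dist_norm add.assoc)
  qed
  moreover have "\<phi> (x + h *\<^sub>R a + h *\<^sub>R b) - \<phi> (x + h *\<^sub>R a) - \<phi> (x + h *\<^sub>R b) + \<phi> x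
      = h * h * iter_deriv [b, a] \<phi> (x + s *\<^sub>R a + t *\<^sub>R b)"
  proof -
    have "iter_deriv [a] \<phi> ((x + h *\<^sub>R b) + s *\<^sub>R a) - iter_deriv [a] \<phi> (x + s *\<^sub>R a) =
        h * iter_deriv [b, a] \<phi> (x + s *\<^sub>R a + t *\<^sub>R b)"
      using t(3) iter_deriv_append[of "[b]" "[a]" \<phi>] by (simp add: ac_simps)
    then show ?thesis using s(3) by (simp add: ac_simps)
  qed
  ultimately show ?thesis by blast
qed

lemma smooth_mixed_derivatives:
  fixes \<phi> :: "'a::euclidean_space \<Rightarrow> real"
  assumes "smooth \<phi>" "a \<in> Basis" "b \<in> Basis"
  shows "iter_deriv [b, a] \<phi> = iter_deriv [a, b] \<phi>"
proof
  fix x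
  define h :: "nat \<Rightarrow> real" where "h n = 1 / Suc n" for n
  have h: "h n > 0" for n by (simp add: h_def)
  define \<Delta> where "\<Delta> n = (\<phi> (x + h n *\<^sub>R a + h n *\<^sub>R b) - \<phi> (x + h n *\<^sub>R a) - \<phi> (x + h n *\<^sub>R b) + \<phi> x) / (h n * h n)" for n
  have h0: "(\<lambda>n. 2 * h n) \<longlonglongrightarrow> 0"
    using tendsto_mult[OF tendsto_const[of 2] LIMSEQ_inverse_real_of_nat]
    by (simp add: h_def inverse_eq_divide)
  have lim: "\<Delta> \<longlonglongrightarrow> iter_deriv [d, c] \<phi> x" if "c \<in> Basis" "d \<in> Basis"
    and *: "\<And>n. \<exists>y. dist y x \<le> 2 * h n \<and> \<Delta> n = iter_deriv [d, c] \<phi> y" for c d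
  proof -
    obtain y where y: "\<And>n. dist (y n) x \<le> 2 * h n" "\<And>n. \<Delta> n = iter_deriv [d, c] \<phi> (y n)"
      using * by metis
    have "y \<longlonglongrightarrow> x"
      unfolding tendsto_dist_iff[of y]
      by (rule tendsto_sandwich[OF _ _ tendsto_const h0]) (use y(1) in \<open>auto intro!: always_eventually\<close>)
    moreover have "smooth (iter_deriv [d, c] \<phi>)"
      using that assms by (intro smooth_iter_deriv) auto
    then have "isCont (iter_deriv [d, c] \<phi>) x"
      by (intro differentiable_imp_continuous_within smooth_differentiable)
    ultimately show ?thesis
      unfolding y(2) by (rule isCont_tendsto_compose[rotated])
  qed
  have "\<Delta> \<longlonglongrightarrow> iter_deriv [b, a] \<phi> x"
  proof (rule lim[OF assms(2,3)])
    fix n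
    show "\<exists>y. dist y x \<le> 2 * h n \<and> \<Delta> n = iter_deriv [b, a] \<phi> y"
      using smooth_second_difference[OF assms(1,2,3) h[of n], of x] h[of n]
      unfolding \<Delta>_def by (metis nonzero_mult_div_cancel_left mult_eq_0_iff less_irrefl)
  qed
  moreover have "\<Delta> \<longlonglongrightarrow> iter_deriv [a, b] \<phi> x"
  proof (rule lim[OF assms(3,2)])
    fix n
    have "\<Delta> n = (\<phi> (x + h n *\<^sub>R b + h n *\<^sub>R a) - \<phi> (x + h n *\<^sub>R b) - \<phi> (x + h n *\<^sub>R a) + \<phi> x) / (h n * h n)"
      unfolding \<Delta>_def by (simp add: algebra_simps)
    then show "\<exists>y. dist y x \<le> 2 * h n \<and> \<Delta> n = iter_deriv [a, b] \<phi> y"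
      using smooth_second_difference[OF assms(1,3,2) h[of n], of x] h[of n]
      by (metis nonzero_mult_div_cancel_left mult_eq_0_iff less_irrefl)
  qed
  ultimately show "iter_deriv [b, a] \<phi> x = iter_deriv [a, b] \<phi> x"
    by (rule LIMSEQ_unique)
qed

section \<open>Continuity of translations\<close>

lemma
  fixes f :: "'a::euclidean_space \<Rightarrow> real"
  assumes [measurable]: "f \<in> borel_measurable borel"
  shows lborel_integral_translation: "(LBINT x. f (x + z)) = (LBINT x. f x)"
    and lborel_integrable_translation: "integrable lborel (\<lambda>x. f (x + z)) \<longleftrightarrow> integrable lborel f"
proof -
  have "(LBINT x. f x) = (\<integral>x. f x \<partial>distr lborel borel ((+) z))"
    by (simp only: lborel_distr_plus)
  then show "(LBINT x. f (x + z)) = (LBINT x. f x)"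
    by (simp add: integral_distr add.commute)
  have "integrable lborel f \<longleftrightarrow> integrable (distr lborel borel ((+) z)) f"
    by (simp only: lborel_distr_plus)
  then show "integrable lborel (\<lambda>x. f (x + z)) \<longleftrightarrow> integrable lborel f"
    by (simp add: integrable_distr_eq add.commute)
qed

text \<open>The integrals of \<open>indicator U (x + z)\<close> and \<open>indicator U x\<close> agree, so the integral of the absolute
  difference is twice that of its negative part.  The latter is dominated by \<open>indicator U\<close> and tends
  to zero pointwise, because \<open>U\<close> is open.\<close>

lemma translation_L1_open:
  fixes U :: "'a::euclidean_space set"
  assumes "open U" "emeasure lborel U < \<infinity>" "z \<longlonglongrightarrow> 0"
  shows "(\<lambda>n. LBINT x. \<bar>indicator U (x + z n) - indicator U x :: real\<bar>) \<longlonglongrightarrow> 0"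
proof -
  have [measurable]: "U \<in> sets borel" using assms by simp
  let ?I = "\<lambda>x. indicator U x :: real"
  have int: "integrable lborel ?I" using assms(2) by simp
  have intz: "integrable lborel (\<lambda>x. ?I (x + w))" for w
    using int by (subst lborel_integrable_translation) auto
  let ?p = "\<lambda>n x. max 0 (?I x - ?I (x + z n))"
  have "(LBINT x. \<bar>?I (x + z n) - ?I x\<bar>) = 2 * (LBINT x. ?p n x)" for n
  proof -
    have "(LBINT x. \<bar>?I (x + z n) - ?I x\<bar>) = (LBINT x. (?I (x + z n) - ?I x) + 2 * ?p n x)"
      by (intro Bochner_Integration.integral_cong) (auto simp: max_def)
    also have "\<dots> = (LBINT x. ?I (x + z n)) - (LBINT x. ?I x) + 2 * (LBINT x. ?p n x)"
      using int intz by simp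
    also have "(LBINT x. ?I (x + z n)) = (LBINT x. ?I x)"
      by (rule lborel_integral_translation) auto
    finally show ?thesis by simp
  qed
  moreover have "(\<lambda>n. LBINT x. ?p n x) \<longlonglongrightarrow> (\<integral>x. 0 \<partial>(lborel :: 'a measure))"
  proof (rule integral_dominated_convergence[OF _ _ int])
    show "AE x in lborel. (\<lambda>n. ?p n x) \<longlonglongrightarrow> 0"
    proof (intro AE_I2)
      fix x
      show "(\<lambda>n. ?p n x) \<longlonglongrightarrow> 0"
      proof (cases "x \<in> U")
        case True
        have "(\<lambda>n. x + z n) \<longlonglongrightarrow> x + 0" by (intro tendsto_intros assms)
        then have "\<forall>\<^sub>F n in sequentially. x + z n \<in> U"
          using True assms(1) by (auto intro: topological_tendstoD)
        then have "\<forall>\<^sub>F n in sequentially. ?p n x = 0"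
          by (rule eventually_mono) (use True in auto)
        then show ?thesis by (rule tendsto_eventually)
      qed (auto simp: indicator_def)
    qed
    show "AE x in lborel. norm (?p n x) \<le> ?I x" for n
      by (auto simp: indicator_def)
  qed auto
  ultimately show ?thesis
    using tendsto_mult_right_zero by fastforce
qed

text \<open>Measurable sets of finite measure are approximated from outside by open sets; the rest is
  approximation by simple functions.\<close>

lemma translation_L1:
  fixes f :: "'a::euclidean_space \<Rightarrow> real"
  assumes "integrable lborel f" "z \<longlonglongrightarrow> 0"
  shows "(\<lambda>n. LBINT x. \<bar>f (x + z n) - f x\<bar>) \<longlonglongrightarrow> 0"
  using assms(1)
proof (induction rule: integrable_induct)
  case (base A c)
  then have [measurable]: "A \<in> sets borel" by simp
  let ?I = "\<lambda>A x. indicator A x :: real"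
  have "(\<lambda>n. LBINT x. \<bar>?I A (x + z n) - ?I A x\<bar>) \<longlonglongrightarrow> 0"
  proof (rule LIMSEQ_I)
    fix r :: real assume "r > 0"
    obtain U where U: "open U" "A \<subseteq> U" "U - A \<in> lmeasurable" "emeasure lebesgue (U - A) < ennreal (r / 4)"
      using sets_lebesgue_outer_open[of A "r / 4"] \<open>r > 0\<close> by auto
    have [measurable]: "U \<in> sets borel" using U by simp
    have UA: "emeasure lborel (U - A) < ennreal (r / 4)" using U by simp
    have "emeasure lborel U \<le> emeasure lborel (U - A) + emeasure lborel A"
      using U(2) by (subst plus_emeasure) (auto intro!: emeasure_mono)
    also have "\<dots> < \<infinity>" using UA base by (auto simp: less_top[symmetric] top_unique)
    finally have Ufin: "emeasure lborel U < \<infinity>" .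
    have UA': "emeasure lborel (U - A) < \<infinity>"
      using UA by (rule order.strict_trans) simp
    have intA: "integrable lborel (?I A)" and intD: "integrable lborel (?I (U - A))"
      and intU: "integrable lborel (?I U)"
      using base UA' Ufin by (auto simp: less_top[symmetric] top_unique)
    have tr: "integrable lborel (\<lambda>x. ?I S (x + w))" if "integrable lborel (?I S)" "S \<in> sets borel" for S w
      using that by (subst lborel_integrable_translation) auto
    have D: "(LBINT x. ?I (U - A) x) < r / 4"
    proof -
      have "ennreal (measure lborel (U - A)) < ennreal (r / 4)"
        using UA by (subst emeasure_eq_ennreal_measure[symmetric]) auto
      then show ?thesis using \<open>r > 0\<close> by (simp add: ennreal_less_iff)
    qed
    have "\<forall>\<^sub>F n in sequentially. (LBINT x. \<bar>?I U (x + z n) - ?I U x\<bar>) < r / 2"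
      using order_tendstoD(2)[OF translation_L1_open[OF U(1) Ufin assms(2)], of "r / 2"] \<open>r > 0\<close> by simp
    then have "\<forall>\<^sub>F n in sequentially. norm ((LBINT x. \<bar>?I A (x + z n) - ?I A x\<bar>) - 0) < r"
    proof eventually_elim
      case (elim n)
      have "(LBINT x. \<bar>?I A (x + z n) - ?I A x\<bar>) \<le>
        (LBINT x. \<bar>?I U (x + z n) - ?I U x\<bar> + ?I (U - A) (x + z n) + ?I (U - A) x)"
        using U(2)
        by (intro integral_mono integrable_abs Bochner_Integration.integrable_add Bochner_Integration.integrable_diff tr intA intD intU)
           (auto simp: indicator_def)
      also have "\<dots> = (LBINT x. \<bar>?I U (x + z n) - ?I U x\<bar>) + (LBINT x. ?I (U - A) (x + z n)) + (LBINT x. ?I (U - A) x)"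
        using tr[OF intU] tr[OF intD] intU intD by simp
      also have "(LBINT x. ?I (U - A) (x + z n)) = (LBINT x. ?I (U - A) x)"
        by (rule lborel_integral_translation) auto
      finally have "(LBINT x. \<bar>?I A (x + z n) - ?I A x\<bar>) < r" using D elim by linarith
      moreover have "0 \<le> (LBINT x. \<bar>?I A (x + z n) - ?I A x\<bar>)" by simp
      ultimately show ?case by simp
    qed
    then show "\<exists>no. \<forall>n\<ge>no. norm ((LBINT x. \<bar>?I A (x + z n) - ?I A x\<bar>) - 0) < r"
      by (simp add: eventually_sequentially)
  qed
  then have "(\<lambda>n. \<bar>c\<bar> * (LBINT x. \<bar>?I A (x + z n) - ?I A x\<bar>)) \<longlonglongrightarrow> 0"
    by (rule tendsto_mult_right_zero)
  moreover have "\<bar>c\<bar> * (LBINT x. \<bar>?I A (x + z n) - ?I A x\<bar>) =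
    (LBINT x. \<bar>indicat_real A (x + z n) *\<^sub>R c - indicat_real A x *\<^sub>R c\<bar>)" for n
    by (subst integral_mult_right_zero[symmetric])
       (auto intro!: Bochner_Integration.integral_cong simp: indicator_def abs_mult[symmetric] algebra_simps)
  ultimately show ?case by simp
next
  case (add f g)
  have [measurable]: "f \<in> borel_measurable borel" "g \<in> borel_measurable borel"
    using add borel_measurable_integrable by auto
  have tr: "integrable lborel (\<lambda>x. f (x + w))" "integrable lborel (\<lambda>x. g (x + w))" for w
    using add by (auto simp: lborel_integrable_translation)
  show ?case
  proof (rule tendsto_sandwich[OF _ _ tendsto_const])
    show "\<forall>\<^sub>F n in sequentially. (LBINT x. \<bar>f (x + z n) + g (x + z n) - (f x + g x)\<bar>) \<le>
      (LBINT x. \<bar>f (x + z n) - f x\<bar>) + (LBINT x. \<bar>g (x + z n) - g x\<bar>)"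
    proof (intro always_eventually allI)
      fix n
      have "(LBINT x. \<bar>f (x + z n) + g (x + z n) - (f x + g x)\<bar>) \<le>
        (LBINT x. \<bar>f (x + z n) - f x\<bar> + \<bar>g (x + z n) - g x\<bar>)"
        using add(1,2) tr by (intro integral_mono) auto
      then show "(LBINT x. \<bar>f (x + z n) + g (x + z n) - (f x + g x)\<bar>) \<le>
        (LBINT x. \<bar>f (x + z n) - f x\<bar>) + (LBINT x. \<bar>g (x + z n) - g x\<bar>)"
        using add(1,2) tr by simp
    qed
    show "(\<lambda>n. (LBINT x. \<bar>f (x + z n) - f x\<bar>) + (LBINT x. \<bar>g (x + z n) - g x\<bar>)) \<longlonglongrightarrow> 0"
      using tendsto_add[OF add(3,4)] by simp
  qed simp
next
  case (lim f s)
  have [measurable]: "f \<in> borel_measurable borel" "\<And>i. s i \<in> borel_measurable borel"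
    using lim borel_measurable_integrable by auto
  have sf: "(\<lambda>i. LBINT x. \<bar>s i x - f x\<bar>) \<longlonglongrightarrow> (\<integral>x. 0 \<partial>(lborel :: 'a measure))"
  proof (rule integral_dominated_convergence[where w="\<lambda>x. 3 * norm (f x)"])
    show "AE x in lborel. (\<lambda>i. \<bar>s i x - f x\<bar>) \<longlonglongrightarrow> 0"
      using lim(2) by (intro AE_I2 tendsto_rabs_zero LIM_zero) auto
    show "AE x in lborel. norm \<bar>s i x - f x\<bar> \<le> 3 * norm (f x)" for i
      using lim(3)[of _ i] by (intro AE_I2) (smt (verit) real_norm_def UNIV_I space_lborel space_borel)
  qed (use lim in auto)
  show ?case
  proof (rule LIMSEQ_I)
    fix r :: real assume "r > 0"
    have "\<forall>\<^sub>F i in sequentially. (LBINT x. \<bar>s i x - f x\<bar>) < r / 3"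
      using order_tendstoD(2)[OF sf, of "r / 3"] \<open>r > 0\<close> by simp
    then obtain i where i: "(LBINT x. \<bar>s i x - f x\<bar>) < r / 3"
      using eventually_happens by force
    have "\<forall>\<^sub>F n in sequentially. (LBINT x. \<bar>s i (x + z n) - s i x\<bar>) < r / 3"
      using order_tendstoD(2)[OF lim(5)[of i], of "r / 3"] \<open>r > 0\<close> by simp
    then have "\<forall>\<^sub>F n in sequentially. norm ((LBINT x. \<bar>f (x + z n) - f x\<bar>) - 0) < r"
    proof eventually_elim
      case (elim n)
      let ?d = "\<lambda>x. \<bar>s i x - f x\<bar>"
      have ints: "integrable lborel (s i)" "integrable lborel (\<lambda>x. s i (x + z n))"
        "integrable lborel f" "integrable lborel (\<lambda>x. f (x + z n))" "integrable lborel ?d"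
        "integrable lborel (\<lambda>x. ?d (x + z n))"
        using lim(1,4) by (auto simp: lborel_integrable_translation lborel_integrable_translation[of ?d])
      have "(LBINT x. \<bar>f (x + z n) - f x\<bar>) \<le>
        (LBINT x. \<bar>s i (x + z n) - s i x\<bar> + ?d (x + z n) + ?d x)"
        using ints by (intro integral_mono) auto
      also have "\<dots> = (LBINT x. \<bar>s i (x + z n) - s i x\<bar>) + (LBINT x. ?d (x + z n)) + (LBINT x. ?d x)"
        using ints by simp
      also have "(LBINT x. ?d (x + z n)) = (LBINT x. ?d x)"
        by (rule lborel_integral_translation) auto
      finally show ?case using i elim by simp
    qed
    then show "\<exists>no. \<forall>n\<ge>no. norm ((LBINT x. \<bar>f (x + z n) - f x\<bar>) - 0) < r"
      by (simp add: eventually_sequentially)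
  qed
qed

text \<open>The inequality \<open>(a - b)\<^sup>2 \<le> 2 |a |a| - b |b||\<close> reduces the claim to the integrable function
  \<open>g |g|\<close>.\<close>

lemma translation_L2:
  fixes g :: "'a::euclidean_space \<Rightarrow> real"
  assumes [measurable]: "g \<in> borel_measurable borel" and g: "integrable lborel (\<lambda>x. (g x)\<^sup>2)"
    and "z \<longlonglongrightarrow> 0"
  shows "(\<lambda>n. LBINT x. (g (x + z n) - g x)\<^sup>2) \<longlonglongrightarrow> 0"
    and "integrable lborel (\<lambda>x. (g (x + w) - g x)\<^sup>2)"
proof -
  let ?G = "\<lambda>x. g x * \<bar>g x\<bar>"
  have G: "integrable lborel ?G"
    by (rule Bochner_Integration.integrable_bound[OF g]) (auto simp: power2_eq_square abs_mult)
  have GT: "integrable lborel (\<lambda>x. ?G (x + w))" for w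
    using G by (subst lborel_integrable_translation[of ?G]) auto
  have *: "(a - b)\<^sup>2 \<le> 2 * \<bar>a * \<bar>a\<bar> - b * \<bar>b\<bar>\<bar>" for a b :: real
  proof -
    have "0 \<le> (a - b)\<^sup>2" "0 \<le> (a + b)\<^sup>2" by auto
    moreover have "a \<ge> 0 \<Longrightarrow> b \<ge> 0 \<Longrightarrow> a * b \<ge> 0" "a \<le> 0 \<Longrightarrow> b \<le> 0 \<Longrightarrow> a * b \<ge> 0"
      by (auto simp: mult_nonpos_nonpos)
    moreover have "(a - b)\<^sup>2 \<le> \<bar>a * a - b * b\<bar>" if "(a \<ge> 0 \<and> b \<ge> 0) \<or> (a \<le> 0 \<and> b \<le> 0)"
    proof -
      have "\<bar>a - b\<bar> \<le> \<bar>a + b\<bar>" using that by auto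
      then have "\<bar>a - b\<bar> * \<bar>a - b\<bar> \<le> \<bar>a - b\<bar> * \<bar>a + b\<bar>" by (intro mult_left_mono) auto
      then show ?thesis by (simp add: abs_mult[symmetric] power2_eq_square algebra_simps)
    qed
    ultimately show ?thesis
      by (cases "a \<ge> 0"; cases "b \<ge> 0") (auto simp: power2_eq_square algebra_simps abs_minus_commute)
  qed
  show int: "integrable lborel (\<lambda>x. (g (x + w) - g x)\<^sup>2)" for w
    by (rule Bochner_Integration.integrable_bound[where f="\<lambda>x. 2 * \<bar>?G (x + w) - ?G x\<bar>"])
       (use * G GT in auto)
  show "(\<lambda>n. LBINT x. (g (x + z n) - g x)\<^sup>2) \<longlonglongrightarrow> 0"
  proof (rule tendsto_sandwich[OF _ _ tendsto_const])
    show "\<forall>\<^sub>F n in sequentially. (LBINT x. (g (x + z n) - g x)\<^sup>2) \<le> 2 * (LBINT x. \<bar>?G (x + z n) - ?G x\<bar>)"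
    proof (intro always_eventually allI)
      fix n
      have "(LBINT x. (g (x + z n) - g x)\<^sup>2) \<le> (LBINT x. 2 * \<bar>?G (x + z n) - ?G x\<bar>)"
        by (rule integral_mono[OF int]) (use * G GT in auto)
      then show "(LBINT x. (g (x + z n) - g x)\<^sup>2) \<le> 2 * (LBINT x. \<bar>?G (x + z n) - ?G x\<bar>)"
        by simp
    qed
    show "(\<lambda>n. 2 * (LBINT x. \<bar>?G (x + z n) - ?G x\<bar>)) \<longlonglongrightarrow> 0"
      by (intro tendsto_mult_right_zero translation_L1 G assms)
  qed auto
qed


section \<open>Correlations\<close>

text \<open>Averaging the correlation \<open>z \<mapsto> \<integral> u(x) w(x + z) dx\<close> against \<open>\<sigma>\<close> is the same as integrating
  \<open>\<sigma>(y - x) u(x) w(y)\<close> over both variables.  For fixed \<open>x\<close> or fixed \<open>y\<close> the factor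
  \<open>\<sigma>(y - x)\<close> is a test function of the other variable, which is how weak derivatives come in.\<close>

lemma correlation_fubini:
  fixes u w \<sigma> :: "'a::euclidean_space \<Rightarrow> real"
  assumes [measurable]: "u \<in> borel_measurable borel" "w \<in> borel_measurable borel" "\<sigma> \<in> borel_measurable borel"
    and int: "\<And>z. integrable lborel (\<lambda>x. u x * w (x + z))"
    and bnd: "\<And>z. (LBINT x. \<bar>u x * w (x + z)\<bar>) \<le> M"
    and \<sigma>: "integrable lborel \<sigma>"
  shows "integrable lborel (\<lambda>z. \<sigma> z * (LBINT x. u x * w (x + z)))" (is ?i1)
    and "integrable lborel (\<lambda>x. LBINT y. \<sigma> (y - x) * (u x * w y))" (is ?i2)
    and "integrable lborel (\<lambda>y. LBINT x. \<sigma> (y - x) * (u x * w y))" (is ?i3)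
    and "(LBINT z. \<sigma> z * (LBINT x. u x * w (x + z))) =
         (LBINT x. LBINT y. \<sigma> (y - x) * (u x * w y))" (is ?e1)
    and "(LBINT z. \<sigma> z * (LBINT x. u x * w (x + z))) =
         (LBINT y. LBINT x. \<sigma> (y - x) * (u x * w y))" (is ?e2)
proof -
  define F where "F z x = \<sigma> z * (u x * w (x + z))" for z x
  define G where "G x y = \<sigma> (y - x) * (u x * w y)" for x y
  have [measurable]: "case_prod F \<in> borel_measurable (lborel \<Otimes>\<^sub>M lborel)"
    "case_prod G \<in> borel_measurable (lborel \<Otimes>\<^sub>M lborel)"
    unfolding F_def G_def by measurable
  have M: "0 \<le> M" by (rule order_trans[OF _ bnd[of 0]]) simp
  have F: "integrable (lborel \<Otimes>\<^sub>M lborel) (case_prod F)"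
  proof (rule lborel_pair.Fubini_integrable)
    have "integrable lborel (\<lambda>z. M * \<bar>\<sigma> z\<bar>)" using \<sigma> by simp
    then show "integrable lborel (\<lambda>z. LBINT x. norm (case_prod F (z, x)))"
    proof (rule Bochner_Integration.integrable_bound)
      show "AE z in lborel. norm (LBINT x. norm (case_prod F (z, x))) \<le> norm (M * \<bar>\<sigma> z\<bar>)"
      proof (intro AE_I2)
        fix z
        have "(LBINT x. norm (F z x)) = \<bar>\<sigma> z\<bar> * (LBINT x. \<bar>u x * w (x + z)\<bar>)"
          by (simp add: F_def abs_mult)
        also have "\<dots> \<le> \<bar>\<sigma> z\<bar> * M" by (intro mult_left_mono bnd) auto
        finally show "norm (LBINT x. norm (case_prod F (z, x))) \<le> norm (M * \<bar>\<sigma> z\<bar>)"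
          using M by (simp add: mult.commute abs_mult)
      qed
    qed measurable
    show "AE z in lborel. integrable lborel (\<lambda>x. case_prod F (z, x))"
      unfolding F_def using int by simp
  qed simp
  have FG: "F z x = G x (z + x)" for z x by (simp add: F_def G_def add.commute)
  have Gm: "G x \<in> borel_measurable borel" for x unfolding G_def by measurable
  have inner: "(LBINT z. F z x) = (LBINT y. G x y)" for x
    unfolding FG by (rule lborel_integral_translation) (rule Gm)
  have G: "integrable (lborel \<Otimes>\<^sub>M lborel) (case_prod G)"
  proof (rule lborel_pair.Fubini_integrable)
    have "(LBINT y. norm (G x y)) = (LBINT z. norm (F z x))" for x
      unfolding FG by (rule lborel_integral_translation[symmetric]) (use Gm in measurable)
    moreover have "integrable lborel (\<lambda>x. LBINT z. norm (F z x))"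
      by (rule lborel_pair.integrable_snd) (use integrable_norm[OF F] in \<open>simp add: case_prod_unfold\<close>)
    ultimately show "integrable lborel (\<lambda>x. LBINT y. norm (case_prod G (x, y)))" by simp
    have "AE x in lborel. integrable lborel (\<lambda>z. F z x)" by (rule lborel_pair.AE_integrable_snd[OF F])
    then show "AE x in lborel. integrable lborel (\<lambda>y. case_prod G (x, y))"
      unfolding FG using lborel_integrable_translation[OF Gm] by simp
  qed simp
  have Fz: "(LBINT x. F z x) = \<sigma> z * (LBINT x. u x * w (x + z))" for z
    by (simp add: F_def)
  show ?i1 using lborel_pair.integrable_fst[OF F] by (simp add: Fz)
  show ?i2 using lborel_pair.integrable_fst[OF G] by (simp add: G_def)
  show ?i3 using lborel_pair.integrable_snd[OF G] by (simp add: G_def)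
  show ?e1 using lborel_pair.Fubini_integral[OF F] by (simp add: Fz inner) (simp add: G_def)
  then show ?e2 using lborel_pair.Fubini_integral[OF G] by (simp add: G_def)
qed

lemma abs_mult_le_sum_squares: "\<bar>a * b\<bar> \<le> a\<^sup>2 + b\<^sup>2" for a b :: real
proof -
  have "0 \<le> (\<bar>a\<bar> - \<bar>b\<bar>)\<^sup>2" by simp
  then have "2 * \<bar>a * b\<bar> \<le> a\<^sup>2 + b\<^sup>2" by (simp add: power2_diff abs_mult)
  then show ?thesis by simp
qed

lemma
  fixes u w :: "'a::euclidean_space \<Rightarrow> real"
  assumes [measurable]: "u \<in> borel_measurable borel" "w \<in> borel_measurable borel"
    and u: "integrable lborel (\<lambda>x. (u x)\<^sup>2)" and w: "integrable lborel (\<lambda>x. (w x)\<^sup>2)"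
  shows correlation_L2_integrable: "integrable lborel (\<lambda>x. u x * w (x + z))"
    and correlation_L2_bound: "(LBINT x. \<bar>u x * w (x + z)\<bar>) \<le> (LBINT x. (u x)\<^sup>2) + (LBINT x. (w x)\<^sup>2)"
    and correlation_L2_continuous: "h \<longlonglongrightarrow> 0 \<Longrightarrow>
      (\<lambda>n. LBINT x. u x * w (x + h n)) \<longlonglongrightarrow> (LBINT x. u x * w (x + 0))"
proof -
  have wz: "integrable lborel (\<lambda>x. (w (x + z))\<^sup>2)" for z
    using w by (subst lborel_integrable_translation[of "\<lambda>x. (w x)\<^sup>2"]) auto
  note * = abs_mult_le_sum_squares
  show int: "integrable lborel (\<lambda>x. u x * w (x + z))" for z
    by (rule Bochner_Integration.integrable_bound[OF Bochner_Integration.integrable_add[OF u wz[of z]]])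
       (use * in auto)
  have "(LBINT x. \<bar>u x * w (x + z)\<bar>) \<le> (LBINT x. (u x)\<^sup>2 + (w (x + z))\<^sup>2)"
    using int u wz * by (intro integral_mono) auto
  also have "\<dots> = (LBINT x. (u x)\<^sup>2) + (LBINT x. (w (x + z))\<^sup>2)"
    using u wz by simp
  also have "(LBINT x. (w (x + z))\<^sup>2) = (LBINT x. (w x)\<^sup>2)"
    by (rule lborel_integral_translation) auto
  finally show "(LBINT x. \<bar>u x * w (x + z)\<bar>) \<le> (LBINT x. (u x)\<^sup>2) + (LBINT x. (w x)\<^sup>2)" .
  assume h: "h \<longlonglongrightarrow> 0"
  show "(\<lambda>n. LBINT x. u x * w (x + h n)) \<longlonglongrightarrow> (LBINT x. u x * w (x + 0))"
  proof (rule LIMSEQ_I)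
    fix r :: real assume r: "r > 0"
    define U where "U = (LBINT x. (u x)\<^sup>2)"
    have U: "U \<ge> 0" by (simp add: U_def)
    define \<delta> where "\<delta> = r / (U + 1)"
    have \<delta>: "\<delta> > 0" "\<delta> * U < r" using r U by (auto simp: \<delta>_def field_simps)
    define D where "D n = (LBINT x. (w (x + h n) - w x)\<^sup>2)" for n
    have "\<forall>\<^sub>F n in sequentially. D n < \<delta> * r"
      using translation_L2(1)[OF _ w h] \<delta> r unfolding D_def by (auto intro: order_tendstoD)
    then have "\<forall>\<^sub>F n in sequentially. norm ((LBINT x. u x * w (x + h n)) - (LBINT x. u x * w (x + 0))) < r"
    proof eventually_elim
      case (elim n)
      have i: "integrable lborel (\<lambda>x. u x * (w (x + h n) - w x))"
        using Bochner_Integration.integrable_diff[OF int[of "h n"] int[of 0]] by (simp add: algebra_simps)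
      have D: "integrable lborel (\<lambda>x. (w (x + h n) - w x)\<^sup>2)" by (rule translation_L2(2)[OF _ w h]) simp
      have amgm: "\<bar>a * b\<bar> \<le> \<delta> / 2 * a\<^sup>2 + 1 / (2 * \<delta>) * b\<^sup>2" for a b
      proof -
        have "0 \<le> (\<delta> * \<bar>a\<bar> - \<bar>b\<bar>)\<^sup>2" by simp
        then have "2 * \<delta> * \<bar>a * b\<bar> \<le> \<delta>\<^sup>2 * a\<^sup>2 + b\<^sup>2"
          by (simp add: power2_diff abs_mult power_mult_distrib mult.assoc)
        then have "\<bar>a * b\<bar> \<le> (\<delta>\<^sup>2 * a\<^sup>2 + b\<^sup>2) / (2 * \<delta>)"
          using \<delta> by (simp add: pos_le_divide_eq mult.commute)
        also have "\<dots> = \<delta> / 2 * a\<^sup>2 + 1 / (2 * \<delta>) * b\<^sup>2"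
          using \<delta> by (simp add: field_simps power2_eq_square)
        finally show ?thesis .
      qed
      have "(LBINT x. u x * w (x + h n)) - (LBINT x. u x * w (x + 0)) = (LBINT x. u x * (w (x + h n) - w x))"
        using Bochner_Integration.integral_diff[OF int[of "h n"] int[of 0]] by (simp add: algebra_simps)
      also have "norm \<dots> \<le> (LBINT x. \<bar>u x * (w (x + h n) - w x)\<bar>)"
        using integral_norm_bound[of lborel "\<lambda>x. u x * (w (x + h n) - w x)"] by simp
      also have "\<dots> \<le> (LBINT x. \<delta> / 2 * (u x)\<^sup>2 + 1 / (2 * \<delta>) * (w (x + h n) - w x)\<^sup>2)"
        using i u D amgm by (intro integral_mono) auto
      also have "\<dots> = \<delta> / 2 * U + 1 / (2 * \<delta>) * D n"
        using u D by (simp add: U_def D_def)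
      also have "\<dots> < r"
      proof -
        have "1 / (2 * \<delta>) * D n < r / 2" using elim \<delta> by (simp add: field_simps)
        then show ?thesis using \<delta> by simp
      qed
      finally show ?case .
    qed
    then show "\<exists>no. \<forall>n\<ge>no. norm ((LBINT x. u x * w (x + h n)) - (LBINT x. u x * w (x + 0))) < r"
      by (simp add: eventually_sequentially)
  qed
qed

text \<open>If \<open>T 0\<close> were nonzero, \<open>T\<close> would keep its sign on the support of a bump close to \<open>0\<close>.\<close>

lemma vanishes_at_0:
  fixes T :: "'a::euclidean_space \<Rightarrow> real"
  assumes cont: "\<And>h. h \<longlonglongrightarrow> 0 \<Longrightarrow> (\<lambda>n. T (h n)) \<longlonglongrightarrow> T 0" and "d > 0"
    and int: "\<And>\<rho>. test_function (ball 0 d) \<rho> \<Longrightarrow> integrable lborel (\<lambda>z. \<rho> z * T z)"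
    and zero: "\<And>\<rho>. test_function (ball 0 d) \<rho> \<Longrightarrow> (LBINT z. \<rho> z * T z) = 0"
  shows "T 0 = 0"
proof (rule ccontr)
  assume T0: "T 0 \<noteq> 0"
  have "isCont (\<lambda>z. T z * T 0) 0"
    unfolding continuous_within_sequentially o_def using cont by (auto intro!: tendsto_intros)
  then have "\<forall>\<^sub>F z in at 0. T z * T 0 > 0"
    unfolding isCont_def using T0 by (intro order_tendstoD(1)[where y="T 0 * T 0"]) (auto simp: zero_less_mult_iff not_less le_less)
  then obtain e where e: "e > 0" "\<And>z. dist z 0 < e \<Longrightarrow> z \<noteq> 0 \<Longrightarrow> T z * T 0 > 0"
    unfolding eventually_at by auto
  have pos: "T z * T 0 > 0" if "z \<in> ball 0 e" for z
    using e(2)[of z] T0 that by (cases "z = 0") (auto simp: zero_less_mult_iff not_less le_less dist_commute)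
  obtain \<rho> :: "'a \<Rightarrow> real" where \<rho>: "test_function (ball 0 (min d e)) \<rho>" "\<And>x. 0 \<le> \<rho> x" "\<rho> 0 > 0"
    using bump_exists[of "min d e" 0] \<open>d > 0\<close> e(1) by (metis min_less_iff_conj)
  have \<rho>d: "test_function (ball 0 d) \<rho>" using \<rho>(1) by (rule test_function_mono) auto
  have \<rho>e: "\<rho> x = 0" if "x \<notin> ball 0 e" for x
    using \<rho>(1) that unfolding test_function_def by auto
  have nonneg: "0 \<le> \<rho> z * T z * T 0" for z
    using pos[of z] \<rho>(2)[of z] \<rho>e[of z] by (cases "z \<in> ball 0 e") (auto simp: mult.assoc)
  have "(LBINT z. \<rho> z * T z * T 0) = 0" using zero[OF \<rho>d] by simp
  then have ae: "AE z in lborel. \<rho> z * T z * T 0 = 0"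
    using int[OF \<rho>d] nonneg by (subst (asm) integral_nonneg_eq_0_iff_AE) auto
  let ?S = "\<rho> -` {0<..}"
  have "open ?S"
    by (intro open_vimage smooth_continuous_on[OF test_function_smooth[OF \<rho>(1)]]) auto
  have "0 \<in> ?S" using \<rho>(3) by simp
  have nz: "\<rho> z * T z * T 0 \<noteq> 0" if "z \<in> ?S" for z
    using pos[of z] \<rho>e[of z] that by (cases "z \<in> ball 0 e") auto
  have "AE z in lebesgue. z \<notin> ?S"
    using AE_completion[OF ae] by (rule eventually_mono) (use nz in blast)
  then have "negligible ?S"
    unfolding negligible_iff_null_sets by (subst AE_iff_null_sets) (use \<open>open ?S\<close> in auto)
  then show False using open_not_negligible \<open>open ?S\<close> \<open>0 \<in> ?S\<close> by blast
qed

section \<open>Calculus of weak derivatives\<close>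

lemma lebesgue_test_integral:
  assumes "test_function \<Omega> \<phi>" "es \<in> lists Basis"
  shows "(LINT x:\<Omega>|lebesgue. f x * iter_deriv es \<phi> x) = (LINT x|lebesgue. f x * iter_deriv es \<phi> x)"
proof -
  have "test_function \<Omega> (iter_deriv es \<phi>)" by (rule test_function_iter_deriv[OF assms])
  then have "iter_deriv es \<phi> x = 0" if "x \<notin> \<Omega>" for x
    using that unfolding test_function_def by blast
  then show ?thesis
    unfolding set_lebesgue_integral_def
    by (intro Bochner_Integration.integral_cong refl) (auto simp: indicator_def)
qed

lemma has_weak_deriv_iff:
  assumes "es \<in> lists Basis"
  shows "has_weak_deriv \<Omega> es f g \<longleftrightarrow>
     locally_integrable \<Omega> f \<and> locally_integrable \<Omega> g \<and>
     (\<forall>\<phi>. test_function \<Omega> \<phi> \<longrightarrow>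
        (LINT x|lebesgue. f x * iter_deriv es \<phi> x) = (- 1) ^ length es * (LINT x|lebesgue. g x * \<phi> x))"
  unfolding has_weak_deriv_def
  using lebesgue_test_integral[OF _ assms] lebesgue_test_integral[of \<Omega> _ "[]"] by auto

lemma has_weak_derivD:
  assumes "has_weak_deriv \<Omega> [e] f g" "e \<in> Basis" "test_function \<Omega> \<phi>"
  shows "(LINT x|lebesgue. f x * iter_deriv [e] \<phi> x) = - (LINT x|lebesgue. g x * \<phi> x)"
  using assms by (subst (asm) has_weak_deriv_iff) auto

lemma has_weak_derivI:
  assumes "e \<in> Basis" "locally_integrable \<Omega> f" "locally_integrable \<Omega> g"
    and "\<And>\<phi>. test_function \<Omega> \<phi> \<Longrightarrow>
        (LINT x|lebesgue. f x * iter_deriv [e] \<phi> x) = - (LINT x|lebesgue. g x * \<phi> x)"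
  shows "has_weak_deriv \<Omega> [e] f g"
  using assms by (subst has_weak_deriv_iff) auto

lemma locally_integrable_test_integrable:
  assumes "locally_integrable \<Omega> f" "test_function \<Omega> \<phi>"
  shows "integrable lebesgue (\<lambda>x. f x * \<phi> x)"
proof -
  obtain K where K: "compact K" "K \<subseteq> \<Omega>" "\<And>x. x \<notin> K \<Longrightarrow> \<phi> x = 0"
    using assms(2) unfolding test_function_def by blast
  obtain C where C: "\<And>x. \<bar>\<phi> x\<bar> \<le> C" using test_function_bounded[OF assms(2)] by blast
  have [measurable]: "\<phi> \<in> borel_measurable lebesgue"
    using smooth_borel_measurable[OF test_function_smooth[OF assms(2)]] by (intro measurable_completion) simp
  have int: "integrable lebesgue (\<lambda>x. indicator K x * f x)"
    using assms(1) K unfolding locally_integrable_def set_integrable_def by auto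
  have eq: "f x * \<phi> x = indicator K x * f x * \<phi> x" for x
    using K(3)[of x] by (auto simp: indicator_def)
  have "integrable lebesgue (\<lambda>x. C * (indicator K x * f x))"
    using int by simp
  then show ?thesis
  proof (rule Bochner_Integration.integrable_bound)
    show "(\<lambda>x. f x * \<phi> x) \<in> borel_measurable lebesgue"
      unfolding eq using borel_measurable_integrable[OF int] by measurable
    show "AE x in lebesgue. norm (f x * \<phi> x) \<le> norm (C * (indicator K x * f x))"
    proof (intro AE_I2)
      fix x
      have "\<bar>indicator K x * f x\<bar> * \<bar>\<phi> x\<bar> \<le> \<bar>indicator K x * f x\<bar> * C" using C by (intro mult_left_mono) auto
      moreover have "C \<ge> 0" using C[of x] by linarith
      ultimately show "norm (f x * \<phi> x) \<le> norm (C * (indicator K x * f x))"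
        unfolding eq by (simp add: abs_mult mult.commute)
    qed
  qed
qed

lemma locally_integrable_const: "locally_integrable \<Omega> (\<lambda>x::'a::euclidean_space. c::real)"
proof -
  have "integrable lebesgue (indicat_real K)" if "compact K" for K :: "'a set"
    using lmeasurable_compact[OF that]
    by (intro integrable_real_indicator) (auto simp: fmeasurable_def simp del: emeasure_completion)
  then show ?thesis
    unfolding locally_integrable_def set_integrable_def by simp
qed

lemma test_function_integrable:
  assumes "test_function \<Omega> \<phi>"
  shows "integrable lborel \<phi>"
proof -
  have "\<phi> \<in> borel_measurable borel"
    by (rule smooth_borel_measurable[OF test_function_smooth[OF assms]])
  then show ?thesis
    using locally_integrable_test_integrable[OF locally_integrable_const assms, of 1]
    by (simp add: integrable_completion)
qed

lemma locally_integrable_cong: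
  assumes "locally_integrable \<Omega> f" and ae: "AE x in lebesgue. x \<in> \<Omega> \<longrightarrow> f x = g x"
  shows "locally_integrable \<Omega> g"
  unfolding locally_integrable_def set_integrable_def
proof safe
  fix K assume K: "compact K" "K \<subseteq> \<Omega>"
  then have int: "integrable lebesgue (\<lambda>x. indicator K x *\<^sub>R f x)"
    using assms(1) unfolding locally_integrable_def set_integrable_def by auto
  have "AE x in lebesgue. indicator K x *\<^sub>R f x = indicator K x *\<^sub>R g x"
    using ae by eventually_elim (use K in \<open>auto simp: indicator_def\<close>)
  then show "integrable lebesgue (\<lambda>x. indicator K x *\<^sub>R g x)"
    using int by (subst integrable_cong_AE[of _ _ "\<lambda>x. indicator K x *\<^sub>R f x"])
      (auto intro: borel_measurable_AE[OF borel_measurable_integrable[OF int]])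
qed

lemma integral_test_cong:
  assumes "locally_integrable \<Omega> f" "test_function \<Omega> \<phi>" and ae: "AE x in lebesgue. x \<in> \<Omega> \<longrightarrow> f x = g x"
  shows "(LINT x|lebesgue. f x * \<phi> x) = (LINT x|lebesgue. g x * \<phi> x)"
proof (rule integral_cong_AE)
  show "(\<lambda>x. f x * \<phi> x) \<in> borel_measurable lebesgue" "(\<lambda>x. g x * \<phi> x) \<in> borel_measurable lebesgue"
    using locally_integrable_test_integrable[OF assms(1,2)]
      locally_integrable_test_integrable[OF locally_integrable_cong[OF assms(1) ae] assms(2)] by auto
  show "AE x in lebesgue. f x * \<phi> x = g x * \<phi> x"
    using ae
  proof eventually_elim
    case (elim x)
    then show ?case using assms(2) unfolding test_function_def by (cases "x \<in> \<Omega>") auto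
  qed
qed

lemma has_weak_deriv_cong:
  assumes "has_weak_deriv \<Omega> [e] f g" "e \<in> Basis"
    and "AE x in lebesgue. x \<in> \<Omega> \<longrightarrow> f x = f' x" "AE x in lebesgue. x \<in> \<Omega> \<longrightarrow> g x = g' x"
  shows "has_weak_deriv \<Omega> [e] f' g'"
proof (rule has_weak_derivI[OF assms(2)])
  have f: "locally_integrable \<Omega> f" and g: "locally_integrable \<Omega> g"
    using assms(1) by (auto simp: has_weak_deriv_def)
  show "locally_integrable \<Omega> f'" "locally_integrable \<Omega> g'"
    using locally_integrable_cong f g assms by blast+
  fix \<phi> assume \<phi>: "test_function \<Omega> \<phi>"
  have "test_function \<Omega> (iter_deriv [e] \<phi>)"
    using \<phi> assms(2) by (intro test_function_iter_deriv) auto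
  then show "(LINT x|lebesgue. f' x * iter_deriv [e] \<phi> x) = - (LINT x|lebesgue. g' x * \<phi> x)"
    using has_weak_derivD[OF assms(1,2) \<phi>] integral_test_cong[OF f _ assms(3)]
      integral_test_cong[OF g \<phi> assms(4)] by simp
qed

lemma locally_integrable_borel_representative:
  assumes "locally_integrable \<Omega> f" "open \<Omega>"
  obtains g where "g \<in> borel_measurable borel" "AE x in lebesgue. x \<in> \<Omega> \<longrightarrow> f x = g x"
proof -
  obtain C where C: "\<And>n. compact (C n)" "\<And>n. C n \<subseteq> \<Omega>" "\<And>n. C n \<subseteq> interior (C (Suc n))"
    "\<Union>(range C) = \<Omega>" "\<And>K. compact K \<Longrightarrow> K \<subseteq> \<Omega> \<Longrightarrow> \<exists>N. \<forall>n\<ge>N. K \<subseteq> C n"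
    by (rule open_Union_compact_subsets[OF assms(2)]) (rule that, assumption+)
  have "(\<lambda>x. indicator \<Omega> x *\<^sub>R f x) \<in> borel_measurable lebesgue"
  proof (rule borel_measurable_LIMSEQ_real)
    show "(\<lambda>x. indicator (C n) x *\<^sub>R f x) \<in> borel_measurable lebesgue" for n
      using assms(1) C(1,2) unfolding locally_integrable_def set_integrable_def
      by (intro borel_measurable_integrable) auto
    fix x
    show "(\<lambda>n. indicator (C n) x *\<^sub>R f x) \<longlonglongrightarrow> indicator \<Omega> x *\<^sub>R f x"
    proof (cases "x \<in> \<Omega>")
      case True
      then obtain N where "\<forall>n\<ge>N. {x} \<subseteq> C n" using C(5)[of "{x}"] by auto
      then show ?thesis using True
        by (intro tendsto_eventually) (auto simp: eventually_sequentially indicator_def)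
    next
      case False
      then have "x \<notin> C n" for n using C(2) by auto
      then show ?thesis using False by simp
    qed
  qed
  from completion_ex_borel_measurable_real[OF this]
  obtain g where g: "g \<in> borel_measurable borel" "AE x in lborel. indicator \<Omega> x *\<^sub>R f x = g x"
    by auto
  have "AE x in lebesgue. x \<in> \<Omega> \<longrightarrow> f x = g x"
    using AE_completion[OF g(2)] by eventually_elim auto
  then show ?thesis using that g(1) by blast
qed

lemma test_function_translate:
  assumes "test_function (ball 0 d) \<rho>" "\<And>z. z \<in> ball 0 d \<Longrightarrow> x + z \<in> \<Omega>"
  shows "test_function \<Omega> (\<lambda>y. \<rho> (y - x))"
proof -
  obtain K where K: "smooth \<rho>" "compact K" "K \<subseteq> ball 0 d" "\<And>x. x \<notin> K \<Longrightarrow> \<rho> x = 0"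
    using assms(1) unfolding test_function_def by blast
  have "smooth (\<lambda>y. \<rho> (- x + y))"
    by (rule smooth_affine[OF K(1)]) (simp add: linear_iff)
  moreover have "compact ((+) x ` K)" by (rule compact_translation[OF K(2)])
  moreover have "(+) x ` K \<subseteq> \<Omega>" using K(3) assms(2) by auto
  moreover have "\<rho> (y - x) = 0" if "y \<notin> (+) x ` K" for y
    using that by (intro K(4)) (auto simp: image_iff algebra_simps)
  ultimately show ?thesis by (intro test_functionI) auto
qed

text \<open>The fundamental lemma of the calculus of variations.  For a compact \<open>K\<close> let \<open>u\<close> be the sign of \<open>h\<close>
  on \<open>K\<close> and \<open>T\<close> the correlation of \<open>u\<close> with \<open>h\<close>.  Averaging \<open>T\<close> against a bump \<open>\<rho>\<close> integrates \<open>h\<close>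
  against the translates of \<open>\<rho>\<close> to the points of \<open>K\<close>, which gives zero.  As \<open>T\<close> is continuous,
  \<open>T 0 = \<integral>\<^sub>K |h|\<close> vanishes.\<close>

lemma fundamental_lemma:
  fixes h :: "'a::euclidean_space \<Rightarrow> real"
  assumes \<Omega>: "open \<Omega>" and h: "locally_integrable \<Omega> h"
    and zero: "\<And>\<phi>. test_function \<Omega> \<phi> \<Longrightarrow> (LINT x|lebesgue. h x * \<phi> x) = 0"
  shows "AE x in lebesgue. x \<in> \<Omega> \<longrightarrow> h x = 0"
proof -
  obtain h0 where h0[measurable]: "h0 \<in> borel_measurable borel" and hh0: "AE x in lebesgue. x \<in> \<Omega> \<longrightarrow> h x = h0 x"
    using locally_integrable_borel_representative[OF h \<Omega>] by blast
  have lh0: "locally_integrable \<Omega> h0" by (rule locally_integrable_cong[OF h hh0])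
  have zero0: "(LINT x|lebesgue. h0 x * \<phi> x) = 0" if "test_function \<Omega> \<phi>" for \<phi>
    using integral_test_cong[OF h that hh0] zero[OF that] by simp
  have comp: "AE x in lebesgue. x \<in> K \<longrightarrow> h0 x = 0" if K: "compact K" "K \<subseteq> \<Omega>" for K
  proof -
    obtain d where d: "d > 0" "(\<Union>x\<in>K. cball x d) \<subseteq> \<Omega>"
      using compact_subset_open_imp_cball_epsilon_subset[OF K(1) \<Omega> K(2)] by blast
    define K' where "K' = {x + y | x y. x \<in> K \<and> y \<in> cball (0::'a) d}"
    have K': "compact K'" unfolding K'_def by (intro compact_sums K compact_cball)
    have K'\<Omega>: "K' \<subseteq> \<Omega>" using d(2) unfolding K'_def by (force simp: dist_norm)
    have [measurable]: "K \<in> sets borel" "K' \<in> sets borel" using K K' by (auto intro: borel_compact)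
    \<comment> \<open>Only the values of \<open>h0\<close> near \<open>K\<close> matter, and there \<open>h0\<close> is integrable.\<close>
    define w where "w x = indicator K' x * h0 x" for x
    define u where "u x = indicator K x * sgn (h0 x)" for x
    have [measurable]: "w \<in> borel_measurable borel" "u \<in> borel_measurable borel"
      unfolding w_def u_def by measurable
    have w: "integrable lborel w"
    proof -
      have "integrable lebesgue w"
        using lh0 K' K'\<Omega> unfolding locally_integrable_def set_integrable_def w_def by auto
      then show ?thesis by (subst (asm) integrable_completion) auto
    qed
    then have wz: "integrable lborel (\<lambda>x. w (x + z))" for z
      by (subst lborel_integrable_translation) auto
    have u1: "\<bar>u x\<bar> \<le> 1" for x by (auto simp: u_def indicator_def sgn_real_def)
    have uw: "integrable lborel (\<lambda>x. u x * w (x + z))" for z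
      by (rule Bochner_Integration.integrable_bound[OF wz[of z]])
         (use u1 in \<open>auto simp: abs_mult intro!: mult_left_le_one_le\<close>)
    have uwb: "(LBINT x. \<bar>u x * w (x + z)\<bar>) \<le> (LBINT x. \<bar>w x\<bar>)" for z
    proof -
      have "(LBINT x. \<bar>u x * w (x + z)\<bar>) \<le> (LBINT x. \<bar>w (x + z)\<bar>)"
        using integrable_abs[OF uw[of z]] integrable_abs[OF wz[of z]] u1 by (intro integral_mono) (auto simp: abs_mult intro!: mult_left_le_one_le)
      also have "\<dots> = (LBINT x. \<bar>w x\<bar>)"
        by (rule lborel_integral_translation) auto
      finally show ?thesis .
    qed
    define T where "T z = (LBINT x. u x * w (x + z))" for z
    have "T 0 = 0"
    proof (rule vanishes_at_0[OF _ d(1)])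
      fix z :: "nat \<Rightarrow> 'a" assume z: "z \<longlonglongrightarrow> 0"
      have "(\<lambda>n. T (z n) - T 0) \<longlonglongrightarrow> 0"
      proof (rule tendsto_rabs_zero_cancel, rule tendsto_sandwich[OF _ _ tendsto_const translation_L1[OF w z]])
        show "\<forall>\<^sub>F n in sequentially. \<bar>T (z n) - T 0\<bar> \<le> (LBINT x. \<bar>w (x + z n) - w x\<bar>)"
        proof (intro always_eventually allI)
          fix n
          have i: "integrable lborel (\<lambda>x. u x * (w (x + z n) - w x))"
            using Bochner_Integration.integrable_diff[OF uw[of "z n"] uw[of 0]] by (simp add: algebra_simps)
          have "T (z n) - T 0 = (LBINT x. u x * (w (x + z n) - w x))"
            unfolding T_def using Bochner_Integration.integral_diff[OF uw[of "z n"] uw[of 0]]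
            by (simp add: algebra_simps)
          also have "\<bar>\<dots>\<bar> \<le> (LBINT x. \<bar>u x * (w (x + z n) - w x)\<bar>)"
            using integral_norm_bound[of lborel "\<lambda>x. u x * (w (x + z n) - w x)"] by simp
          also have "\<dots> \<le> (LBINT x. \<bar>w (x + z n) - w x\<bar>)"
            using integrable_abs[OF i] w wz u1 by (intro integral_mono) (auto simp: abs_mult intro!: mult_left_le_one_le)
          finally show "\<bar>T (z n) - T 0\<bar> \<le> (LBINT x. \<bar>w (x + z n) - w x\<bar>)" .
        qed
      qed simp
      then show "(\<lambda>n. T (z n)) \<longlonglongrightarrow> T 0" by (simp add: LIM_zero_iff)
    next
      fix \<rho> :: "'a \<Rightarrow> real" assume \<rho>: "test_function (ball 0 d) \<rho>"
      have [measurable]: "\<rho> \<in> borel_measurable borel"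
        by (rule smooth_borel_measurable[OF test_function_smooth[OF \<rho>]])
      have \<rho>i: "integrable lborel \<rho>" by (rule test_function_integrable[OF \<rho>])
      note cf = correlation_fubini[OF _ _ _ uw uwb \<rho>i]
      show "integrable lborel (\<lambda>z. \<rho> z * T z)"
        unfolding T_def by (rule cf(1)) auto
      have "(LBINT z. \<rho> z * T z) = (LBINT x. LBINT y. \<rho> (y - x) * (u x * w y))"
        unfolding T_def by (rule cf(4)) auto
      also have "\<dots> = (\<integral>x. 0 \<partial>(lborel :: 'a measure))"
      proof (rule Bochner_Integration.integral_cong[OF refl])
        fix x
        show "(LBINT y. \<rho> (y - x) * (u x * w y)) = 0"
        proof (cases "x \<in> K")
          case True
          then have *: "x + z \<in> K'" if "z \<in> ball 0 d" for z
            using that unfolding K'_def by force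
          have t: "test_function \<Omega> (\<lambda>y. \<rho> (y - x))"
            by (rule test_function_translate[OF \<rho>]) (use * K'\<Omega> in auto)
          have "\<rho> (y - x) * (u x * w y) = u x * (h0 y * \<rho> (y - x))" for y
          proof (cases "y \<in> K'")
            case False
            then have "y - x \<notin> ball 0 d" using *[of "y - x"] by auto
            then have "\<rho> (y - x) = 0" using \<rho> unfolding test_function_def by blast
            then show ?thesis by simp
          qed (simp add: w_def)
          then have "(\<lambda>y. \<rho> (y - x) * (u x * w y)) = (\<lambda>y. u x * (h0 y * \<rho> (y - x)))" by (rule ext)
          then have "(LBINT y. \<rho> (y - x) * (u x * w y)) = u x * (LBINT y. h0 y * \<rho> (y - x))"
            by (simp only: integral_mult_right_zero)
          also have "(LBINT y. h0 y * \<rho> (y - x)) = (LINT y|lebesgue. h0 y * \<rho> (y - x))"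
            by (rule integral_completion[symmetric]) measurable
          finally show ?thesis using zero0[OF t] by simp
        qed (simp add: u_def)
      qed
      finally show "(LBINT z. \<rho> z * T z) = 0" by simp
    qed
    moreover have "T 0 = (LBINT x. indicator K x * \<bar>h0 x\<bar>)"
    proof -
      have "u x * w (x + 0) = indicator K x * \<bar>h0 x\<bar>" for x
      proof (cases "x \<in> K")
        case True
        then have "x \<in> K'" using d(1) unfolding K'_def by (force intro: exI[of _ x] exI[of _ 0])
        then show ?thesis using True by (simp add: u_def w_def abs_sgn mult.commute)
      qed (simp add: u_def)
      then show ?thesis unfolding T_def by simp
    qed
    moreover have "integrable lborel (\<lambda>x. indicator K x * \<bar>h0 x\<bar>)"
    proof -
      have "integrable lebesgue (\<lambda>x. indicator K x * h0 x)"
        using lh0 K unfolding locally_integrable_def set_integrable_def by simp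
      then have "integrable lborel (\<lambda>x. indicator K x * h0 x)"
        by (subst (asm) integrable_completion) auto
      from integrable_abs[OF this] show ?thesis by (simp add: abs_mult)
    qed
    ultimately have "AE x in lborel. indicator K x * \<bar>h0 x\<bar> = 0"
      by (subst integral_nonneg_eq_0_iff_AE[symmetric]) auto
    from AE_completion[OF this] show ?thesis
      by eventually_elim auto
  qed
  obtain C where C: "\<And>n. compact (C n)" "\<And>n. C n \<subseteq> \<Omega>" "\<And>n. C n \<subseteq> interior (C (Suc n))"
    "\<Union>(range C) = \<Omega>" "\<And>K. compact K \<Longrightarrow> K \<subseteq> \<Omega> \<Longrightarrow> \<exists>N. \<forall>n\<ge>N. K \<subseteq> C n"
    by (rule open_Union_compact_subsets[OF \<Omega>]) (rule that, assumption+)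
  have "AE x in lebesgue. \<forall>n::nat. x \<in> C n \<longrightarrow> h0 x = 0"
    unfolding AE_all_countable by (intro allI comp C(1,2))
  then show ?thesis using hh0
    by eventually_elim (use C(4) in auto)
qed

lemma locally_integrable_add:
  "locally_integrable \<Omega> f \<Longrightarrow> locally_integrable \<Omega> g \<Longrightarrow> locally_integrable \<Omega> (\<lambda>x. f x + g x)"
  unfolding locally_integrable_def using set_integral_add(1) by blast

lemma locally_integrable_cmult: "locally_integrable \<Omega> f \<Longrightarrow> locally_integrable \<Omega> (\<lambda>x. c * f x)"
  unfolding locally_integrable_def by (auto intro: set_integrable_mult_right)

lemma locally_integrable_smooth_mult:
  assumes "smooth a" "locally_integrable \<Omega> f"
  shows "locally_integrable \<Omega> (\<lambda>x. a x * f x)"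
  unfolding locally_integrable_def set_integrable_def
proof safe
  fix K assume K: "compact K" "K \<subseteq> \<Omega>"
  then have int: "integrable lebesgue (\<lambda>x. indicator K x * f x)"
    using assms(2) unfolding locally_integrable_def set_integrable_def by simp
  have "bounded (a ` K)"
    using K assms(1) by (intro compact_imp_bounded compact_continuous_image smooth_continuous_on)
  then obtain C where C: "\<And>x. x \<in> K \<Longrightarrow> \<bar>a x\<bar> \<le> C"
    unfolding bounded_iff by auto
  have [measurable]: "a \<in> borel_measurable lebesgue"
    using smooth_borel_measurable[OF assms(1)] by (intro measurable_completion) simp
  have "integrable lebesgue (\<lambda>x. a x * (indicator K x * f x))"
  proof (rule Bochner_Integration.integrable_bound)
    show "integrable lebesgue (\<lambda>x. \<bar>C\<bar> * (indicator K x * f x))" using int by simp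
    show "(\<lambda>x. a x * (indicator K x * f x)) \<in> borel_measurable lebesgue"
      using borel_measurable_integrable[OF int] by measurable
    show "AE x in lebesgue. norm (a x * (indicator K x * f x)) \<le> norm (\<bar>C\<bar> * (indicator K x * f x))"
      using order_trans[OF C abs_ge_self] by (intro AE_I2) (auto simp: indicator_def abs_mult intro!: mult_right_mono)
  qed
  then show "integrable lebesgue (\<lambda>x. indicator K x *\<^sub>R (a x * f x))"
    by (simp add: mult.left_commute)
qed

lemma has_weak_deriv_locally_integrable:
  assumes "has_weak_deriv \<Omega> es f g"
  shows "locally_integrable \<Omega> f" "locally_integrable \<Omega> g"
  using assms by (auto simp: has_weak_deriv_def)

lemma has_weak_deriv_unique:
  assumes "has_weak_deriv \<Omega> es f g" "has_weak_deriv \<Omega> es f h" "open \<Omega>" "es \<in> lists Basis"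
  shows "AE x in lebesgue. x \<in> \<Omega> \<longrightarrow> g x = h x"
proof -
  note w = assms(1,2)[unfolded has_weak_deriv_iff[OF assms(4)]]
  have "AE x in lebesgue. x \<in> \<Omega> \<longrightarrow> g x + (- 1) * h x = 0"
  proof (rule fundamental_lemma[OF assms(3)])
    show "locally_integrable \<Omega> (\<lambda>x. g x + (- 1) * h x)"
      using w by (intro locally_integrable_add locally_integrable_cmult) auto
    fix \<phi> assume \<phi>: "test_function \<Omega> \<phi>"
    then have "(LINT x|lebesgue. g x * \<phi> x) = (LINT x|lebesgue. h x * \<phi> x)"
      using w by auto
    moreover have "integrable lebesgue (\<lambda>x. g x * \<phi> x)" "integrable lebesgue (\<lambda>x. h x * \<phi> x)"
      using w \<phi> locally_integrable_test_integrable by blast+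
    ultimately show "(LINT x|lebesgue. (g x + (- 1) * h x) * \<phi> x) = 0"
      by (simp add: algebra_simps)
  qed
  then show ?thesis by eventually_elim auto
qed

lemma weak_deriv_works:
  "weakly_differentiable \<Omega> es f \<Longrightarrow> has_weak_deriv \<Omega> es f (weak_deriv \<Omega> es f)"
  unfolding weakly_differentiable_def weak_deriv_def by (erule someI_ex)

lemma weak_deriv_eq:
  assumes "has_weak_deriv \<Omega> es f g" "open \<Omega>" "es \<in> lists Basis"
  shows "AE x in lebesgue. x \<in> \<Omega> \<longrightarrow> weak_deriv \<Omega> es f x = g x"
  using assms weak_deriv_works[of \<Omega> es f] unfolding weakly_differentiable_def
  by (intro has_weak_deriv_unique) auto

lemma has_weak_deriv_add:
  assumes "has_weak_deriv \<Omega> [e] f f'" "has_weak_deriv \<Omega> [e] g g'" "e \<in> Basis"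
  shows "has_weak_deriv \<Omega> [e] (\<lambda>x. f x + g x) (\<lambda>x. f' x + g' x)"
proof (rule has_weak_derivI[OF assms(3)])
  note l = has_weak_deriv_locally_integrable[OF assms(1)] has_weak_deriv_locally_integrable[OF assms(2)]
  then show "locally_integrable \<Omega> (\<lambda>x. f x + g x)" "locally_integrable \<Omega> (\<lambda>x. f' x + g' x)"
    by (auto intro: locally_integrable_add)
  fix \<phi> assume \<phi>: "test_function \<Omega> \<phi>"
  then have \<phi>': "test_function \<Omega> (iter_deriv [e] \<phi>)"
    using assms(3) by (intro test_function_iter_deriv) auto
  show "(LINT x|lebesgue. (f x + g x) * iter_deriv [e] \<phi> x) = - (LINT x|lebesgue. (f' x + g' x) * \<phi> x)"
    using l[THEN locally_integrable_test_integrable, OF \<phi>] l[THEN locally_integrable_test_integrable, OF \<phi>']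
      has_weak_derivD[OF assms(1,3) \<phi>] has_weak_derivD[OF assms(2,3) \<phi>]
    by (simp add: distrib_right)
qed

lemma has_weak_deriv_const:
  assumes "e \<in> Basis"
  shows "has_weak_deriv \<Omega> [e] (\<lambda>x. 0) (\<lambda>x. 0)"
  by (rule has_weak_derivI[OF assms]) (auto intro: locally_integrable_const)

lemma has_weak_deriv_sum:
  assumes "\<And>i. i \<in> I \<Longrightarrow> has_weak_deriv \<Omega> [e] (f i) (f' i)" "e \<in> Basis"
  shows "has_weak_deriv \<Omega> [e] (\<lambda>x. \<Sum>i\<in>I. f i x) (\<lambda>x. \<Sum>i\<in>I. f' i x)"
  using assms
  by (induction I rule: infinite_finite_induct) (auto intro: has_weak_deriv_const has_weak_deriv_add)

lemma has_weak_deriv_smooth_mult: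
  assumes "has_weak_deriv \<Omega> [e] f f'" "e \<in> Basis" "smooth a"
  shows "has_weak_deriv \<Omega> [e] (\<lambda>x. a x * f x) (\<lambda>x. iter_deriv [e] a x * f x + a x * f' x)"
proof (rule has_weak_derivI[OF assms(2)])
  have a': "smooth (iter_deriv [e] a)" using assms by (intro smooth_iter_deriv) auto
  note l = has_weak_deriv_locally_integrable[OF assms(1)]
  show "locally_integrable \<Omega> (\<lambda>x. a x * f x)"
    "locally_integrable \<Omega> (\<lambda>x. iter_deriv [e] a x * f x + a x * f' x)"
    using l assms(3) a' by (auto intro: locally_integrable_add locally_integrable_smooth_mult)
  fix \<phi> assume \<phi>: "test_function \<Omega> \<phi>"
  have \<phi>': "test_function \<Omega> (iter_deriv [e] \<phi>)"
    using assms(2) \<phi> by (intro test_function_iter_deriv) auto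
  have a\<phi>: "test_function \<Omega> (\<lambda>x. a x * \<phi> x)" by (rule test_function_mult[OF assms(3) \<phi>])
  have "iter_deriv [e] (\<lambda>x. a x * \<phi> x) = (\<lambda>x. a x * iter_deriv [e] \<phi> x + iter_deriv [e] a x * \<phi> x)"
    by (intro iter_deriv_mult smooth_differentiable assms test_function_smooth[OF \<phi>])
  then have "(LINT x|lebesgue. f x * (a x * iter_deriv [e] \<phi> x) + f x * (iter_deriv [e] a x * \<phi> x)) = - (LINT x|lebesgue. f' x * (a x * \<phi> x))"
    using has_weak_derivD[OF assms(1,2) a\<phi>] by (simp add: distrib_left)
  moreover have "integrable lebesgue (\<lambda>x. f x * (a x * iter_deriv [e] \<phi> x))"
    "integrable lebesgue (\<lambda>x. f x * (iter_deriv [e] a x * \<phi> x))" "integrable lebesgue (\<lambda>x. f' x * (a x * \<phi> x))"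
    using l assms(3) a' \<phi> \<phi>' by (auto intro!: locally_integrable_test_integrable test_function_mult)
  ultimately show "(LINT x|lebesgue. a x * f x * iter_deriv [e] \<phi> x) =
      - (LINT x|lebesgue. (iter_deriv [e] a x * f x + a x * f' x) * \<phi> x)"
    by (simp add: algebra_simps)
qed

lemma has_weak_deriv_cmult:
  assumes "has_weak_deriv \<Omega> [e] f f'" "e \<in> Basis"
  shows "has_weak_deriv \<Omega> [e] (\<lambda>x. c * f x) (\<lambda>x. c * f' x)"
  using has_weak_deriv_smooth_mult[OF assms smooth_const[of c]] by (simp add: iter_deriv.simps)

lemma has_weak_deriv_compose:
  assumes "has_weak_deriv \<Omega> [a] f f'" "has_weak_deriv \<Omega> [b] f' f''" "a \<in> Basis" "b \<in> Basis"
  shows "has_weak_deriv \<Omega> [a, b] f f''"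
proof -
  have "(LINT x|lebesgue. f x * iter_deriv [a, b] \<phi> x) = (LINT x|lebesgue. f'' x * \<phi> x)"
    if \<phi>: "test_function \<Omega> \<phi>" for \<phi>
  proof -
    have "test_function \<Omega> (iter_deriv [b] \<phi>)"
      using assms \<phi> by (intro test_function_iter_deriv) auto
    from has_weak_derivD[OF assms(1,3) this] has_weak_derivD[OF assms(2,4) \<phi>]
    show ?thesis using iter_deriv_append[of "[a]" "[b]" \<phi>] by simp
  qed
  then show ?thesis
    using assms has_weak_deriv_locally_integrable by (subst has_weak_deriv_iff) auto
qed

text \<open>Both iterated derivatives are weak derivatives of \<open>f\<close> for the operators \<open>\<partial>\<^sub>a\<partial>\<^sub>b\<close> and
  \<open>\<partial>\<^sub>b\<partial>\<^sub>a\<close>, which agree on test functions.\<close>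

lemma mixed_weak_derivatives:
  assumes "has_weak_deriv \<Omega> [a] f fa" "has_weak_deriv \<Omega> [b] fa fab"
    and "has_weak_deriv \<Omega> [b] f fb" "has_weak_deriv \<Omega> [a] fb fba"
    and "a \<in> Basis" "b \<in> Basis" "open \<Omega>"
  shows "AE x in lebesgue. x \<in> \<Omega> \<longrightarrow> fab x = fba x"
proof (rule has_weak_deriv_unique[OF _ _ \<open>open \<Omega>\<close>])
  show "has_weak_deriv \<Omega> [a, b] f fab" by (rule has_weak_deriv_compose[OF assms(1,2,5,6)])
  have ba: "has_weak_deriv \<Omega> [b, a] f fba" by (rule has_weak_deriv_compose[OF assms(3,4,6,5)])
  show "has_weak_deriv \<Omega> [a, b] f fba"
    unfolding has_weak_deriv_def
  proof (intro conjI allI impI)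
    fix \<phi> assume \<phi>: "test_function \<Omega> \<phi>"
    have "iter_deriv [a, b] \<phi> = iter_deriv [b, a] \<phi>"
      by (intro smooth_mixed_derivatives test_function_smooth[OF \<phi>] assms)
    then show "(LINT x:\<Omega>|lebesgue. f x * iter_deriv [a, b] \<phi> x) = (- 1) ^ length [a, b] * (LINT x:\<Omega>|lebesgue. fba x * \<phi> x)"
      using ba \<phi> unfolding has_weak_deriv_def by simp
  qed (use ba in \<open>auto simp: has_weak_deriv_def\<close>)
qed (use assms in auto)

subsection \<open>Square-integrable functions\<close>

lemma square_integrable_cong:
  assumes "square_integrable f" "AE x in lebesgue. f x = g x"
  shows "square_integrable g"
proof -
  have g: "g \<in> borel_measurable lebesgue"
    using assms borel_measurable_AE unfolding square_integrable_def by blast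
  moreover have "integrable lebesgue (\<lambda>x. (g x)\<^sup>2)"
    using assms g unfolding square_integrable_def
    by (subst integrable_cong_AE[of _ _ "\<lambda>x. (f x)\<^sup>2"]) auto
  ultimately show ?thesis unfolding square_integrable_def by blast
qed

lemma square_integrable_mult_integrable:
  assumes "square_integrable f" "square_integrable g"
  shows "integrable lebesgue (\<lambda>x. f x * g x)"
proof (rule Bochner_Integration.integrable_bound)
  show "integrable lebesgue (\<lambda>x. (f x)\<^sup>2 + (g x)\<^sup>2)" "(\<lambda>x. f x * g x) \<in> borel_measurable lebesgue"
    using assms unfolding square_integrable_def by auto
  show "AE x in lebesgue. norm (f x * g x) \<le> norm ((f x)\<^sup>2 + (g x)\<^sup>2)"
    using abs_mult_le_sum_squares by simp
qed

lemma square_integrable_bounded_mult: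
  assumes "square_integrable f" "g \<in> borel_measurable lebesgue" "AE x in lebesgue. \<bar>g x\<bar> \<le> C"
  shows "square_integrable (\<lambda>x. f x * g x)"
  unfolding square_integrable_def
proof
  show "integrable lebesgue (\<lambda>x. (f x * g x)\<^sup>2)"
  proof (rule Bochner_Integration.integrable_bound)
    show "integrable lebesgue (\<lambda>x. C\<^sup>2 * (f x)\<^sup>2)" "(\<lambda>x. (f x * g x)\<^sup>2) \<in> borel_measurable lebesgue"
      using assms unfolding square_integrable_def by auto
    show "AE x in lebesgue. norm ((f x * g x)\<^sup>2) \<le> norm (C\<^sup>2 * (f x)\<^sup>2)"
      using assms(3)
    proof eventually_elim
      case (elim x)
      then have "(g x)\<^sup>2 \<le> C\<^sup>2" by (metis abs_le_square_iff abs_ge_self order_trans)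
      then show ?case by (simp add: power_mult_distrib mult.commute[of "C\<^sup>2"] mult_left_mono)
    qed
  qed
qed (use assms in \<open>auto simp: square_integrable_def\<close>)

lemma square_integrable_cmult: "square_integrable f \<Longrightarrow> square_integrable (\<lambda>x. c * f x)"
  unfolding square_integrable_def by (auto simp: power_mult_distrib)

lemma square_integrable_add:
  assumes "square_integrable f" "square_integrable g"
  shows "square_integrable (\<lambda>x. f x + g x)"
  using assms square_integrable_mult_integrable[OF assms] unfolding square_integrable_def
  by (auto simp: power2_sum mult.assoc)

lemma square_integrable_diff:
  assumes "square_integrable f" "square_integrable g"
  shows "square_integrable (\<lambda>x. f x - g x)"
  using square_integrable_add[OF assms(1) square_integrable_cmult[OF assms(2), of "-1"]] by simp

lemma integrable_locally_integrable: "integrable lebesgue f \<Longrightarrow> locally_integrable \<Omega> f"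
  unfolding locally_integrable_def set_integrable_def
  by (auto intro!: integrable_mult_indicator[where f=f and M=lebesgue, simplified] simp: compact_imp_closed borel_closed)

lemma square_integrable_locally_integrable:
  assumes "square_integrable f"
  shows "locally_integrable \<Omega> f"
  unfolding locally_integrable_def set_integrable_def
proof safe
  fix K :: "'a set" assume K: "compact K"
  have "locally_integrable UNIV (\<lambda>x::'a. 1 :: real)" by (rule locally_integrable_const)
  then have "integrable lebesgue (indicat_real K)"
    using K unfolding locally_integrable_def set_integrable_def by auto
  moreover have "(\<lambda>x. (indicat_real K x)\<^sup>2) = indicat_real K" by (auto simp: indicator_def)
  ultimately have "square_integrable (indicat_real K)"
    unfolding square_integrable_def by auto
  from square_integrable_mult_integrable[OF this assms]
  show "integrable lebesgue (\<lambda>x. indicat_real K x *\<^sub>R f x)" by simp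
qed

lemma square_integrable_borel_representative:
  assumes "square_integrable f"
  obtains g where "g \<in> borel_measurable borel" "integrable lborel (\<lambda>x. (g x)\<^sup>2)" "AE x in lebesgue. f x = g x"
proof -
  obtain g where g: "g \<in> borel_measurable lborel" "AE x in lborel. f x = g x"
    using completion_ex_borel_measurable_real assms unfolding square_integrable_def by blast
  from AE_completion[OF g(2)] have ae: "AE x in lebesgue. f x = g x" .
  have "integrable lebesgue (\<lambda>x. (g x)\<^sup>2)"
    using square_integrable_cong[OF assms ae] unfolding square_integrable_def by blast
  then have "integrable lborel (\<lambda>x. (g x)\<^sup>2)"
    using g(1) by (subst (asm) integrable_completion) auto
  then show ?thesis using that g(1) ae by simp
qed


text \<open>The proof doubles the variables, which avoids a smooth approximation of the factors.  Use
  \<open>\<rho>(y - x) \<phi>(x)\<close> as a test function of \<open>x\<close> for \<open>f\<close> and of \<open>y\<close> for \<open>g\<close>: the derivatives that fall on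
  \<open>\<rho>\<close> cancel, and what remains says that the sum \<open>T z\<close> of the three integrals, with \<open>g\<close> and \<open>g'\<close>
  translated by \<open>z\<close>, has average zero against every bump \<open>\<rho>\<close>.  Correlations of square-integrable
  functions are continuous, so \<open>T 0 = 0\<close>.\<close>

lemma weak_product_rule_borel:
  fixes f g f' g' :: "'a::euclidean_space \<Rightarrow> real"
  assumes [measurable]: "f \<in> borel_measurable borel" "g \<in> borel_measurable borel"
      "f' \<in> borel_measurable borel" "g' \<in> borel_measurable borel"
    and f2: "integrable lborel (\<lambda>x. (f x)\<^sup>2)" and g2: "integrable lborel (\<lambda>x. (g x)\<^sup>2)"
    and f'2: "integrable lborel (\<lambda>x. (f' x)\<^sup>2)" and g'2: "integrable lborel (\<lambda>x. (g' x)\<^sup>2)"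
    and e: "e \<in> Basis" and \<phi>: "test_function UNIV \<phi>"
    and f': "\<And>\<psi>. test_function UNIV \<psi> \<Longrightarrow> (LBINT x. f x * iter_deriv [e] \<psi> x) = - (LBINT x. f' x * \<psi> x)"
    and g': "\<And>\<psi>. test_function UNIV \<psi> \<Longrightarrow> (LBINT x. g x * iter_deriv [e] \<psi> x) = - (LBINT x. g' x * \<psi> x)"
  shows "(LBINT x. f x * iter_deriv [e] \<phi> x * g x) + (LBINT x. f' x * \<phi> x * g x)
    + (LBINT x. f x * \<phi> x * g' x) = 0"
proof -
  have \<phi>': "test_function UNIV (iter_deriv [e] \<phi>)"
    using e \<phi> by (intro test_function_iter_deriv) auto
  note meas = smooth_borel_measurable[OF test_function_smooth]
  note [measurable] = meas[OF \<phi>] meas[OF \<phi>']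
  have L2_mult: "integrable lborel (\<lambda>x. (k x * \<psi> x)\<^sup>2)"
    if k: "integrable lborel (\<lambda>x. (k x)\<^sup>2)" and [measurable]: "k \<in> borel_measurable borel" and \<psi>: "test_function UNIV \<psi>" for k \<psi> :: "'a \<Rightarrow> real"
  proof -
    note [measurable] = meas[OF \<psi>]
    obtain C where C: "\<And>x. \<bar>\<psi> x\<bar> \<le> C" using test_function_bounded[OF \<psi>] by blast
    have "square_integrable k" using k unfolding square_integrable_def
      by (auto simp: integrable_completion intro: measurable_completion)
    then have "square_integrable (\<lambda>x. k x * \<psi> x)"
      by (rule square_integrable_bounded_mult[where C=C]) (use C in \<open>auto intro: measurable_completion\<close>)
    then show ?thesis unfolding square_integrable_def by (subst (asm) integrable_completion) auto
  qed
  define u1 where "u1 x = f x * iter_deriv [e] \<phi> x" for x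
  define u2 where "u2 x = f' x * \<phi> x" for x
  define u3 where "u3 x = f x * \<phi> x" for x
  have mu[measurable]: "u1 \<in> borel_measurable borel" "u2 \<in> borel_measurable borel" "u3 \<in> borel_measurable borel"
    unfolding u1_def u2_def u3_def by measurable
  have u: "integrable lborel (\<lambda>x. (u1 x)\<^sup>2)" "integrable lborel (\<lambda>x. (u2 x)\<^sup>2)" "integrable lborel (\<lambda>x. (u3 x)\<^sup>2)"
    unfolding u1_def u2_def u3_def by (intro L2_mult f2 f'2 \<phi> \<phi>'; simp)+
  define T where "T z = (LBINT x. u1 x * g (x + z)) + (LBINT x. u2 x * g (x + z))
    + (LBINT x. u3 x * g' (x + z))" for z
  have "T 0 = 0"
  proof (rule vanishes_at_0[where d=1])
    fix z :: "nat \<Rightarrow> 'a" assume "z \<longlonglongrightarrow> 0"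
    then show "(\<lambda>n. T (z n)) \<longlonglongrightarrow> T 0"
      unfolding T_def by (intro tendsto_add correlation_L2_continuous u g2 g'2) auto
  next
    fix \<rho> :: "'a \<Rightarrow> real" assume "test_function (ball 0 1) \<rho>"
    then have \<rho>: "test_function UNIV \<rho>" by (rule test_function_mono) auto
    define \<sigma> where "\<sigma> = iter_deriv [e] \<rho>"
    have \<sigma>: "test_function UNIV \<sigma>"
      unfolding \<sigma>_def using e \<rho> by (intro test_function_iter_deriv) auto
    note [measurable] = meas[OF \<rho>] meas[OF \<sigma>]
    note \<rho>i = test_function_integrable[OF \<rho>] and \<sigma>i = test_function_integrable[OF \<sigma>]
    note m = meas[OF \<rho>] meas[OF \<sigma>]
    note c1 = correlation_fubini[OF mu(1) assms(2) m(1) correlation_L2_integrable[OF mu(1) assms(2) u(1) g2]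
        correlation_L2_bound[OF mu(1) assms(2) u(1) g2] \<rho>i]
    note c2 = correlation_fubini[OF mu(2) assms(2) m(1) correlation_L2_integrable[OF mu(2) assms(2) u(2) g2]
        correlation_L2_bound[OF mu(2) assms(2) u(2) g2] \<rho>i]
    note c3 = correlation_fubini[OF mu(3) assms(4) m(1) correlation_L2_integrable[OF mu(3) assms(4) u(3) g'2]
        correlation_L2_bound[OF mu(3) assms(4) u(3) g'2] \<rho>i]
    note c4 = correlation_fubini[OF mu(3) assms(2) m(2) correlation_L2_integrable[OF mu(3) assms(2) u(3) g2]
        correlation_L2_bound[OF mu(3) assms(2) u(3) g2] \<sigma>i]
    show "integrable lborel (\<lambda>z. \<rho> z * T z)"
      unfolding T_def distrib_left using c1(1) c2(1) c3(1) by (intro Bochner_Integration.integrable_add)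
    \<comment> \<open>the weak derivative of \<open>g\<close>, tested in \<open>y\<close> for fixed \<open>x\<close>\<close>
    have ex: "(LBINT y. \<rho> (y - x) * (u3 x * g' y)) = - (LBINT y. \<sigma> (y - x) * (u3 x * g y))" for x
    proof -
      have "test_function UNIV (\<lambda>y. \<rho> (- x + 1 *\<^sub>R y))" by (rule test_function_affine[OF \<rho>]) simp
      moreover have "iter_deriv [e] (\<lambda>y. \<rho> (- x + 1 *\<^sub>R y)) = (\<lambda>y. 1 * \<sigma> (- x + 1 *\<^sub>R y))"
        unfolding \<sigma>_def by (rule iter_deriv_scale[OF test_function_smooth[OF \<rho>] e])
      ultimately have "(LBINT y. g y * \<sigma> (y - x)) = - (LBINT y. g' y * \<rho> (y - x))"
        using g'[of "\<lambda>y. \<rho> (- x + 1 *\<^sub>R y)"] by simp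
      then have "u3 x * (LBINT y. g' y * \<rho> (y - x)) = - (u3 x * (LBINT y. g y * \<sigma> (y - x)))" by simp
      then show ?thesis by (simp add: integral_mult_right_zero[symmetric] ac_simps del: integral_mult_right_zero)
    qed
    \<comment> \<open>the weak derivative of \<open>f\<close>, tested in \<open>x\<close> for fixed \<open>y\<close>\<close>
    have ey: "(LBINT x. \<rho> (y - x) * (u1 x * g y)) + (LBINT x. \<rho> (y - x) * (u2 x * g y)) =
        (LBINT x. \<sigma> (y - x) * (u3 x * g y))" for y
    proof -
      let ?r = "\<lambda>x. \<rho> (y + (- 1) *\<^sub>R x)"
      have r: "test_function UNIV ?r" by (rule test_function_affine[OF \<rho>]) simp
      have r': "iter_deriv [e] ?r = (\<lambda>x. - 1 * \<sigma> (y + (- 1) *\<^sub>R x))"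
        unfolding \<sigma>_def by (rule iter_deriv_scale[OF test_function_smooth[OF \<rho>] e])
      have s: "smooth (\<lambda>x. \<sigma> (y + (- 1) *\<^sub>R x))"
        by (rule test_function_smooth[OF test_function_affine[OF \<sigma>]]) simp
      have "iter_deriv [e] (\<lambda>x. ?r x * \<phi> x) = (\<lambda>x. ?r x * iter_deriv [e] \<phi> x + (- 1 * \<sigma> (y + (- 1) *\<^sub>R x)) * \<phi> x)"
        using iter_deriv_mult[OF smooth_differentiable[OF test_function_smooth[OF r]] smooth_differentiable[OF test_function_smooth[OF \<phi>]], of e]
        unfolding r' .
      then have "(LBINT x. f x * (\<rho> (y - x) * iter_deriv [e] \<phi> x) - f x * (\<sigma> (y - x) * \<phi> x)) =
          - (LBINT x. f' x * (\<rho> (y - x) * \<phi> x))"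
        using f'[OF test_function_mult[OF test_function_smooth[OF r] \<phi>]] by (simp add: algebra_simps)
      moreover have li: "integrable lborel (\<lambda>x. k x * \<psi> x)"
        if k: "integrable lborel (\<lambda>x. (k x)\<^sup>2)" and [measurable]: "k \<in> borel_measurable borel" and \<psi>: "test_function UNIV \<psi>" for k \<psi> :: "'a \<Rightarrow> real"
      proof -
        note [measurable] = meas[OF \<psi>]
        have "square_integrable k" using k unfolding square_integrable_def
          by (auto simp: integrable_completion intro: measurable_completion)
        from locally_integrable_test_integrable[OF square_integrable_locally_integrable[OF this] \<psi>]
        show ?thesis by (subst (asm) integrable_completion) auto
      qed
      have "integrable lborel (\<lambda>x. f x * (\<rho> (y - x) * iter_deriv [e] \<phi> x))" "integrable lborel (\<lambda>x. f x * (\<sigma> (y - x) * \<phi> x))"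
        using li[OF f2 _ test_function_mult[OF test_function_smooth[OF r] \<phi>']] li[OF f2 _ test_function_mult[OF s \<phi>]]
        by auto
      ultimately have "(LBINT x. f x * (\<rho> (y - x) * iter_deriv [e] \<phi> x)) + (LBINT x. f' x * (\<rho> (y - x) * \<phi> x))
        = (LBINT x. f x * (\<sigma> (y - x) * \<phi> x))"
        by simp
      from arg_cong[OF this, of "\<lambda>t. g y * t"] show ?thesis
        unfolding u1_def u2_def u3_def distrib_left by (simp add: integral_mult_right_zero[symmetric] ac_simps del: integral_mult_right_zero)
    qed
    have "(LBINT z. \<rho> z * T z) = (LBINT z. \<rho> z * (LBINT x. u1 x * g (x + z)))
      + (LBINT z. \<rho> z * (LBINT x. u2 x * g (x + z))) + (LBINT z. \<rho> z * (LBINT x. u3 x * g' (x + z)))"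
      unfolding T_def distrib_left using c1(1) c2(1) c3(1) by simp
    also have "(LBINT z. \<rho> z * (LBINT x. u1 x * g (x + z))) + (LBINT z. \<rho> z * (LBINT x. u2 x * g (x + z)))
      = (LBINT y. (LBINT x. \<rho> (y - x) * (u1 x * g y)) + (LBINT x. \<rho> (y - x) * (u2 x * g y)))"
      unfolding c1(5) c2(5) by (rule Bochner_Integration.integral_add[OF c1(3) c2(3), symmetric])
    also have "\<dots> = (LBINT z. \<sigma> z * (LBINT x. u3 x * g (x + z)))"
      unfolding ey c4(5) ..
    also have "(LBINT z. \<rho> z * (LBINT x. u3 x * g' (x + z))) = - (LBINT z. \<sigma> z * (LBINT x. u3 x * g (x + z)))"
      unfolding c3(4) c4(4) ex by simp
    finally show "(LBINT z. \<rho> z * T z) = 0" by simp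
  qed simp
  then show ?thesis unfolding T_def u1_def u2_def u3_def by simp
qed

lemma weak_product_rule:
  fixes f g f' g' :: "'a::euclidean_space \<Rightarrow> real"
  assumes sq: "square_integrable f" "square_integrable g" "square_integrable f'" "square_integrable g'"
    and w: "has_weak_deriv UNIV [e] f f'" "has_weak_deriv UNIV [e] g g'" and e: "e \<in> Basis"
  shows "has_weak_deriv UNIV [e] (\<lambda>x. f x * g x) (\<lambda>x. f' x * g x + f x * g' x)"
proof -
  obtain F where F: "F \<in> borel_measurable borel" "integrable lborel (\<lambda>x. (F x)\<^sup>2)" "AE x in lebesgue. f x = F x"
    using square_integrable_borel_representative[OF sq(1)] by blast
  obtain G where G: "G \<in> borel_measurable borel" "integrable lborel (\<lambda>x. (G x)\<^sup>2)" "AE x in lebesgue. g x = G x"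
    using square_integrable_borel_representative[OF sq(2)] by blast
  obtain F' where F': "F' \<in> borel_measurable borel" "integrable lborel (\<lambda>x. (F' x)\<^sup>2)" "AE x in lebesgue. f' x = F' x"
    using square_integrable_borel_representative[OF sq(3)] by blast
  obtain G' where G': "G' \<in> borel_measurable borel" "integrable lborel (\<lambda>x. (G' x)\<^sup>2)" "AE x in lebesgue. g' x = G' x"
    using square_integrable_borel_representative[OF sq(4)] by blast
  note [measurable] = F(1) G(1) F'(1) G'(1)
  have si: "square_integrable F" "square_integrable G" "square_integrable F'" "square_integrable G'"
    using square_integrable_cong sq F(3) G(3) F'(3) G'(3) by blast+
  have wF: "has_weak_deriv UNIV [e] F F'" "has_weak_deriv UNIV [e] G G'"
    using has_weak_deriv_cong[OF w(1) e] has_weak_deriv_cong[OF w(2) e] F(3) G(3) F'(3) G'(3) by simp_all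
  have lb: "(LINT x|lebesgue. k x * \<psi> x) = (LBINT x. k x * \<psi> x)"
    if [measurable]: "k \<in> borel_measurable borel" and "test_function UNIV \<psi>" for k \<psi> :: "'a \<Rightarrow> real"
  proof -
    note [measurable] = smooth_borel_measurable[OF test_function_smooth[OF that(2)]]
    show ?thesis by (rule integral_completion) measurable
  qed
  have "has_weak_deriv UNIV [e] (\<lambda>x. F x * G x) (\<lambda>x. F' x * G x + F x * G' x)"
  proof (rule has_weak_derivI[OF e])
    have i: "integrable lebesgue (\<lambda>x. F x * G x)" "integrable lebesgue (\<lambda>x. F' x * G x)" "integrable lebesgue (\<lambda>x. F x * G' x)"
      using si by (auto intro: square_integrable_mult_integrable)
    then have l: "locally_integrable UNIV (\<lambda>x. F x * G x)" "locally_integrable UNIV (\<lambda>x. F' x * G x)" "locally_integrable UNIV (\<lambda>x. F x * G' x)"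
      by (auto intro: integrable_locally_integrable)
    then show "locally_integrable UNIV (\<lambda>x. F x * G x)" "locally_integrable UNIV (\<lambda>x. F' x * G x + F x * G' x)"
      by (auto intro: locally_integrable_add)
    fix \<phi> :: "'a \<Rightarrow> real" assume \<phi>: "test_function UNIV \<phi>"
    have D: "test_function UNIV (iter_deriv [e] \<psi>)" if "test_function UNIV \<psi>" for \<psi> :: "'a \<Rightarrow> real"
      using e that by (intro test_function_iter_deriv) auto
    have wl: "(LBINT x. k x * iter_deriv [e] \<psi> x) = - (LBINT x. k' x * \<psi> x)"
      if "has_weak_deriv UNIV [e] k k'" "k \<in> borel_measurable borel" "k' \<in> borel_measurable borel" "test_function UNIV \<psi>" for k k' \<psi> :: "'a \<Rightarrow> real"
      using has_weak_derivD[OF that(1) e that(4)] lb[OF that(2) D[OF that(4)]] lb[OF that(3,4)] by simp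
    have "(LBINT x. F x * iter_deriv [e] \<phi> x * G x) + (LBINT x. F' x * \<phi> x * G x)
      + (LBINT x. F x * \<phi> x * G' x) = 0"
      by (rule weak_product_rule_borel[OF F(1) G(1) F'(1) G'(1) F(2) G(2) F'(2) G'(2) e \<phi>])
         (use wl wF F(1) G(1) F'(1) G'(1) in blast)+
    moreover have "integrable lborel (\<lambda>x. F' x * G x * \<phi> x)" "integrable lborel (\<lambda>x. F x * G' x * \<phi> x)"
      using locally_integrable_test_integrable[OF l(2) \<phi>] locally_integrable_test_integrable[OF l(3) \<phi>]
        smooth_borel_measurable[OF test_function_smooth[OF \<phi>]]
      by (auto simp: integrable_completion)
    ultimately have "(LBINT x. F x * G x * iter_deriv [e] \<phi> x) = - (LBINT x. (F' x * G x + F x * G' x) * \<phi> x)"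
      by (simp add: algebra_simps)
    then show "(LINT x|lebesgue. F x * G x * iter_deriv [e] \<phi> x) = - (LINT x|lebesgue. (F' x * G x + F x * G' x) * \<phi> x)"
      by (subst (1 2) lb) (use \<phi> D in auto)
  qed
  then show ?thesis
  proof (rule has_weak_deriv_cong[OF _ e])
    show "AE x in lebesgue. x \<in> UNIV \<longrightarrow> F x * G x = f x * g x"
      using F(3) G(3) by eventually_elim simp
    show "AE x in lebesgue. x \<in> UNIV \<longrightarrow> F' x * G x + F x * G' x = f' x * g x + f x * g' x"
      using F(3) G(3) F'(3) G'(3) by eventually_elim simp
  qed
qed


subsection \<open>Cutoff functions\<close>

lemma dilated_test_function_limit:
  fixes g \<theta> :: "'a::euclidean_space \<Rightarrow> real"
  assumes g: "integrable lebesgue g" and \<theta>: "test_function UNIV \<theta>"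
  shows "(\<lambda>n. LINT x|lebesgue. g x * \<theta> ((1 / real (Suc n)) *\<^sub>R x)) \<longlonglongrightarrow> (LINT x|lebesgue. g x * \<theta> 0)"
    and "integrable lebesgue (\<lambda>x. g x * \<theta> (c *\<^sub>R x))"
proof -
  obtain C where C: "\<And>x. \<bar>\<theta> x\<bar> \<le> C" using test_function_bounded[OF \<theta>] by blast
  have m: "(\<lambda>x. \<theta> (c *\<^sub>R x)) \<in> borel_measurable lebesgue" for c
  proof -
    have "smooth (\<lambda>x. \<theta> (0 + c *\<^sub>R x))"
      by (rule smooth_affine[OF test_function_smooth[OF \<theta>]]) (simp add: linear_iff algebra_simps)
    then show ?thesis using smooth_borel_measurable by (intro measurable_completion) simp
  qed
  have m': "(\<lambda>x. g x * \<theta> (c *\<^sub>R x)) \<in> borel_measurable lebesgue" for c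
    using m borel_measurable_integrable[OF g] by measurable
  have w: "integrable lebesgue (\<lambda>x. C * \<bar>g x\<bar>)" using g by simp
  have b: "norm (g x * \<theta> (c *\<^sub>R x)) \<le> C * \<bar>g x\<bar>" for x c
    using C[of "c *\<^sub>R x"] by (simp add: abs_mult mult.commute[of C] mult_left_mono)
  have "C \<ge> 0" using C[of 0] by linarith
  then show "integrable lebesgue (\<lambda>x. g x * \<theta> (c *\<^sub>R x))"
    using b by (intro Bochner_Integration.integrable_bound[OF w m']) (auto simp: abs_mult)
  show "(\<lambda>n. LINT x|lebesgue. g x * \<theta> ((1 / real (Suc n)) *\<^sub>R x)) \<longlonglongrightarrow> (LINT x|lebesgue. g x * \<theta> 0)"
  proof (rule integral_dominated_convergence[OF _ m' w])
    show "(\<lambda>x. g x * \<theta> 0) \<in> borel_measurable lebesgue" using m'[of 0] by simp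
    show "AE x in lebesgue. (\<lambda>n. g x * \<theta> ((1 / real (Suc n)) *\<^sub>R x)) \<longlonglongrightarrow> g x * \<theta> 0"
    proof (intro AE_I2 tendsto_mult tendsto_const)
      fix x :: 'a
      have "(\<lambda>n. (1 / real (Suc n)) *\<^sub>R x) \<longlonglongrightarrow> 0 *\<^sub>R x"
        by (rule tendsto_scaleR[OF LIMSEQ_inverse_real_of_nat[unfolded inverse_eq_divide] tendsto_const])
      moreover have "isCont \<theta> 0"
        by (intro differentiable_imp_continuous_within smooth_differentiable test_function_smooth[OF \<theta>])
      ultimately show "(\<lambda>n. \<theta> ((1 / real (Suc n)) *\<^sub>R x)) \<longlonglongrightarrow> \<theta> 0"
        using isCont_tendsto_compose by fastforce
    qed
  qed (use b in auto)
qed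

text \<open>Dilating a bump to scale \<open>n\<close> makes it converge to a constant, normalised to \<open>1\<close>.  Its derivatives are
  of order \<open>1 / n\<close>.  The growing factor \<open>x \<bullet> e\<close> is harmless: \<open>(x \<bullet> e) \<partial>\<^sub>e\<kappa>\<close> is the dilation of a
  fixed test function that vanishes at the origin.\<close>

lemma cutoff_functions:
  obtains \<kappa> :: "nat \<Rightarrow> 'a::euclidean_space \<Rightarrow> real"
  where "\<And>n. test_function UNIV (\<kappa> n)" "\<And>n x. 0 \<le> \<kappa> n x"
    and "\<And>g. integrable lebesgue g \<Longrightarrow> (\<lambda>n. LINT x|lebesgue. g x * \<kappa> n x) \<longlonglongrightarrow> (LINT x|lebesgue. g x)"
    and "\<And>g n. integrable lebesgue g \<Longrightarrow> integrable lebesgue (\<lambda>x. g x * \<kappa> n x)"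
    and "\<And>g e. integrable lebesgue g \<Longrightarrow> e \<in> Basis \<Longrightarrow> (\<lambda>n. LINT x|lebesgue. g x * iter_deriv [e] (\<kappa> n) x) \<longlonglongrightarrow> 0"
    and "\<And>g e n. integrable lebesgue g \<Longrightarrow> e \<in> Basis \<Longrightarrow> integrable lebesgue (\<lambda>x. g x * iter_deriv [e] (\<kappa> n) x)"
    and "\<And>g e. integrable lebesgue g \<Longrightarrow> e \<in> Basis \<Longrightarrow>
      (\<lambda>n. LINT x|lebesgue. g x * ((x \<bullet> e) * iter_deriv [e] (\<kappa> n) x)) \<longlonglongrightarrow> 0"
    and "\<And>g e n. integrable lebesgue g \<Longrightarrow> e \<in> Basis \<Longrightarrow> integrable lebesgue (\<lambda>x. g x * ((x \<bullet> e) * iter_deriv [e] (\<kappa> n) x))"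
proof -
  obtain \<phi> :: "'a \<Rightarrow> real" where \<phi>: "test_function (ball 0 1) \<phi>" "\<And>x. 0 \<le> \<phi> x" "\<phi> 0 > 0"
    using bump_exists[of 1 0] by (metis zero_less_one)
  define \<theta> where "\<theta> x = (1 / \<phi> 0) * \<phi> x" for x
  have \<theta>: "test_function UNIV \<theta>"
    unfolding \<theta>_def[abs_def] by (intro test_function_mult smooth_const test_function_mono[OF \<phi>(1)]) auto
  have \<theta>0: "\<theta> 0 = 1" "\<And>x. 0 \<le> \<theta> x" using \<phi> by (auto simp: \<theta>_def)
  define \<kappa> where "\<kappa> n x = \<theta> ((1 / real (Suc n)) *\<^sub>R x)" for n x
  have D: "iter_deriv [e] (\<kappa> n) = (\<lambda>x. (1 / real (Suc n)) * iter_deriv [e] \<theta> ((1 / real (Suc n)) *\<^sub>R x))"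
    if "e \<in> Basis" for e n
    using iter_deriv_scale[OF test_function_smooth[OF \<theta>] that, of 0 "1 / real (Suc n)"]
    unfolding \<kappa>_def[abs_def] by simp
  have \<theta>': "test_function UNIV (iter_deriv [e] \<theta>)" if "e \<in> Basis" for e
    using \<theta> that by (intro test_function_iter_deriv) auto
  have \<theta>'': "test_function UNIV (\<lambda>x. (x \<bullet> e) * iter_deriv [e] \<theta> x)" if "e \<in> Basis" for e
    by (intro test_function_mult smooth_inner \<theta>' that)
  have xD: "(x \<bullet> e) * iter_deriv [e] (\<kappa> n) x =
      (\<lambda>x. (x \<bullet> e) * iter_deriv [e] \<theta> x) ((1 / real (Suc n)) *\<^sub>R x)" if "e \<in> Basis" for x e n
    unfolding D[OF that] by simp
  show ?thesis
  proof (rule that[of \<kappa>])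
    show "test_function UNIV (\<kappa> n)" for n
      unfolding \<kappa>_def[abs_def] using test_function_affine[OF \<theta>, of "1 / real (Suc n)" 0] by simp
    show "0 \<le> \<kappa> n x" for n x unfolding \<kappa>_def by (rule \<theta>0)
    fix g :: "'a \<Rightarrow> real" assume g: "integrable lebesgue g"
    show "(\<lambda>n. LINT x|lebesgue. g x * \<kappa> n x) \<longlonglongrightarrow> (LINT x|lebesgue. g x)"
      using dilated_test_function_limit(1)[OF g \<theta>] unfolding \<theta>0 \<kappa>_def by simp
    show "integrable lebesgue (\<lambda>x. g x * \<kappa> n x)" for n
      unfolding \<kappa>_def by (rule dilated_test_function_limit(2)[OF g \<theta>])
    fix e :: 'a assume e: "e \<in> Basis"
    have "(\<lambda>n. (1 / real (Suc n)) * (LINT x|lebesgue. g x * iter_deriv [e] \<theta> ((1 / real (Suc n)) *\<^sub>R x))) \<longlonglongrightarrow>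
        0 * (LINT x|lebesgue. g x * iter_deriv [e] \<theta> 0)"
      by (intro tendsto_mult dilated_test_function_limit(1)[OF g \<theta>'[OF e]] LIMSEQ_inverse_real_of_nat[unfolded inverse_eq_divide])
    moreover have "(1 / real (Suc n)) * (LINT x|lebesgue. g x * iter_deriv [e] \<theta> ((1 / real (Suc n)) *\<^sub>R x)) =
        (LINT x|lebesgue. g x * iter_deriv [e] (\<kappa> n) x)" for n
      unfolding D[OF e] integral_mult_right_zero[symmetric] by (simp only: mult.left_commute)
    ultimately show "(\<lambda>n. LINT x|lebesgue. g x * iter_deriv [e] (\<kappa> n) x) \<longlonglongrightarrow> 0" by simp
    show "integrable lebesgue (\<lambda>x. g x * iter_deriv [e] (\<kappa> n) x)" for n
      unfolding D[OF e] mult.left_commute[of "g _"]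
      by (intro integrable_mult_right dilated_test_function_limit(2)[OF g \<theta>'[OF e]])
    show "(\<lambda>n. LINT x|lebesgue. g x * ((x \<bullet> e) * iter_deriv [e] (\<kappa> n) x)) \<longlonglongrightarrow> 0"
      using dilated_test_function_limit(1)[OF g \<theta>''[OF e]] unfolding xD[OF e] by simp
    show "integrable lebesgue (\<lambda>x. g x * ((x \<bullet> e) * iter_deriv [e] (\<kappa> n) x))" for n
      unfolding xD[OF e] by (rule dilated_test_function_limit(2)[OF g \<theta>''[OF e]])
  qed
qed

lemma integral_weak_deriv_zero:
  fixes g :: "'a::euclidean_space \<Rightarrow> real"
  assumes "has_weak_deriv UNIV [e] g g'" "e \<in> Basis" "integrable lebesgue g" "integrable lebesgue g'"
  shows "(LINT x|lebesgue. g' x) = 0"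
proof -
  obtain \<kappa> :: "nat \<Rightarrow> 'a \<Rightarrow> real" where \<kappa>: "\<And>n. test_function UNIV (\<kappa> n)"
    and lim: "\<And>g. integrable lebesgue g \<Longrightarrow> (\<lambda>n. LINT x|lebesgue. g x * \<kappa> n x) \<longlonglongrightarrow> (LINT x|lebesgue. g x)"
      "\<And>g e. integrable lebesgue g \<Longrightarrow> e \<in> Basis \<Longrightarrow> (\<lambda>n. LINT x|lebesgue. g x * iter_deriv [e] (\<kappa> n) x) \<longlonglongrightarrow> 0"
    by (rule cutoff_functions) (rule that, assumption+)
  have "(\<lambda>n. - (LINT x|lebesgue. g x * iter_deriv [e] (\<kappa> n) x)) \<longlonglongrightarrow> - 0"
    by (intro tendsto_minus lim assms)
  then have "(\<lambda>n. LINT x|lebesgue. g' x * \<kappa> n x) \<longlonglongrightarrow> 0"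
    using has_weak_derivD[OF assms(1,2) \<kappa>] by simp
  with lim(1)[OF assms(4)] show ?thesis by (rule LIMSEQ_unique)
qed

subsection \<open>Sobolev functions\<close>

lemma sobolev_H_mono: "f \<in> sobolev_H m \<Longrightarrow> k \<le> m \<Longrightarrow> f \<in> sobolev_H k"
  unfolding sobolev_H_def by auto

lemma sobolev_H_square_integrable: "f \<in> sobolev_H m \<Longrightarrow> square_integrable f"
  unfolding sobolev_H_def by auto

lemma sobolev_H_weak_deriv:
  assumes "f \<in> sobolev_H (Suc m)" and e: "e \<in> Basis"
  shows "has_weak_deriv UNIV [e] f (weak_deriv UNIV [e] f)"
    and "weak_deriv UNIV [e] f \<in> sobolev_H m"
proof -
  let ?f' = "weak_deriv UNIV [e] f"
  obtain g where g: "has_weak_deriv UNIV [e] f g" "square_integrable g"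
    using assms unfolding sobolev_H_def by (force dest: bspec[of _ _ "[e]"])
  then show w: "has_weak_deriv UNIV [e] f ?f'"
    by (intro weak_deriv_works) (auto simp: weakly_differentiable_def)
  have sq: "square_integrable ?f'"
    using has_weak_deriv_unique[OF g(1) w] e by (intro square_integrable_cong[OF g(2)]) simp
  have "\<exists>g. has_weak_deriv UNIV es ?f' g \<and> square_integrable g" if es: "es \<in> lists Basis" "length es \<le> m" for es
  proof -
    have ees: "e # es \<in> lists Basis" using e es by simp
    then obtain g where g: "has_weak_deriv UNIV (e # es) f g" "square_integrable g"
      using assms es(2) unfolding sobolev_H_def by force
    have "(LINT x|lebesgue. ?f' x * iter_deriv es \<phi> x) = (- 1) ^ length es * (LINT x|lebesgue. g x * \<phi> x)"
      if \<phi>: "test_function UNIV \<phi>" for \<phi>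
    proof -
      have "(LINT x|lebesgue. f x * iter_deriv (e # es) \<phi> x) = - (LINT x|lebesgue. ?f' x * iter_deriv es \<phi> x)"
        using has_weak_derivD[OF w e test_function_iter_deriv[OF \<phi> es(1)]] iter_deriv_append[of "[e]" es \<phi>] by simp
      moreover have "(LINT x|lebesgue. f x * iter_deriv (e # es) \<phi> x) = (- 1) ^ length (e # es) * (LINT x|lebesgue. g x * \<phi> x)"
        using g(1) \<phi> by (simp add: has_weak_deriv_iff[OF ees] del: power_Suc)
      ultimately show ?thesis by simp
    qed
    then have "has_weak_deriv UNIV es ?f' g"
      using g(2) sq by (subst has_weak_deriv_iff[OF es(1)]) (auto intro: square_integrable_locally_integrable)
    then show ?thesis using g(2) by blast
  qed
  then show "?f' \<in> sobolev_H m" unfolding sobolev_H_def using sq by blast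
qed

section \<open>Self-similar fields on the space-time slab\<close>

subsection \<open>Rescaling the Lebesgue measure\<close>

lemma
  fixes f :: "'a::euclidean_space \<Rightarrow> real"
  assumes [measurable]: "f \<in> borel_measurable borel" and c: "c > 0"
  shows lborel_integral_scale: "(LBINT x. f (c *\<^sub>R x)) = (1 / c) ^ DIM('a) * (LBINT x. f x)"
    and lborel_integrable_scale: "integrable lborel (\<lambda>x. f (c *\<^sub>R x)) \<longleftrightarrow> integrable lborel f"
proof -
  let ?D = "density (distr lborel borel (\<lambda>x::'a. 0 + c *\<^sub>R x)) (\<lambda>_. ennreal (\<bar>c\<bar> ^ DIM('a)))"
  have D: "lborel = ?D" by (rule lborel_affine) (use c in simp)
  have "(LBINT x. f x) = (\<integral>x. f x \<partial>?D)" using D by simp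
  also have "\<dots> = c ^ DIM('a) * (LBINT x. f (c *\<^sub>R x))"
    using c by (subst integral_density) (auto simp: integral_distr)
  finally show "(LBINT x. f (c *\<^sub>R x)) = (1 / c) ^ DIM('a) * (LBINT x. f x)"
    using c by (simp add: power_one_over)
  have "integrable lborel f \<longleftrightarrow> integrable ?D f" using D by simp
  also have "\<dots> \<longleftrightarrow> integrable lborel (\<lambda>x. f (c *\<^sub>R x))"
    using c by (subst integrable_density) (auto simp: integrable_distr_eq)
  finally show "integrable lborel (\<lambda>x. f (c *\<^sub>R x)) \<longleftrightarrow> integrable lborel f" by simp
qed

lemma AE_lborel_scale:
  fixes P :: "'a::euclidean_space \<Rightarrow> bool"
  assumes "AE x in lborel. P x" "c > 0"
  shows "AE x in lborel. P (c *\<^sub>R x)"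
proof -
  let ?D = "density (distr lborel borel (\<lambda>x::'a. 0 + c *\<^sub>R x)) (\<lambda>_. ennreal (\<bar>c\<bar> ^ DIM('a)))"
  have D: "lborel = ?D" by (rule lborel_affine) (use assms in simp)
  obtain N where N: "{x \<in> space lborel. \<not> P x} \<subseteq> N" "emeasure lborel N = 0" "N \<in> sets lborel"
    using AE_E[OF assms(1)] .
  then have [measurable]: "N \<in> sets borel" by simp
  have "AE x in lborel. x \<notin> N"
    using N by (intro AE_not_in) auto
  then have "AE x in ?D. x \<notin> N" by (rule subst[OF D, where P="\<lambda>M. AE x in M. x \<notin> N"])
  then have "AE x in distr lborel borel (\<lambda>x::'a. 0 + c *\<^sub>R x). x \<notin> N"
    using assms(2) by (subst (asm) AE_density) auto
  then have "AE x in lborel. c *\<^sub>R x \<notin> N"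
    by (subst (asm) AE_distr_iff) auto
  then show ?thesis
    by eventually_elim (use N(1) in auto)
qed

text \<open>The integrands of all space-time integrals have this form: a bounded function of bounded support
  times a locally integrable profile on the time slices, dilated by \<open>c t\<close>.  The bounds on the dilation
  factor make the integrals over the slices uniformly bounded.\<close>

lemma lborel_iterated_integral_scaled:
  fixes u :: "real \<times> 'a::euclidean_space \<Rightarrow> real" and g :: "'a \<Rightarrow> real" and c :: "real \<Rightarrow> real"
  assumes u: "u \<in> borel_measurable borel" and [measurable]: "g \<in> borel_measurable borel" "c \<in> borel_measurable borel"
    and C: "\<And>z. \<bar>u z\<bar> \<le> C" and g: "locally_integrable UNIV g"
    and supp: "\<forall>t x. u (t, x) \<noteq> 0 \<longrightarrow> 0 < t \<and> t < T \<and> 0 < c t \<and> 1 / c t \<le> Q \<and> norm (c t *\<^sub>R x) \<le> R"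
  shows "integrable (lborel \<Otimes>\<^sub>M lborel) (\<lambda>(t, x). u (t, x) * g (c t *\<^sub>R x))" (is ?i)
    and "integrable lborel (\<lambda>x. u (t, x) * g (c t *\<^sub>R x))" (is ?s)
    and "(LBINT z. u z * g (c (fst z) *\<^sub>R snd z)) = (LBINT t. LBINT x. u (t, x) * g (c t *\<^sub>R x))" (is ?e)
proof -
  have [measurable]: "u \<in> borel_measurable (lborel \<Otimes>\<^sub>M lborel)" using u by (simp add: lborel_prod)
  define G where "G y = indicator (cball 0 R) y * g y" for y
  have [measurable]: "G \<in> borel_measurable borel" unfolding G_def[abs_def]
    by (intro borel_measurable_times borel_measurable_indicator assms(2)) auto
  have G: "integrable lborel G"
  proof -
    have "integrable lebesgue G"
      using g unfolding G_def locally_integrable_def set_integrable_def by auto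
    then show ?thesis by (subst (asm) integrable_completion) auto
  qed
  have uG: "u (t, x) * g (c t *\<^sub>R x) = u (t, x) * G (c t *\<^sub>R x)" for t x
    using supp by (cases "u (t, x) = 0") (auto simp: G_def)
  have C0: "C \<ge> 0" using C[of undefined] by linarith
  have Gn: "0 \<le> (LBINT x. \<bar>G x\<bar>)" by simp
  have good: "integrable lborel (\<lambda>x. u (t, x) * G (c t *\<^sub>R x)) \<and>
      (LBINT x. \<bar>u (t, x) * G (c t *\<^sub>R x)\<bar>) \<le> indicator {0<..<T} t * (C * \<bar>Q\<bar> ^ DIM('a) * (LBINT x. \<bar>G x\<bar>))" for t
  proof (cases "\<exists>x. u (t, x) \<noteq> 0")
    case True
    then have t: "0 < t" "t < T" "0 < c t" "1 / c t \<le> Q" using supp by blast+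
    have Gc: "integrable lborel (\<lambda>x. G (c t *\<^sub>R x))"
      using G lborel_integrable_scale[OF _ t(3), of G] by simp
    have b: "\<bar>u (t, x) * G (c t *\<^sub>R x)\<bar> \<le> C * \<bar>G (c t *\<^sub>R x)\<bar>" for x
      using C[of "(t, x)"] by (simp add: abs_mult mult_right_mono)
    have i: "integrable lborel (\<lambda>x. u (t, x) * G (c t *\<^sub>R x))"
      by (rule Bochner_Integration.integrable_bound[where f="\<lambda>x. C * \<bar>G (c t *\<^sub>R x)\<bar>"]) (use Gc b C0 in \<open>auto simp: abs_mult\<close>)
    have "(LBINT x. \<bar>u (t, x) * G (c t *\<^sub>R x)\<bar>) \<le> (LBINT x. C * \<bar>G (c t *\<^sub>R x)\<bar>)"
      using integrable_abs[OF i] Gc b by (intro integral_mono) auto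
    also have "\<dots> = C * ((1 / c t) ^ DIM('a) * (LBINT x. \<bar>G x\<bar>))"
      using lborel_integral_scale[OF _ t(3), of "\<lambda>x. \<bar>G x\<bar>"] by simp
    also have "\<dots> \<le> C * (\<bar>Q\<bar> ^ DIM('a) * (LBINT x. \<bar>G x\<bar>))"
      using t C0 by (intro mult_left_mono mult_right_mono power_mono) auto
    finally show ?thesis using i t by (simp add: mult.assoc)
  next
    case False
    then show ?thesis using C0 by (auto simp: indicator_def)
  qed
  have m: "(\<lambda>(t, x). u (t, x) * g (c t *\<^sub>R x)) \<in> borel_measurable (lborel \<Otimes>\<^sub>M lborel)" by measurable
  show i: ?i
  proof (rule lborel_pair.Fubini_integrable[OF m])
    show "integrable lborel (\<lambda>t. LBINT x. norm (case (t, x) of (t, x) \<Rightarrow> u (t, x) * g (c t *\<^sub>R x)))"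
    proof (rule Bochner_Integration.integrable_bound)
      show "integrable lborel (\<lambda>t. indicator {0<..<T} t * (C * \<bar>Q\<bar> ^ DIM('a) * (LBINT x. \<bar>G x\<bar>)))"
        by (intro integrable_mult_left integrable_real_indicator) (cases "0 \<le> T"; simp)+
      show "(\<lambda>t. LBINT x. norm (case (t, x) of (t, x) \<Rightarrow> u (t, x) * g (c t *\<^sub>R x))) \<in> borel_measurable lborel"
        by measurable
      show "AE t in lborel. norm (LBINT x. norm (case (t, x) of (t, x) \<Rightarrow> u (t, x) * g (c t *\<^sub>R x)))
          \<le> norm (indicator {0<..<T} t * (C * \<bar>Q\<bar> ^ DIM('a) * (LBINT x. \<bar>G x\<bar>)))"
        using good C0 by (intro AE_I2) (auto simp: uG abs_mult simp del: abs_mult_self_eq)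
    qed
    show "AE t in lborel. integrable lborel (\<lambda>x. case (t, x) of (t, x) \<Rightarrow> u (t, x) * g (c t *\<^sub>R x))"
      using good by (simp add: uG)
  qed
  show ?s using good by (simp add: uG)
  show ?e using lborel_pair.integral_fst[OF i] by (simp add: lborel_prod case_prod_unfold)
qed

subsection \<open>The slab\<close>

lemma open_slab: "open (slab T)"
  unfolding slab_def by (intro open_Times) auto

lemma e_t_Basis: "e_t \<in> Basis"
  unfolding e_t_def Basis_prod_def by simp

lemma e_x_Basis: "e_x i \<in> Basis"
  unfolding e_x_def Basis_prod_def by (auto simp: axis_in_Basis_iff)

abbreviation dilation :: "real \<Rightarrow> real \<Rightarrow> real" where
  "dilation T t \<equiv> 1 / sqrt (T - t)"

text \<open>The field with profile \<open>g\<close> and homogeneity \<open>k\<close>; each spatial derivative raises \<open>k\<close> by one, and a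
  time derivative raises it by two.\<close>

abbreviation dilated :: "real \<Rightarrow> nat \<Rightarrow> (real^'n \<Rightarrow> real) \<Rightarrow> real \<times> (real^'n) \<Rightarrow> real" where
  "dilated T k g z \<equiv> dilation T (fst z) ^ k * g (dilation T (fst z) *\<^sub>R snd z)"

text \<open>The profiles are determined only up to null sets, so null sets have to be transported between the
  slab and the profile variable, in both directions.\<close>

lemma AE_slab_scaled:
  fixes P :: "real^'n \<Rightarrow> bool"
  assumes "AE y in lebesgue. P y"
  shows "AE z in lebesgue. z \<in> slab T \<longrightarrow> P (dilation T (fst z) *\<^sub>R snd z)"
proof -
  have "AE y in lborel. P y" using assms by (simp add: AE_completion_iff)
  then obtain N where N: "{x \<in> space lborel. \<not> P x} \<subseteq> N" "emeasure lborel N = 0" "N \<in> sets lborel"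
    by (rule AE_E)
  then have [measurable]: "N \<in> sets borel" by simp
  have N0: "AE y in lborel. y \<notin> N" using N by (intro AE_not_in) auto
  have "AE z in lborel \<Otimes>\<^sub>M lborel. (0 < fst z \<and> fst z < T) \<longrightarrow> dilation T (fst z) *\<^sub>R snd z \<notin> N"
  proof (rule lborel_pair.AE_pair_measure)
    show "{z \<in> space (lborel \<Otimes>\<^sub>M lborel). 0 < fst z \<and> fst z < T \<longrightarrow> dilation T (fst z) *\<^sub>R snd z \<notin> N}
       \<in> sets (lborel \<Otimes>\<^sub>M lborel)" by measurable
    show "AE t in lborel. AE x in lborel. 0 < fst (t, x) \<and> fst (t, x) < T \<longrightarrow> dilation T (fst (t, x)) *\<^sub>R snd (t, x) \<notin> N"
    proof (rule AE_I2)
      fix t :: real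
      show "AE x in lborel. 0 < fst (t, x) \<and> fst (t, x) < T \<longrightarrow> dilation T (fst (t, x)) *\<^sub>R snd (t, x) \<notin> N"
      proof (cases "t < T")
        case True
        have "AE x in lborel. dilation T t *\<^sub>R x \<notin> N"
          by (rule AE_lborel_scale[OF N0]) (use True in simp)
        then show ?thesis by eventually_elim auto
      qed simp
    qed
  qed
  then have "AE z in lborel. (0 < fst z \<and> fst z < T) \<longrightarrow> dilation T (fst z) *\<^sub>R snd z \<notin> N"
    unfolding lborel_prod .
  from AE_completion[OF this] show ?thesis
    by eventually_elim (use N(1) in \<open>auto simp: slab_def\<close>)
qed

lemma AE_slab_scaledD:
  fixes P :: "real^'n \<Rightarrow> bool"
  assumes "AE z in lebesgue. z \<in> slab T \<longrightarrow> P (dilation T (fst z) *\<^sub>R snd z)" "T > 0"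
  shows "AE y in lebesgue. P y"
proof -
  have "AE z in lborel \<Otimes>\<^sub>M lborel. z \<in> slab T \<longrightarrow> P (dilation T (fst z) *\<^sub>R snd z)"
    unfolding lborel_prod using assms(1) by (simp add: AE_completion_iff)
  from lborel_pair.AE_pair[OF this]
  have ae: "AE t in lborel. AE x in lborel. t \<in> {0<..<T} \<longrightarrow> P (dilation T t *\<^sub>R x)"
    by (simp add: slab_def)
  have "\<exists>t\<in>{0<..<T}. AE x in lborel. P (dilation T t *\<^sub>R x)"
  proof (rule ccontr)
    assume no: "\<not> ?thesis"
    have "AE t in lborel. t \<notin> {0<..<T}"
      using ae by (rule eventually_mono) (use no in auto)
    then have "emeasure lborel {0<..<T} = 0"
      by (subst (asm) AE_iff_measurable[of "{0<..<T}"]) auto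
    then show False using assms(2) by simp
  qed
  then obtain t where t: "t \<in> {0<..<T}" "AE x in lborel. P (dilation T t *\<^sub>R x)" by blast
  from AE_lborel_scale[OF t(2), of "sqrt (T - t)"]
  have "AE x in lborel. P x" using t(1) by simp
  then show ?thesis by (rule AE_completion)
qed

lemma compact_slab_bounds:
  fixes K :: "(real \<times> (real^'n)) set"
  assumes "compact K" "K \<subseteq> slab T" "T > 0"
  obtains a b r where "0 < a" "a < b" "b < T" "\<And>t x. (t, x) \<in> K \<Longrightarrow> a < t \<and> t < b \<and> norm x \<le> r"
proof -
  have c: "compact (fst ` K)" by (intro compact_continuous_image assms continuous_intros)
  have "fst ` K \<subseteq> {0<..<T}" using assms(2) by (auto simp: slab_def)
  obtain r where r: "\<And>z. z \<in> K \<Longrightarrow> norm z \<le> r"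
    using compact_imp_bounded[OF assms(1)] unfolding bounded_iff by blast
  have rx: "norm x \<le> r" if "(t, x) \<in> K" for t x
    using r[OF that] norm_snd_le[of x t] by (simp add: norm_Pair) (meson order_trans real_sqrt_sum_squares_ge2)
  show ?thesis
  proof (cases "K = {}")
    case True
    then show ?thesis using that[of "T / 3" "T / 2" r] assms(3) by auto
  next
    case False
    then have "fst ` K \<noteq> {}" by simp
    from compact_attains_inf[OF c this] compact_attains_sup[OF c this]
    obtain m M where m: "m \<in> fst ` K" "\<forall>t\<in>fst ` K. m \<le> t" and M: "M \<in> fst ` K" "\<forall>t\<in>fst ` K. t \<le> M"
      by (elim bexE) (rule that, assumption+)
    have mM: "0 < m" "M < T" "m \<le> M" using m M \<open>fst ` K \<subseteq> {0<..<T}\<close> by auto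
    show ?thesis
    proof (rule that[of "m / 2" "(M + T) / 2" r])
      fix t x assume z: "(t, x) \<in> K"
      then have "t \<in> fst ` K" by force
      then show "m / 2 < t \<and> t < (M + T) / 2 \<and> norm x \<le> r"
        using m M mM rx[OF z] by force
    qed (use mM in auto)
  qed
qed

lemma slab_test_slice:
  fixes \<phi> :: "real \<times> (real^'n) \<Rightarrow> real"
  assumes \<phi>: "test_function (slab T) \<phi>"
  shows "test_function UNIV (\<lambda>x. \<phi> (t, x))"
    and "iter_deriv [axis i 1] (\<lambda>x. \<phi> (t, x)) = (\<lambda>x. iter_deriv [e_x i] \<phi> (t, x))"
proof -
  obtain K where K: "smooth \<phi>" "compact K" "\<And>z. z \<notin> K \<Longrightarrow> \<phi> z = 0"
    using \<phi> unfolding test_function_def by blast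
  have lin: "linear (\<lambda>x::real^'n. (0::real, x))" by (simp add: linear_iff)
  have "smooth (\<lambda>x. \<phi> ((t, 0) + (0, x)))" by (rule smooth_affine[OF K(1) lin])
  moreover have "compact (snd ` K)" by (intro compact_continuous_image K continuous_intros)
  moreover have "\<phi> (t, x) = 0" if "x \<notin> snd ` K" for x
    using that by (intro K(3)) force
  ultimately show "test_function UNIV (\<lambda>x. \<phi> (t, x))" by (intro test_functionI) auto
  have "iter_deriv [axis i 1] (\<lambda>x. \<phi> ((t, 0) + (0, x))) =
     (\<lambda>x. \<Sum>b\<in>Basis. ((0, axis i 1) \<bullet> b) * iter_deriv [b] \<phi> ((t, 0) + (0, x)))"
    by (rule iter_deriv_affine(1)[OF K(1) lin])
  also have "\<dots> = (\<lambda>x. iter_deriv [e_x i] \<phi> (t, x))"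
    using sum_Basis_inner_left[OF e_x_Basis, of 1 i] by (simp add: e_x_def)
  finally show "iter_deriv [axis i 1] (\<lambda>x. \<phi> (t, x)) = (\<lambda>x. iter_deriv [e_x i] \<phi> (t, x))" by simp
qed

lemma test_integral_lborel:
  assumes "k \<in> borel_measurable borel" "test_function \<Omega> \<psi>"
  shows "(LINT x|lebesgue. k x * \<psi> x) = (LBINT x. k x * \<psi> x)"
  using assms smooth_borel_measurable[OF test_function_smooth[OF assms(2)]]
  by (intro integral_completion) simp

text \<open>Substituting \<open>y = c x\<close> turns \<open>\<psi>\<close> into the dilated test function \<open>\<psi> (y / c)\<close>.\<close>

lemma weak_deriv_scaled_test:
  fixes f f' :: "'a::euclidean_space \<Rightarrow> real"
  assumes w: "has_weak_deriv UNIV [e] f f'" and e: "e \<in> Basis"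
    and [measurable]: "f \<in> borel_measurable borel" "f' \<in> borel_measurable borel"
    and \<psi>: "test_function UNIV \<psi>" and c: "c > 0"
  shows "(LBINT x. f (c *\<^sub>R x) * iter_deriv [e] \<psi> x) = - c * (LBINT x. f' (c *\<^sub>R x) * \<psi> x)"
proof -
  let ?r = "\<lambda>y. \<psi> (0 + (1 / c) *\<^sub>R y)"
  have D: "test_function UNIV (iter_deriv [e] \<psi>)" using e \<psi> by (intro test_function_iter_deriv) auto
  note [measurable] = smooth_borel_measurable[OF test_function_smooth[OF \<psi>]] smooth_borel_measurable[OF test_function_smooth[OF D]]
  have r: "test_function UNIV ?r" by (rule test_function_affine[OF \<psi>]) (use c in simp)
  have r': "iter_deriv [e] ?r = (\<lambda>y. (1 / c) * iter_deriv [e] \<psi> (0 + (1 / c) *\<^sub>R y))"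
    by (rule iter_deriv_scale[OF test_function_smooth[OF \<psi>] e])
  have Dr: "test_function UNIV (iter_deriv [e] ?r)" using e r by (intro test_function_iter_deriv) auto
  have "(LBINT y. f y * iter_deriv [e] ?r y) = - (LBINT y. f' y * ?r y)"
    using has_weak_derivD[OF w e r] test_integral_lborel[OF _ Dr, of f] test_integral_lborel[OF _ r, of f'] by simp
  then have *: "(LBINT y. f y * iter_deriv [e] \<psi> ((1 / c) *\<^sub>R y)) = - c * (LBINT y. f' y * \<psi> ((1 / c) *\<^sub>R y))"
    unfolding r' using c by (simp add: field_simps)
  have "(LBINT x. f (c *\<^sub>R x) * iter_deriv [e] \<psi> x) = (1 / c) ^ DIM('a) * (LBINT y. f y * iter_deriv [e] \<psi> ((1 / c) *\<^sub>R y))"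
    using lborel_integral_scale[OF _ c, of "\<lambda>y. f y * iter_deriv [e] \<psi> ((1 / c) *\<^sub>R y)"] c by simp
  also have "\<dots> = - c * ((1 / c) ^ DIM('a) * (LBINT y. f' y * \<psi> ((1 / c) *\<^sub>R y)))"
    unfolding * by simp
  also have "(1 / c) ^ DIM('a) * (LBINT y. f' y * \<psi> ((1 / c) *\<^sub>R y)) = (LBINT x. f' (c *\<^sub>R x) * \<psi> x)"
    using lborel_integral_scale[OF _ c, of "\<lambda>y. f' y * \<psi> ((1 / c) *\<^sub>R y)"] c by simp
  finally show ?thesis .
qed

lemma
  fixes g :: "real^'n \<Rightarrow> real" and \<theta> :: "real \<times> (real^'n) \<Rightarrow> real"
  assumes g[measurable]: "g \<in> borel_measurable borel" and lg: "locally_integrable UNIV g" and T: "T > 0"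
    and K: "compact K" "K \<subseteq> slab T"
    and \<theta>: "\<theta> \<in> borel_measurable borel" "\<And>z. \<bar>\<theta> z\<bar> \<le> C" "\<forall>z. z \<notin> K \<longrightarrow> \<theta> z = 0"
  shows slab_integrable: "integrable lebesgue (\<lambda>z. dilated T k g z * \<theta> z)" (is ?i)
    and slab_integral: "(LINT z|lebesgue. dilated T k g z * \<theta> z)
      = (LBINT t. LBINT x. dilation T t ^ k * g (dilation T t *\<^sub>R x) * \<theta> (t, x))" (is ?e)
    and slab_slice_integrable: "integrable lborel (\<lambda>x. dilation T t ^ k * g (dilation T t *\<^sub>R x) * \<theta> (t, x))" (is ?s)
    and slab_outer_integrable: "integrable lborel (\<lambda>t. LBINT x. dilation T t ^ k * g (dilation T t *\<^sub>R x) * \<theta> (t, x))" (is ?o)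
proof -
  obtain a b r where ab: "0 < a" "a < b" "b < T" "\<And>t x. (t, x) \<in> K \<Longrightarrow> a < t \<and> t < b \<and> norm x \<le> r"
    using compact_slab_bounds[OF K T] by metis
  have \<theta>m[measurable]: "\<theta> \<in> borel_measurable (lborel \<Otimes>\<^sub>M lborel)" using \<theta>(1) by (simp add: lborel_prod)
  define u where "u z = dilation T (fst z) ^ k * \<theta> z" for z
  have um: "u \<in> borel_measurable (lborel \<Otimes>\<^sub>M lborel)" unfolding u_def[abs_def] by measurable
  then have u: "u \<in> borel_measurable borel" by (simp add: lborel_prod)
  have dm: "(\<lambda>t. dilation T t) \<in> borel_measurable borel" by measurable
  have dil: "0 < dilation T t" "dilation T t \<le> dilation T b" "1 / dilation T t \<le> sqrt T" if "(t, x) \<in> K" for t x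
    using ab(1,2,3) ab(4)[OF that] by (auto simp: frac_le)
  have C0: "C \<ge> 0" using \<theta>(2)[of undefined] by linarith
  have ub: "\<bar>u z\<bar> \<le> dilation T b ^ k * C" for z
  proof (cases "z \<in> K")
    case True
    then have "(fst z, snd z) \<in> K" by simp
    note d = dil[OF this]
    have "\<bar>dilation T (fst z) ^ k\<bar> \<le> dilation T b ^ k" using d by (simp add: power_mono)
    then show ?thesis unfolding u_def abs_mult using \<theta>(2) by (intro mult_mono) auto
  next
    case False
    then have "\<theta> z = 0" using \<theta>(3) by blast
    then show ?thesis using C0 ab by (simp add: u_def)
  qed
  have supp: "0 < t \<and> t < T \<and> 0 < dilation T t \<and> 1 / dilation T t \<le> sqrt T \<and> norm (dilation T t *\<^sub>R x) \<le> dilation T b * r"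
    if "u (t, x) \<noteq> 0" for t x
  proof -
    have "(t, x) \<in> K" using that \<theta>(3) by (auto simp: u_def)
    note d = dil[OF this] ab(4)[OF this]
    have "norm (dilation T t *\<^sub>R x) = dilation T t * norm x" using d by simp
    also have "\<dots> \<le> dilation T b * r" using d ab by (intro mult_mono) auto
    finally show ?thesis using d ab by auto
  qed
  then have supp': "\<forall>t x. u (t, x) \<noteq> 0 \<longrightarrow> 0 < t \<and> t < T \<and> 0 < dilation T t \<and> 1 / dilation T t \<le> sqrt T \<and> norm (dilation T t *\<^sub>R x) \<le> dilation T b * r"
    by blast
  note li = lborel_iterated_integral_scaled[OF u g dm ub lg supp']
  have eq: "u (t, x) * g (dilation T t *\<^sub>R x) = dilation T t ^ k * g (dilation T t *\<^sub>R x) * \<theta> (t, x)" for t x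
    by (simp add: u_def)
  have m: "(\<lambda>z. dilated T k g z * \<theta> z) \<in> borel_measurable lborel"
  proof -
    have "(\<lambda>z. dilated T k g z * \<theta> z) \<in> borel_measurable (lborel \<Otimes>\<^sub>M lborel)"
      by measurable
    then show ?thesis unfolding lborel_prod .
  qed
  have "integrable (lborel \<Otimes>\<^sub>M lborel) (\<lambda>z. dilated T k g z * \<theta> z)"
    using li(1) unfolding eq by (simp add: case_prod_unfold)
  then show ?i unfolding lborel_prod using m by (subst integrable_completion) auto
  have "(LINT z|lebesgue. dilated T k g z * \<theta> z)
     = (LBINT z. u z * g (dilation T (fst z) *\<^sub>R snd z))"
    unfolding integral_completion[OF m] by (intro Bochner_Integration.integral_cong refl) (simp add: u_def)
  then show ?e using li(3) unfolding eq by simp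
  show ?s using li(2) unfolding eq .
  show ?o using lborel_pair.integrable_fst[OF li(1)] unfolding eq .
qed

lemma slab_dilated_locally_integrable_borel:
  fixes g :: "real^'n \<Rightarrow> real"
  assumes "g \<in> borel_measurable borel" "locally_integrable UNIV g" "T > 0"
  shows "locally_integrable (slab T) (dilated T k g)"
  unfolding locally_integrable_def set_integrable_def
proof safe
  fix K :: "(real \<times> (real^'n)) set" assume K: "compact K" "K \<subseteq> slab T"
  have "integrable lebesgue (\<lambda>z. dilated T k g z * indicat_real K z)"
    by (rule slab_integrable[OF assms K borel_measurable_indicator[OF borel_compact[OF K(1)]], of 1]) auto
  then show "integrable lebesgue (\<lambda>z. indicat_real K z *\<^sub>R (dilated T k g z))"
    by (simp add: mult.commute)
qed

lemma slab_test_function_bounds: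
  fixes \<phi> :: "real \<times> (real^'n) \<Rightarrow> real"
  assumes "test_function (slab T) \<phi>"
  obtains K C where "compact K" "K \<subseteq> slab T" "\<phi> \<in> borel_measurable borel" "\<And>z. \<bar>\<phi> z\<bar> \<le> C" "\<forall>z. z \<notin> K \<longrightarrow> \<phi> z = 0"
proof -
  obtain K where "compact K" "K \<subseteq> slab T" "\<And>z. z \<notin> K \<Longrightarrow> \<phi> z = 0"
    using assms unfolding test_function_def by blast
  moreover obtain C where C: "\<And>z. \<bar>\<phi> z\<bar> \<le> C" using test_function_bounded[OF assms] by blast
  ultimately show ?thesis
    using that smooth_borel_measurable[OF test_function_smooth[OF assms]] by blast
qed

lemma slab_spatial_derivative_borel:
  fixes f f' :: "real^'n \<Rightarrow> real"
  assumes m: "f \<in> borel_measurable borel" "f' \<in> borel_measurable borel"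
    and w: "has_weak_deriv UNIV [axis i 1] f f'" and T: "T > 0"
  shows "has_weak_deriv (slab T) [e_x i] (dilated T k f) (dilated T (k + 1) f')"
proof (rule has_weak_derivI[OF e_x_Basis])
  have l: "locally_integrable UNIV f" "locally_integrable UNIV f'"
    using has_weak_deriv_locally_integrable[OF w] .
  show "locally_integrable (slab T) (dilated T k f)"
    "locally_integrable (slab T) (dilated T (k + 1) f')"
    using slab_dilated_locally_integrable_borel m l T by blast+
  fix \<phi> :: "real \<times> (real^'n) \<Rightarrow> real" assume \<phi>: "test_function (slab T) \<phi>"
  have D: "test_function (slab T) (iter_deriv [e_x i] \<phi>)"
    using e_x_Basis \<phi> by (intro test_function_iter_deriv) auto
  obtain K C where K: "compact K" "K \<subseteq> slab T" "\<phi> \<in> borel_measurable borel" "\<And>z. \<bar>\<phi> z\<bar> \<le> C" "\<forall>z. z \<notin> K \<longrightarrow> \<phi> z = 0"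
    using slab_test_function_bounds[OF \<phi>] by metis
  obtain K' C' where K': "compact K'" "K' \<subseteq> slab T" "iter_deriv [e_x i] \<phi> \<in> borel_measurable borel"
    "\<And>z. \<bar>iter_deriv [e_x i] \<phi> z\<bar> \<le> C'" "\<forall>z. z \<notin> K' \<longrightarrow> iter_deriv [e_x i] \<phi> z = 0"
    using slab_test_function_bounds[OF D] by metis
  have sl: "(LBINT x. dilation T t ^ k * f (dilation T t *\<^sub>R x) * iter_deriv [e_x i] \<phi> (t, x))
    = - (LBINT x. dilation T t ^ (k + 1) * f' (dilation T t *\<^sub>R x) * \<phi> (t, x))" for t
  proof (cases "t < T")
    case True
    then have "(LBINT x. f (dilation T t *\<^sub>R x) * iter_deriv [axis i 1] (\<lambda>x. \<phi> (t, x)) x) =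
      - dilation T t * (LBINT x. f' (dilation T t *\<^sub>R x) * \<phi> (t, x))"
      by (intro weak_deriv_scaled_test[OF w _ m] slab_test_slice(1)[OF \<phi>]) (auto simp: axis_in_Basis_iff)
    then show ?thesis
      unfolding slab_test_slice(2)[OF \<phi>] mult.assoc by simp
  next
    case False
    then have "(t, x) \<notin> K" "(t, x) \<notin> K'" for x using K(2) K'(2) by (auto simp: slab_def)
    then have "\<phi> (t, x) = 0" "iter_deriv [e_x i] \<phi> (t, x) = 0" for x
      using K(5) K'(5) by auto
    then show ?thesis by simp
  qed
  show "(LINT z|lebesgue. dilated T k f z * iter_deriv [e_x i] \<phi> z) =
      - (LINT z|lebesgue. dilated T (k + 1) f' z * \<phi> z)"
    using slab_integral[OF m(1) l(1) T K', of k] slab_integral[OF m(2) l(2) T K, of "k + 1"] sl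
    by (simp only: integral_minus)
qed

lemma slab_spatial_derivative:
  fixes f f' :: "real^'n \<Rightarrow> real"
  assumes w: "has_weak_deriv UNIV [axis i 1] f f'" and T: "T > 0"
  shows "has_weak_deriv (slab T) [e_x i] (dilated T k f) (dilated T (k + 1) f')"
proof -
  have e: "axis i 1 \<in> (Basis :: (real^'n) set)" by (simp add: axis_in_Basis_iff)
  obtain F where F: "F \<in> borel_measurable borel" "AE x in lebesgue. x \<in> UNIV \<longrightarrow> f x = F x"
    using locally_integrable_borel_representative[OF has_weak_deriv_locally_integrable(1)[OF w] open_UNIV] by blast
  obtain F' where F': "F' \<in> borel_measurable borel" "AE x in lebesgue. x \<in> UNIV \<longrightarrow> f' x = F' x"
    using locally_integrable_borel_representative[OF has_weak_deriv_locally_integrable(2)[OF w] open_UNIV] by blast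
  note wF = slab_spatial_derivative_borel[OF F(1) F'(1) has_weak_deriv_cong[OF w e F(2) F'(2)] T, of k]
  show ?thesis
  proof (rule has_weak_deriv_cong[OF wF e_x_Basis])
    have "AE x in lebesgue. f x = F x" "AE x in lebesgue. f' x = F' x" using F(2) F'(2) by simp_all
    note this[THEN AE_slab_scaled[where T=T]]
    then show "AE z in lebesgue. z \<in> slab T \<longrightarrow> dilated T k F z =
        dilated T k f z"
      "AE z in lebesgue. z \<in> slab T \<longrightarrow> dilated T (k + 1) F' z =
        dilated T (k + 1) f' z"
      by (auto elim: eventually_mono)
  qed
qed


subsection \<open>The time derivative of a self-similar field\<close>

lemma sum_Basis_vec: "(\<Sum>b\<in>(Basis :: (real^'n) set). F b) = (\<Sum>i\<in>UNIV. F (axis i 1))"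
proof -
  have "(Basis :: (real^'n) set) = range (\<lambda>i. axis i 1)" by (auto simp: Basis_vec_def)
  moreover have "inj (\<lambda>i::'n. axis i (1::real))" by (auto simp: inj_def axis_eq_axis)
  ultimately show ?thesis using sum.reindex[of "\<lambda>i::'n. axis i (1::real)" UNIV F] by (simp add: o_def)
qed

lemma sum_Basis_slab:
  fixes k :: "real^'n"
  shows "(\<Sum>b\<in>Basis. ((h, k) \<bullet> b) * F b) = h * F e_t + (\<Sum>i\<in>UNIV. k $ i * F (e_x i))"
proof -
  have "(\<Sum>b\<in>Basis. ((h, k) \<bullet> b) * F b) =
    (\<Sum>b\<in>(\<lambda>u. (u, 0)) ` (Basis :: real set). ((h, k) \<bullet> b) * F b) + (\<Sum>b\<in>(\<lambda>u. (0, u)) ` (Basis :: (real^'n) set). ((h, k) \<bullet> b) * F b)"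
    unfolding Basis_prod_def by (intro sum.union_disjoint) auto
  also have "(\<Sum>b\<in>(\<lambda>u. (u, 0)) ` (Basis :: real set). ((h, k) \<bullet> b) * F b) = h * F e_t"
    by (simp add: e_t_def)
  also have "(\<Sum>b\<in>(\<lambda>u. (0, u)) ` (Basis :: (real^'n) set). ((h, k) \<bullet> b) * F b) = (\<Sum>u\<in>(Basis :: (real^'n) set). (k \<bullet> u) * F (0, u))"
    by (subst sum.reindex) (auto simp: inj_on_def)
  also have "\<dots> = (\<Sum>i\<in>UNIV. k $ i * F (e_x i))"
    unfolding sum_Basis_vec by (simp add: e_x_def inner_axis)
  finally show ?thesis .
qed

lemma scaled_test_integrable:
  fixes f \<psi> :: "'a::euclidean_space \<Rightarrow> real"
  assumes [measurable]: "f \<in> borel_measurable borel" and f: "locally_integrable UNIV f"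
    and \<psi>: "test_function UNIV \<psi>" and c: "c > 0"
  shows "integrable lborel (\<lambda>x. f (c *\<^sub>R x) * \<psi> x)"
proof -
  note [measurable] = smooth_borel_measurable[OF test_function_smooth[OF \<psi>]]
  have r: "test_function UNIV (\<lambda>y. \<psi> (0 + (1 / c) *\<^sub>R y))" by (rule test_function_affine[OF \<psi>]) (use c in simp)
  have "integrable lborel (\<lambda>y. f y * \<psi> ((1 / c) *\<^sub>R y))"
    using locally_integrable_test_integrable[OF f r] by (subst (asm) integrable_completion) auto
  then have "integrable lborel (\<lambda>x. f (c *\<^sub>R x) * \<psi> ((1 / c) *\<^sub>R c *\<^sub>R x))"
    using lborel_integrable_scale[OF _ c, of "\<lambda>y. f y * \<psi> ((1 / c) *\<^sub>R y)"] by simp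
  then show ?thesis using c by simp
qed

lemma locally_integrable_sum:
  "(\<And>i. i \<in> I \<Longrightarrow> locally_integrable \<Omega> (f i)) \<Longrightarrow> locally_integrable \<Omega> (\<lambda>x. \<Sum>i\<in>I. f i x)"
  by (induction I rule: infinite_finite_induct) (auto intro: locally_integrable_const locally_integrable_add)

lemma smooth_component: "smooth (\<lambda>x::real^'n. x $ i)"
  using smooth_inner[of "axis i 1 :: real^'n"] by (simp add: inner_axis)

lemma iter_deriv_component_delta: "iter_deriv [axis j 1] (\<lambda>x::real^'n. x $ i) = (\<lambda>x. if i = j then 1 else 0)"
proof -
  have "((\<lambda>x::real^'n. x $ i) has_derivative (\<lambda>h. h $ i)) (at x)" for x
    by (rule bounded_linear_imp_has_derivative) (rule bounded_linear_vec_nth)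
  from iter_deriv_eqI[OF this, of "axis j 1"] show ?thesis by (auto simp: axis_def)
qed

lemma iter_deriv_component: "iter_deriv [axis i 1] (\<lambda>x::real^'n. x $ i) = (\<lambda>x. 1)"
  by (simp add: iter_deriv_component_delta)

text \<open>The function \<open>(f + y \<cdot> \<nabla>f) / 2\<close> for \<open>f' = \<nabla>f\<close>, up to the factor \<open>1 / 2\<close> the derivative of
  \<open>\<lambda> f(\<lambda> y)\<close> in \<open>\<lambda>\<close> at \<open>\<lambda> = 1\<close>.\<close>

definition euler_generator :: "(real^'n \<Rightarrow> real) \<Rightarrow> ('n \<Rightarrow> real^'n \<Rightarrow> real) \<Rightarrow> real^'n \<Rightarrow> real" where
  "euler_generator f f' y = (1 / 2) * (f y + (\<Sum>i\<in>UNIV. y $ i * f' i y))"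

text \<open>The weak derivatives of \<open>f\<close> are tested against \<open>x\<^sub>i \<psi>\<close>; the \<open>n\<close> derivatives of the factors
  \<open>x\<^sub>i\<close> produce the coefficient \<open>1 - n\<close>.\<close>

lemma euler_generator_test_slice:
  fixes f :: "real^'n \<Rightarrow> real" and f' :: "'n \<Rightarrow> real^'n \<Rightarrow> real"
  assumes m: "f \<in> borel_measurable borel" "\<And>i. f' i \<in> borel_measurable borel"
    and w: "\<And>i. has_weak_deriv UNIV [axis i 1] f (f' i)"
    and \<psi>: "test_function UNIV \<psi>" and c: "c > 0"
  shows "(LBINT x. euler_generator f f' (c *\<^sub>R x) * \<psi> x) =
    (LBINT x. f (c *\<^sub>R x) * ((1 / 2) * ((1 - real CARD('n)) * \<psi> x - (\<Sum>i\<in>UNIV. x $ i * iter_deriv [axis i 1] \<psi> x))))"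
proof -
  have e: "axis i 1 \<in> (Basis :: (real^'n) set)" for i by (simp add: axis_in_Basis_iff)
  have l: "locally_integrable UNIV f" "\<And>i. locally_integrable UNIV (f' i)"
    using has_weak_deriv_locally_integrable w by blast+
  have \<psi>x: "test_function UNIV (\<lambda>x. x $ i * \<psi> x)" for i by (intro test_function_mult smooth_component \<psi>)
  have D\<psi>: "test_function UNIV (iter_deriv [axis i 1] \<psi>)" for i
    using e \<psi> by (intro test_function_iter_deriv) auto
  have xD: "test_function UNIV (\<lambda>x. x $ i * iter_deriv [axis i 1] \<psi> x)" for i
    by (intro test_function_mult smooth_component D\<psi>)
  have D: "iter_deriv [axis i 1] (\<lambda>x. x $ i * \<psi> x) = (\<lambda>x. x $ i * iter_deriv [axis i 1] \<psi> x + 1 * \<psi> x)" for i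
    using iter_deriv_mult[OF smooth_differentiable[OF smooth_component] smooth_differentiable[OF test_function_smooth[OF \<psi>]], of "axis i 1" i]
    unfolding iter_deriv_component .
  note i = scaled_test_integrable[OF m(1) l(1) _ c] scaled_test_integrable[OF m(2) l(2) _ c]
  have s: "(LBINT x. f' i (c *\<^sub>R x) * ((c *\<^sub>R x) $ i * \<psi> x)) =
    - (LBINT x. f (c *\<^sub>R x) * (x $ i * iter_deriv [axis i 1] \<psi> x)) - (LBINT x. f (c *\<^sub>R x) * \<psi> x)" for i
  proof -
    have "(LBINT x. f' i (c *\<^sub>R x) * ((c *\<^sub>R x) $ i * \<psi> x)) = c * (LBINT x. f' i (c *\<^sub>R x) * (x $ i * \<psi> x))"
      by (subst integral_mult_right_zero[symmetric]) (simp add: ac_simps)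
    also have "\<dots> = - (LBINT x. f (c *\<^sub>R x) * (x $ i * iter_deriv [axis i 1] \<psi> x + 1 * \<psi> x))"
      using weak_deriv_scaled_test[OF w[of i] e m(1) m(2) \<psi>x[of i] c] unfolding D by simp
    also have "\<dots> = - (LBINT x. f (c *\<^sub>R x) * (x $ i * iter_deriv [axis i 1] \<psi> x)) - (LBINT x. f (c *\<^sub>R x) * \<psi> x)"
      using i(1)[OF xD] i(1)[OF \<psi>] by (simp add: distrib_left)
    finally show ?thesis .
  qed
  have ii: "integrable lborel (\<lambda>x. f' i (c *\<^sub>R x) * ((c *\<^sub>R x) $ i * \<psi> x))" for i
    using integrable_mult_right[OF i(2)[OF \<psi>x], of c] by (simp add: ac_simps)
  have "(LBINT x. euler_generator f f' (c *\<^sub>R x) * \<psi> x) =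
     (LBINT x. (1 / 2) * (f (c *\<^sub>R x) * \<psi> x + (\<Sum>i\<in>UNIV. f' i (c *\<^sub>R x) * ((c *\<^sub>R x) $ i * \<psi> x))))"
  proof (intro Bochner_Integration.integral_cong refl)
    fix x
    have "(\<Sum>i\<in>UNIV. (c *\<^sub>R x) $ i * f' i (c *\<^sub>R x)) * \<psi> x = (\<Sum>i\<in>UNIV. f' i (c *\<^sub>R x) * ((c *\<^sub>R x) $ i * \<psi> x))"
      unfolding sum_distrib_right by (intro sum.cong refl) (simp add: ac_simps)
    then show "euler_generator f f' (c *\<^sub>R x) * \<psi> x =
       (1 / 2) * (f (c *\<^sub>R x) * \<psi> x + (\<Sum>i\<in>UNIV. f' i (c *\<^sub>R x) * ((c *\<^sub>R x) $ i * \<psi> x)))"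
      unfolding euler_generator_def by (simp only: distrib_right mult.assoc)
  qed
  also have "\<dots> = (1 / 2) * ((LBINT x. f (c *\<^sub>R x) * \<psi> x) + (\<Sum>i\<in>UNIV. LBINT x. f' i (c *\<^sub>R x) * ((c *\<^sub>R x) $ i * \<psi> x)))"
    using i(1)[OF \<psi>] ii by (simp del: vector_scaleR_component)
  also have "\<dots> = (1 / 2) * ((1 - real CARD('n)) * (LBINT x. f (c *\<^sub>R x) * \<psi> x) - (\<Sum>i\<in>UNIV. LBINT x. f (c *\<^sub>R x) * (x $ i * iter_deriv [axis i 1] \<psi> x)))"
    unfolding s by (simp add: sum_subtractf sum_negf algebra_simps)
  also have "\<dots> = (LBINT x. (1 / 2) * ((1 - real CARD('n)) * (f (c *\<^sub>R x) * \<psi> x) - (\<Sum>i\<in>UNIV. f (c *\<^sub>R x) * (x $ i * iter_deriv [axis i 1] \<psi> x))))"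
    using i(1)[OF \<psi>] i(1)[OF xD] by simp
  also have "\<dots> = (LBINT x. f (c *\<^sub>R x) * ((1 / 2) * ((1 - real CARD('n)) * \<psi> x - (\<Sum>i\<in>UNIV. x $ i * iter_deriv [axis i 1] \<psi> x))))"
    by (intro Bochner_Integration.integral_cong refl) (simp add: right_diff_distrib sum_distrib_left ac_simps)
  finally show ?thesis .
qed

text \<open>Write \<open>s = sqrt (T - t)\<close>, the reciprocal of the dilation factor.  Once the spatial derivatives of \<open>f\<close>
  have been moved to the test function and \<open>y = x / s\<close> is substituted on every slice, the difference
  of the two sides becomes the integral of \<open>f(y)\<close> times the total \<open>t\<close>-derivative of
  \<open>s\<^sup>n\<^sup>-\<^sup>1 \<phi>(t, s y)\<close>.  For each \<open>y\<close> the \<open>t\<close>-integral of that derivative vanishes.\<close>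

lemma slab_time_derivative_borel:
  fixes f :: "real^'n \<Rightarrow> real" and f' :: "'n \<Rightarrow> real^'n \<Rightarrow> real"
  assumes m: "f \<in> borel_measurable borel" "\<And>i. f' i \<in> borel_measurable borel"
    and w: "\<And>i. has_weak_deriv UNIV [axis i 1] f (f' i)" and T: "T > 0"
  shows "has_weak_deriv (slab T) [e_t] (dilated T 1 f) (dilated T 3 (euler_generator f f'))"
proof (rule has_weak_derivI[OF e_t_Basis])
  note [measurable] = m
  have l: "locally_integrable UNIV f" "\<And>i. locally_integrable UNIV (f' i)"
    using has_weak_deriv_locally_integrable w by blast+
  let ?G = "euler_generator f f'"
  have Gm: "?G \<in> borel_measurable borel"
    unfolding euler_generator_def[abs_def] by measurable
  have Gl: "locally_integrable UNIV ?G"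
    unfolding euler_generator_def[abs_def]
    by (intro locally_integrable_cmult locally_integrable_add locally_integrable_sum
        locally_integrable_smooth_mult smooth_component l)
  show "locally_integrable (slab T) (dilated T 1 f)"
    "locally_integrable (slab T) (dilated T 3 ?G)"
    by (intro slab_dilated_locally_integrable_borel m l Gm Gl T)+
  fix \<phi> :: "real \<times> (real^'n) \<Rightarrow> real" assume \<phi>: "test_function (slab T) \<phi>"
  obtain K where K: "smooth \<phi>" "compact K" "K \<subseteq> slab T" "\<And>z. z \<notin> K \<Longrightarrow> \<phi> z = 0"
    using \<phi> unfolding test_function_def by blast
  obtain a b r where ab: "0 < a" "a < b" "b < T" "\<And>t x. (t, x) \<in> K \<Longrightarrow> a < t \<and> t < b \<and> norm x \<le> r"
    using compact_slab_bounds[OF K(2,3) T] by metis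
  define n where "n = CARD('n)"
  define Dt where "Dt = iter_deriv [e_t] \<phi>"
  define \<Theta> where "\<Theta> z = (1 / 2) * ((1 - real n) * \<phi> z - (\<Sum>i\<in>UNIV. snd z $ i * iter_deriv [e_x i] \<phi> z))" for z
  have tDt: "test_function (slab T) Dt"
    unfolding Dt_def using e_t_Basis \<phi> by (intro test_function_iter_deriv) auto
  have Kz: "iter_deriv es \<phi> z = 0" if "z \<notin> K" for es z
    using iter_deriv_zero_outside[OF compact_imp_closed[OF K(2)] K(4) that] .
  have s\<Theta>: "smooth \<Theta>"
  proof -
    have "smooth (\<lambda>z::real \<times> (real^'n). z \<bullet> (0, axis i 1) * iter_deriv [e_x i] \<phi> z)" for i
      using e_x_Basis by (intro smooth_mult smooth_inner smooth_iter_deriv K) auto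
    then have "smooth (\<lambda>z. (1 / 2) * ((1 - real n) * \<phi> z + (- 1) * (\<Sum>i\<in>UNIV. z \<bullet> (0, axis i 1) * iter_deriv [e_x i] \<phi> z)))"
      by (intro smooth_cmult smooth_add smooth_sum K)
    then show ?thesis unfolding \<Theta>_def[abs_def] by (simp add: inner_prod_def inner_axis inner_real_def)
  qed
  have \<Theta>0: "\<Theta> z = 0" if "z \<notin> K" for z
    using that K(4) Kz by (simp add: \<Theta>_def)
  have t\<Theta>: "test_function (slab T) \<Theta>" by (rule test_functionI[OF s\<Theta> K(2,3) \<Theta>0])
  have Dt0: "Dt z = 0" if "z \<notin> K" for z using Kz that by (simp add: Dt_def)
  have K0: "\<forall>z. z \<notin> K \<longrightarrow> \<phi> z = 0" "\<forall>z. z \<notin> K \<longrightarrow> Dt z = 0" "\<forall>z. z \<notin> K \<longrightarrow> \<Theta> z = 0"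
    using K(4) Dt0 \<Theta>0 by blast+
  obtain C1 where C1: "\<And>z. \<bar>Dt z\<bar> \<le> C1" using test_function_bounded[OF tDt] by blast
  obtain C2 where C2: "\<And>z. \<bar>\<Theta> z\<bar> \<le> C2" using test_function_bounded[OF t\<Theta>] by blast
  obtain C3 where C3: "\<And>z. \<bar>\<phi> z\<bar> \<le> C3" using test_function_bounded[OF \<phi>] by blast
  have Dtm: "Dt \<in> borel_measurable borel" and \<Theta>m: "\<Theta> \<in> borel_measurable borel" and \<phi>m: "\<phi> \<in> borel_measurable borel"
    using smooth_borel_measurable[OF test_function_smooth] tDt t\<Theta> \<phi> by blast+
  have m': "Dt \<in> borel_measurable (lborel \<Otimes>\<^sub>M lborel)" "\<Theta> \<in> borel_measurable (lborel \<Otimes>\<^sub>M lborel)"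
    using Dtm \<Theta>m by (simp_all add: lborel_prod)
  note [measurable] = m'
  \<comment> \<open>on each slice the derivatives of \<open>f\<close> are moved to the test function\<close>
  have rhs: "(LBINT x. dilation T t ^ 3 * ?G (dilation T t *\<^sub>R x) * \<phi> (t, x)) =
      (LBINT x. dilation T t ^ 3 * f (dilation T t *\<^sub>R x) * \<Theta> (t, x))" for t
  proof (cases "t < T")
    case True
    then have "(LBINT x. ?G (dilation T t *\<^sub>R x) * \<phi> (t, x)) = (LBINT x. f (dilation T t *\<^sub>R x) * \<Theta> (t, x))"
      using euler_generator_test_slice[OF m w slab_test_slice(1)[OF \<phi>], of "dilation T t" t]
      unfolding slab_test_slice(2)[OF \<phi>] \<Theta>_def n_def by simp
    then show ?thesis by (simp add: mult.assoc)
  next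
    case False
    then have "(t, x) \<notin> K" for x using K(3) by (auto simp: slab_def)
    then show ?thesis using K(4) \<Theta>0 by simp
  qed
  let ?q = "\<lambda>t y. sqrt (T - t) ^ n * (dilation T t ^ 1 * Dt (t, sqrt (T - t) *\<^sub>R y) + dilation T t ^ 3 * \<Theta> (t, sqrt (T - t) *\<^sub>R y))"
  define u where "u z = indicator {0<..<T} (fst z) * ?q (fst z) (snd z)" for z
  have um: "u \<in> borel_measurable borel"
  proof -
    have "u \<in> borel_measurable (lborel \<Otimes>\<^sub>M lborel)" unfolding u_def[abs_def] by measurable
    then show ?thesis by (simp add: lborel_prod)
  qed
  have uK: "(t, sqrt (T - t) *\<^sub>R y) \<in> K" if "u (t, y) \<noteq> 0" for t y
  proof (rule ccontr)
    assume "(t, sqrt (T - t) *\<^sub>R y) \<notin> K"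
    then show False using that Dt0 \<Theta>0 by (simp add: u_def)
  qed
  \<comment> \<open>the substitution \<open>y = x / s\<close> on each slice\<close>
  have inner: "(LBINT x. dilation T t ^ 1 * f (dilation T t *\<^sub>R x) * Dt (t, x)) +
      (LBINT x. dilation T t ^ 3 * f (dilation T t *\<^sub>R x) * \<Theta> (t, x)) = (LBINT y. u (t, y) * f (1 *\<^sub>R y))" for t
  proof (cases "0 < t \<and> t < T")
    case True
    then have c: "dilation T t > 0" by simp
    let ?h = "\<lambda>y. f y * (dilation T t ^ 1 * Dt (t, sqrt (T - t) *\<^sub>R y) + dilation T t ^ 3 * \<Theta> (t, sqrt (T - t) *\<^sub>R y))"
    have hm: "?h \<in> borel_measurable borel"
    proof -
      have "(\<lambda>y. Dt (t, sqrt (T - t) *\<^sub>R y)) \<in> borel_measurable lborel" "(\<lambda>y. \<Theta> (t, sqrt (T - t) *\<^sub>R y)) \<in> borel_measurable lborel"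
        by measurable
      then show ?thesis by simp
    qed
    have "(LBINT x. dilation T t ^ 1 * f (dilation T t *\<^sub>R x) * Dt (t, x)) +
      (LBINT x. dilation T t ^ 3 * f (dilation T t *\<^sub>R x) * \<Theta> (t, x)) =
      (LBINT x. dilation T t ^ 1 * f (dilation T t *\<^sub>R x) * Dt (t, x) + dilation T t ^ 3 * f (dilation T t *\<^sub>R x) * \<Theta> (t, x))"
      by (intro Bochner_Integration.integral_add[symmetric]
          slab_slice_integrable[OF m(1) l(1) T K(2,3) Dtm C1 K0(2)] slab_slice_integrable[OF m(1) l(1) T K(2,3) \<Theta>m C2 K0(3)])
    also have "\<dots> = (LBINT x. ?h (dilation T t *\<^sub>R x))"
      using True by (intro Bochner_Integration.integral_cong refl) (simp add: distrib_left mult.left_commute mult.assoc)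
    also have "\<dots> = sqrt (T - t) ^ n * (LBINT y. ?h y)"
      unfolding lborel_integral_scale[OF hm c] by (simp add: n_def)
    also have "\<dots> = (LBINT y. u (t, y) * f (1 *\<^sub>R y))"
      unfolding integral_mult_right_zero[symmetric]
      using True by (intro Bochner_Integration.integral_cong refl) (simp add: u_def)
    finally show ?thesis .
  next
    case False
    then have "(t, x) \<notin> K" for x using K(3) by (auto simp: slab_def)
    then show ?thesis using Dt0 \<Theta>0 False by (simp add: u_def)
  qed
  have zero: "(LBINT t. u (t, y)) = 0" for y
  proof -
    obtain p where p: "n = Suc p" unfolding n_def using zero_less_card_finite not0_implies_Suc by blast
    let ?s = "\<lambda>t. sqrt (T - t)"
    define \<gamma> where "\<gamma> t = ?s t ^ p * \<phi> (t, ?s t *\<^sub>R y)" for t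
    have der: "(\<gamma> has_real_derivative ?q t y) (at t)" if t: "t < T" for t
    proof -
      have s0: "?s t > 0" using t by simp
      have ds: "(?s has_real_derivative - 1 / (2 * ?s t)) (at t)"
        using t by (auto intro!: derivative_eq_intros simp: field_simps)
      have eq: "(*) (- 1 / (2 * ?s t)) = (\<lambda>h. h * (- 1 / (2 * ?s t)))" by (rule ext) (rule mult.commute)
      note ds' = ds[unfolded has_field_derivative_def eq]
      have "((\<lambda>t. (t, ?s t *\<^sub>R y)) has_derivative (\<lambda>h. (h, (h * (- 1 / (2 * ?s t))) *\<^sub>R y))) (at t)"
        by (intro has_derivative_Pair has_derivative_ident has_derivative_scaleR_left ds')
      from has_derivative_compose[OF this smooth_has_derivative[OF K(1)]]
      have "((\<lambda>t. \<phi> (t, ?s t *\<^sub>R y)) has_derivative (\<lambda>h. h * Dt (t, ?s t *\<^sub>R y) +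
          (\<Sum>i\<in>UNIV. ((h * (- 1 / (2 * ?s t))) *\<^sub>R y) $ i * iter_deriv [e_x i] \<phi> (t, ?s t *\<^sub>R y)))) (at t)"
        unfolding sum_Basis_slab Dt_def .
      moreover have "(\<lambda>h. h * Dt (t, ?s t *\<^sub>R y) +
          (\<Sum>i\<in>UNIV. ((h * (- 1 / (2 * ?s t))) *\<^sub>R y) $ i * iter_deriv [e_x i] \<phi> (t, ?s t *\<^sub>R y))) =
          (*) (Dt (t, ?s t *\<^sub>R y) - 1 / (2 * ?s t) * (\<Sum>i\<in>UNIV. y $ i * iter_deriv [e_x i] \<phi> (t, ?s t *\<^sub>R y)))"
        by (rule ext) (simp add: sum_distrib_left sum_negf algebra_simps sum_divide_distrib)
      ultimately have d\<phi>: "((\<lambda>t. \<phi> (t, ?s t *\<^sub>R y)) has_real_derivative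
          Dt (t, ?s t *\<^sub>R y) - 1 / (2 * ?s t) * (\<Sum>i\<in>UNIV. y $ i * iter_deriv [e_x i] \<phi> (t, ?s t *\<^sub>R y))) (at t)"
        unfolding has_field_derivative_def by simp
      define S where "S = (\<Sum>i\<in>UNIV. y $ i * iter_deriv [e_x i] \<phi> (t, ?s t *\<^sub>R y))"
      have \<Theta>S: "\<Theta> (t, ?s t *\<^sub>R y) = (1 / 2) * (- real p * \<phi> (t, ?s t *\<^sub>R y) - ?s t * S)"
        unfolding \<Theta>_def S_def by (simp add: p sum_distrib_left mult.assoc)
      have "(\<gamma> has_real_derivative (real p * ((- 1 / (2 * ?s t)) * ?s t ^ (p - Suc 0))) * \<phi> (t, ?s t *\<^sub>R y) +
          (Dt (t, ?s t *\<^sub>R y) - 1 / (2 * ?s t) * S) * ?s t ^ p) (at t)"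
        unfolding \<gamma>_def S_def by (intro DERIV_mult DERIV_power ds d\<phi>)
      moreover have "(real p * ((- 1 / (2 * ?s t)) * ?s t ^ (p - Suc 0))) * \<phi> (t, ?s t *\<^sub>R y) +
          (Dt (t, ?s t *\<^sub>R y) - 1 / (2 * ?s t) * S) * ?s t ^ p = ?q t y"
      proof -
        have gen: "(real p * ((- 1 / (2 * s)) * s ^ (p - Suc 0))) * A + (D - 1 / (2 * s) * S) * s ^ p =
          s ^ Suc p * ((1 / s) ^ 1 * D + (1 / s) ^ 3 * ((1 / 2) * (- real p * A - s * S)))" if "s > 0" for s A D :: real
          using that by (cases p) (simp_all add: field_simps power3_eq_cube)
        show ?thesis unfolding \<Theta>S p by (rule gen[OF s0])
      qed
      ultimately show ?thesis by simp
    qed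
    have cont: "isCont (\<lambda>t. ?q t y) t" if t: "t < T" for t
    proof -
      have "isCont (\<lambda>t. \<psi> (t, ?s t *\<^sub>R y)) t" if "smooth \<psi>" for \<psi> :: "real \<times> (real^'n) \<Rightarrow> real"
        by (rule isCont_o2[where g=\<psi>, OF _ smooth_isCont[OF that]]) (intro continuous_intros)
      from this[OF test_function_smooth[OF tDt]] this[OF s\<Theta>] show ?thesis
        using t by (intro continuous_intros) auto
    qed
    have "has_bochner_integral lborel (\<lambda>t. ?q t y * indicator {a..b} t) (\<gamma> b - \<gamma> a)"
      by (rule has_bochner_integral_FTC_Icc_real) (use ab der cont in auto)
    moreover have "?q t y * indicator {a..b} t = u (t, y)" for t
    proof (cases "t \<in> {a..b}")
      case True
      then show ?thesis using ab by (simp add: u_def)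
    next
      case False
      then have "(t, sqrt (T - t) *\<^sub>R y) \<notin> K" using ab(4)[of t] by fastforce
      then show ?thesis using uK False by (metis indicator_simps(2) mult_zero_right)
    qed
    moreover have "(a, x) \<notin> K" "(b, x) \<notin> K" for x using ab(4)[of a x] ab(4)[of b x] by auto
    then have "\<gamma> a = 0" "\<gamma> b = 0" using K(4) by (simp_all add: \<gamma>_def)
    ultimately show ?thesis by (simp add: has_bochner_integral_integral_eq)
  qed
  have ub: "\<bar>u z\<bar> \<le> sqrt T ^ n * (dilation T b ^ 1 * C1 + dilation T b ^ 3 * C2)" for z
  proof -
    have C0: "0 \<le> C1" "0 \<le> C2" using C1[of undefined] C2[of undefined] by linarith+
    show ?thesis
    proof (cases "u z = 0")
      case False
      obtain t y where z: "z = (t, y)" by fastforce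
      have "(t, sqrt (T - t) *\<^sub>R y) \<in> K" using uK False z by simp
      then have t: "0 < t" "t < T" "a < t" "t < b" using ab(1,3) ab(4)[of t "sqrt (T - t) *\<^sub>R y"] by auto
      have d: "0 < dilation T t" "dilation T t \<le> dilation T b" using t ab by (auto simp: frac_le)
      have "\<bar>dilation T t ^ 1 * Dt (t, sqrt (T - t) *\<^sub>R y) + dilation T t ^ 3 * \<Theta> (t, sqrt (T - t) *\<^sub>R y)\<bar> \<le>
         \<bar>dilation T t ^ 1 * Dt (t, sqrt (T - t) *\<^sub>R y)\<bar> + \<bar>dilation T t ^ 3 * \<Theta> (t, sqrt (T - t) *\<^sub>R y)\<bar>" by (rule abs_triangle_ineq)
      also have "\<dots> \<le> dilation T b ^ 1 * C1 + dilation T b ^ 3 * C2"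
      proof (rule add_mono)
        show "\<bar>dilation T t ^ 1 * Dt (t, sqrt (T - t) *\<^sub>R y)\<bar> \<le> dilation T b ^ 1 * C1"
          unfolding abs_mult using d C1 ab by (intro mult_mono) auto
        have "\<bar>dilation T t ^ 3\<bar> \<le> dilation T b ^ 3" using d by (simp add: power_mono del: power_divide)
        then show "\<bar>dilation T t ^ 3 * \<Theta> (t, sqrt (T - t) *\<^sub>R y)\<bar> \<le> dilation T b ^ 3 * C2"
          unfolding abs_mult using C2 ab by (intro mult_mono) auto
      qed
      finally have *: "\<bar>dilation T t ^ 1 * Dt (t, sqrt (T - t) *\<^sub>R y) + dilation T t ^ 3 * \<Theta> (t, sqrt (T - t) *\<^sub>R y)\<bar>
        \<le> dilation T b ^ 1 * C1 + dilation T b ^ 3 * C2" .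
      have "\<bar>sqrt (T - t) ^ n\<bar> \<le> sqrt T ^ n" using t by (simp add: power_mono)
      then have "\<bar>?q t y\<bar> \<le> sqrt T ^ n * (dilation T b ^ 1 * C1 + dilation T b ^ 3 * C2)"
        unfolding abs_mult[of "sqrt (T - t) ^ n"] using * by (intro mult_mono) (use t in auto)
      moreover have "u z = ?q t y" using t by (simp add: u_def z)
      ultimately show ?thesis by simp
    qed (use C0 ab T in simp)
  qed
  have supp: "0 < t \<and> t < T \<and> 0 < (1 :: real) \<and> 1 / (1 :: real) \<le> 1 \<and> norm (1 *\<^sub>R y) \<le> r / sqrt (T - b)"
    if "u (t, y) \<noteq> 0" for t y
  proof -
    have "(t, sqrt (T - t) *\<^sub>R y) \<in> K" using uK that .
    then have t: "0 < t" "t < T" "t < b" "norm (sqrt (T - t) *\<^sub>R y) \<le> r" using ab(1,3) ab(4)[of t "sqrt (T - t) *\<^sub>R y"] by auto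
    have "sqrt (T - b) * norm y \<le> sqrt (T - t) * norm y" using t by (intro mult_right_mono) auto
    also have "\<dots> \<le> r" using t by simp
    finally have "norm y \<le> r / sqrt (T - b)" using ab by (simp add: pos_le_divide_eq mult.commute)
    then show ?thesis using t by simp
  qed
  have "(\<lambda>_. 1 :: real) \<in> borel_measurable borel" by simp
  from lborel_iterated_integral_scaled(1)[OF um m(1) this ub l(1), of T 1 "r / sqrt (T - b)"] supp
  have iu: "integrable (lborel \<Otimes>\<^sub>M lborel) (\<lambda>(t, x). u (t, x) * f (1 *\<^sub>R x))" by blast
  have "(LBINT t. LBINT x. dilation T t ^ 1 * f (dilation T t *\<^sub>R x) * Dt (t, x)) +
      (LBINT t. LBINT x. dilation T t ^ 3 * f (dilation T t *\<^sub>R x) * \<Theta> (t, x)) =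
      (LBINT t. (LBINT x. dilation T t ^ 1 * f (dilation T t *\<^sub>R x) * Dt (t, x)) +
      (LBINT x. dilation T t ^ 3 * f (dilation T t *\<^sub>R x) * \<Theta> (t, x)))"
    by (intro Bochner_Integration.integral_add[symmetric]
        slab_outer_integrable[OF m(1) l(1) T K(2,3) Dtm C1 K0(2)] slab_outer_integrable[OF m(1) l(1) T K(2,3) \<Theta>m C2 K0(3)])
  also have "\<dots> = (LBINT t. LBINT y. u (t, y) * f (1 *\<^sub>R y))"
    unfolding inner ..
  also have "\<dots> = (LBINT y. LBINT t. u (t, y) * f (1 *\<^sub>R y))"
    by (rule lborel_pair.Fubini_integral[OF iu, symmetric])
  also have "\<dots> = 0" using zero by simp
  finally show "(LINT z|lebesgue. dilated T 1 f z * iter_deriv [e_t] \<phi> z) =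
      - (LINT z|lebesgue. dilated T 3 ?G z * \<phi> z)"
    using slab_integral[OF m(1) l(1) T K(2,3) Dtm C1 K0(2), of 1]
      slab_integral[OF Gm Gl T K(2,3) \<phi>m C3 K0(1), of 3] unfolding Dt_def[symmetric] rhs by linarith
qed

lemma slab_time_derivative:
  fixes f :: "real^'n \<Rightarrow> real" and f' :: "'n \<Rightarrow> real^'n \<Rightarrow> real"
  assumes w: "\<And>i. has_weak_deriv UNIV [axis i 1] f (f' i)" and T: "T > 0"
  shows "has_weak_deriv (slab T) [e_t] (dilated T 1 f) (dilated T 3 (euler_generator f f'))"
proof -
  have e: "axis i 1 \<in> (Basis :: (real^'n) set)" for i by (simp add: axis_in_Basis_iff)
  obtain F where F: "F \<in> borel_measurable borel" "AE x in lebesgue. x \<in> UNIV \<longrightarrow> f x = F x"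
    using locally_integrable_borel_representative[OF has_weak_deriv_locally_integrable(1)[OF w] open_UNIV] by blast
  have "\<exists>F'. F' \<in> borel_measurable borel \<and> (AE x in lebesgue. x \<in> UNIV \<longrightarrow> f' i x = F' x)" for i
    using locally_integrable_borel_representative[OF has_weak_deriv_locally_integrable(2)[OF w[of i]] open_UNIV] by blast
  then obtain F' where F': "\<And>i. F' i \<in> borel_measurable borel" "\<And>i. AE x in lebesgue. x \<in> UNIV \<longrightarrow> f' i x = F' i x"
    by metis
  note wF = slab_time_derivative_borel[OF F(1) F'(1) has_weak_deriv_cong[OF w e F(2) F'(2)] T]
  show ?thesis
  proof (rule has_weak_deriv_cong[OF wF e_t_Basis])
    have 1: "AE x in lebesgue. f x = F x" using F(2) by simp
    have "AE x in lebesgue. \<forall>i. f' i x = F' i x" using F'(2) by (simp add: AE_all_countable)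
    with 1 have 2: "AE x in lebesgue. euler_generator f f' x = euler_generator F F' x"
      by eventually_elim (simp add: euler_generator_def)
    show "AE z in lebesgue. z \<in> slab T \<longrightarrow> dilated T 1 F z =
        dilated T 1 f z"
      using AE_slab_scaled[OF 1, of T] by eventually_elim auto
    show "AE z in lebesgue. z \<in> slab T \<longrightarrow> dilated T 3 (euler_generator F F') z =
        dilated T 3 (euler_generator f f') z"
      using AE_slab_scaled[OF 2, of T] by eventually_elim auto
  qed
qed

section \<open>The enstrophy estimate\<close>

lemma axis_Basis: "axis i (1::real) \<in> Basis"
  by (simp add: axis_in_Basis_iff)

lemma square_integrable_zero: "square_integrable (\<lambda>x. 0)"
  by (simp add: square_integrable_def)

lemma square_integrable_sum:
  "(\<And>i. i \<in> I \<Longrightarrow> square_integrable (f i)) \<Longrightarrow> square_integrable (\<lambda>x. \<Sum>i\<in>I. f i x)"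
  by (induction I rule: infinite_finite_induct) (auto intro: square_integrable_add square_integrable_zero)

text \<open>The square of \<open>f\<close> has zero derivative in the direction \<open>i\<close> as well.  Testing with \<open>y\<^sub>i \<kappa>\<close> for a
  cutoff \<open>\<kappa>\<close> gives \<open>\<integral> f\<^sup>2 \<kappa> = - \<integral> f\<^sup>2 y\<^sub>i \<partial>\<^sub>i\<kappa>\<close>, which tends to zero.\<close>

lemma square_integrable_eq_zero:
  fixes f :: "real^'n \<Rightarrow> real"
  assumes f: "square_integrable f" and w: "has_weak_deriv UNIV [axis i 1] f f'" and zero: "AE y in lebesgue. f' y = 0"
  shows "AE y in lebesgue. f y = 0"
proof -
  have w0: "has_weak_deriv UNIV [axis i 1] f (\<lambda>y. 0)"
    by (rule has_weak_deriv_cong[OF w axis_Basis]) (use zero in auto)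
  have w2: "has_weak_deriv UNIV [axis i 1] (\<lambda>y. f y * f y) (\<lambda>y. 0)"
    using weak_product_rule[OF f f square_integrable_zero square_integrable_zero w0 w0 axis_Basis] by simp
  have int: "integrable lebesgue (\<lambda>y. f y * f y)" by (rule square_integrable_mult_integrable[OF f f])
  obtain \<kappa> :: "nat \<Rightarrow> real^'n \<Rightarrow> real" where \<kappa>: "\<And>n. test_function UNIV (\<kappa> n)"
    and lim: "\<And>g. integrable lebesgue g \<Longrightarrow> (\<lambda>n. LINT x|lebesgue. g x * \<kappa> n x) \<longlonglongrightarrow> (LINT x|lebesgue. g x)"
    and i: "\<And>g n. integrable lebesgue g \<Longrightarrow> integrable lebesgue (\<lambda>x. g x * \<kappa> n x)"
    and limx: "\<And>g e. integrable lebesgue g \<Longrightarrow> e \<in> Basis \<Longrightarrow>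
      (\<lambda>n. LINT x|lebesgue. g x * ((x \<bullet> e) * iter_deriv [e] (\<kappa> n) x)) \<longlonglongrightarrow> 0"
    and ix: "\<And>g e n. integrable lebesgue g \<Longrightarrow> e \<in> Basis \<Longrightarrow> integrable lebesgue (\<lambda>x. g x * ((x \<bullet> e) * iter_deriv [e] (\<kappa> n) x))"
    by (rule cutoff_functions) (rule that, assumption+)
  have "(LINT y|lebesgue. f y * f y * \<kappa> n y) = - (LINT y|lebesgue. f y * f y * ((y \<bullet> axis i 1) * iter_deriv [axis i 1] (\<kappa> n) y))" for n
  proof -
    have t: "test_function UNIV (\<lambda>y. y $ i * \<kappa> n y)" by (intro test_function_mult smooth_component \<kappa>)
    have "iter_deriv [axis i 1] (\<lambda>y. y $ i * \<kappa> n y) = (\<lambda>y. y $ i * iter_deriv [axis i 1] (\<kappa> n) y + 1 * \<kappa> n y)"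
      using iter_deriv_mult[OF smooth_differentiable[OF smooth_component] smooth_differentiable[OF test_function_smooth[OF \<kappa>]], of "axis i 1" i]
      unfolding iter_deriv_component .
    then have "(LINT y|lebesgue. f y * f y * ((y \<bullet> axis i 1) * iter_deriv [axis i 1] (\<kappa> n) y) + f y * f y * \<kappa> n y) = 0"
      using has_weak_derivD[OF w2 axis_Basis t] by (simp add: inner_axis distrib_left)
    then show ?thesis using ix[OF int axis_Basis, of i n] i[OF int, of n] by simp
  qed
  then have "(\<lambda>n. LINT y|lebesgue. f y * f y * \<kappa> n y) \<longlonglongrightarrow> 0"
    using tendsto_minus[OF limx[OF int axis_Basis[of i]]] by simp
  with lim[OF int] have "(LINT y|lebesgue. f y * f y) = 0" by (rule LIMSEQ_unique)
  then have "AE y in lebesgue. f y * f y = 0"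
    using int by (subst (asm) integral_nonneg_eq_0_iff_AE) auto
  then show ?thesis by eventually_elim simp
qed

text \<open>Multiply the equations by \<open>w\<close> and \<open>J\<close>, test with a cutoff and integrate by parts.  Apart from the sign
  of the viscous term, all that is left next to \<open>(1 - n / 4) \<integral> (w\<^sup>2 + J\<^sup>2) + \<integral> (P w + R J)\<close> are
  terms in which a derivative has hit the cutoff.  Boundedness of \<open>w\<close> and \<open>J\<close> makes \<open>w\<^sup>2 + J\<^sup>2\<close> and
  \<open>w J\<close> square-integrable, so that their products with \<open>V\<close> and \<open>B\<close> are covered by the product rule.\<close>

lemma enstrophy_estimate:
  fixes w J P R :: "real^'n \<Rightarrow> real" and w1 w2 J1 V V1 B B1 :: "'n \<Rightarrow> real^'n \<Rightarrow> real"
  assumes dw: "\<And>i. has_weak_deriv UNIV [axis i 1] w (w1 i)" "\<And>i. has_weak_deriv UNIV [axis i 1] (w1 i) (w2 i)"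
    and dJ: "\<And>i. has_weak_deriv UNIV [axis i 1] J (J1 i)"
    and dV: "\<And>i. has_weak_deriv UNIV [axis i 1] (V i) (V1 i)"
    and dB: "\<And>i. has_weak_deriv UNIV [axis i 1] (B i) (B1 i)"
    and sq: "square_integrable w" "\<And>i. square_integrable (w1 i)" "\<And>i. square_integrable (w2 i)"
      "square_integrable J" "\<And>i. square_integrable (J1 i)" "\<And>i. square_integrable (V i)" "\<And>i. square_integrable (V1 i)"
      "\<And>i. square_integrable (B i)" "\<And>i. square_integrable (B1 i)" "square_integrable P" "square_integrable R"
    and bd: "AE y in lebesgue. \<bar>w y\<bar> \<le> M" "AE y in lebesgue. \<bar>J y\<bar> \<le> M"
    and div: "AE y in lebesgue. (\<Sum>i\<in>UNIV. V1 i y) = 0" "AE y in lebesgue. (\<Sum>i\<in>UNIV. B1 i y) = 0"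
    and \<nu>: "\<nu> \<ge> 0"
    and eqw: "AE y in lebesgue. w y + (\<Sum>i\<in>UNIV. (y $ i / 2 + V i y) * w1 i y) + P y - \<nu> * (\<Sum>i\<in>UNIV. w2 i y)
        - (\<Sum>i\<in>UNIV. B i y * J1 i y) = 0"
    and eqJ: "AE y in lebesgue. J y + (\<Sum>i\<in>UNIV. (y $ i / 2 + V i y) * J1 i y) + R y
        - (\<Sum>i\<in>UNIV. B i y * w1 i y) = 0"
  shows "(1 - real CARD('n) / 4) * (LINT y|lebesgue. w y * w y + J y * J y) \<le> - (LINT y|lebesgue. P y * w y + R y * J y)"
proof -
  have meas: "w \<in> borel_measurable lebesgue" "J \<in> borel_measurable lebesgue"
    using sq by (auto simp: square_integrable_def)
  note bm = square_integrable_bounded_mult[OF _ meas(1) bd(1)] square_integrable_bounded_mult[OF _ meas(2) bd(2)]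
  define e where "e y = w y * w y + J y * J y" for y
  define e1 where "e1 i y = (w1 i y * w y + w y * w1 i y) + (J1 i y * J y + J y * J1 i y)" for i y
  define m where "m y = w y * J y" for y
  define m1 where "m1 i y = w1 i y * J y + w y * J1 i y" for i y
  have de: "has_weak_deriv UNIV [axis i 1] e (e1 i)" for i
    unfolding e_def[abs_def] e1_def[abs_def]
    by (intro has_weak_deriv_add weak_product_rule sq dw dJ axis_Basis)
  have dm: "has_weak_deriv UNIV [axis i 1] m (m1 i)" for i
    unfolding m_def[abs_def] m1_def[abs_def] by (intro weak_product_rule sq dw dJ axis_Basis)
  have se: "square_integrable e" "square_integrable (e1 i)" for i
    unfolding e_def[abs_def] e1_def[abs_def] mult.commute[of "w _" "w1 _ _"] mult.commute[of "J _" "J1 _ _"]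
    by (intro square_integrable_add bm sq)+
  have sm: "square_integrable m" "square_integrable (m1 i)" for i
    unfolding m_def[abs_def] m1_def[abs_def] mult.commute[of "w _" "J1 _ _"]
    by (intro square_integrable_add bm sq)+
  have dVe: "has_weak_deriv UNIV [axis i 1] (\<lambda>y. V i y * e y) (\<lambda>y. V1 i y * e y + V i y * e1 i y)" for i
    by (intro weak_product_rule sq se dV de axis_Basis)
  have dBm: "has_weak_deriv UNIV [axis i 1] (\<lambda>y. B i y * m y) (\<lambda>y. B1 i y * m y + B i y * m1 i y)" for i
    by (intro weak_product_rule sq sm dB dm axis_Basis)
  have dww: "has_weak_deriv UNIV [axis i 1] (\<lambda>y. w y * w1 i y) (\<lambda>y. w1 i y * w1 i y + w y * w2 i y)" for i
    by (intro weak_product_rule sq dw axis_Basis)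
  note smi = square_integrable_mult_integrable
  have ie: "integrable lebesgue e"
    unfolding e_def[abs_def] by (intro Bochner_Integration.integrable_add smi sq)
  have iPR: "integrable lebesgue (\<lambda>y. P y * w y + R y * J y)"
    by (intro Bochner_Integration.integrable_add smi sq)
  have iVe: "integrable lebesgue (\<lambda>y. V i y * e y)" for i by (intro smi sq se)
  have iBm: "integrable lebesgue (\<lambda>y. B i y * m y)" for i by (intro smi sq sm)
  have iww: "integrable lebesgue (\<lambda>y. w y * w1 i y)" for i by (intro smi sq)
  have iVe1: "integrable lebesgue (\<lambda>y. V1 i y * e y + V i y * e1 i y)" for i
    by (intro Bochner_Integration.integrable_add smi sq se)
  have iBm1: "integrable lebesgue (\<lambda>y. B1 i y * m y + B i y * m1 i y)" for i
    by (intro Bochner_Integration.integrable_add smi sq sm)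
  have iww1: "integrable lebesgue (\<lambda>y. w1 i y * w1 i y + w y * w2 i y)" for i
    by (intro Bochner_Integration.integrable_add smi sq)
  have iw1: "integrable lebesgue (\<lambda>y. w1 i y * w1 i y)" for i by (intro smi sq)
  \<comment> \<open>The divergence terms, which vanish, and \<open>\<nu> w1\<^sup>2\<close>, which cancels, are inserted so that
    each sum is a weak derivative of a product.\<close>
  have ae: "AE y in lebesgue. e y + 1 / 4 * (\<Sum>i\<in>UNIV. e1 i y * y $ i) + 1 / 2 * (\<Sum>i\<in>UNIV. V1 i y * e y + V i y * e1 i y)
      + (P y * w y + R y * J y) - \<nu> * (\<Sum>i\<in>UNIV. w1 i y * w1 i y + w y * w2 i y) + \<nu> * (\<Sum>i\<in>UNIV. w1 i y * w1 i y)
      - (\<Sum>i\<in>UNIV. B1 i y * m y + B i y * m1 i y) = 0"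
    using eqw eqJ div
  proof eventually_elim
    case (elim y)
    have "w y * (w y + (\<Sum>i\<in>UNIV. (y $ i / 2 + V i y) * w1 i y) + P y - \<nu> * (\<Sum>i\<in>UNIV. w2 i y)
        - (\<Sum>i\<in>UNIV. B i y * J1 i y)) + J y * (J y + (\<Sum>i\<in>UNIV. (y $ i / 2 + V i y) * J1 i y) + R y
        - (\<Sum>i\<in>UNIV. B i y * w1 i y)) = 0"
      unfolding elim(1,2) by simp
    moreover have "w y * (\<Sum>i\<in>UNIV. (y $ i / 2 + V i y) * w1 i y) + J y * (\<Sum>i\<in>UNIV. (y $ i / 2 + V i y) * J1 i y)
       = 1 / 4 * (\<Sum>i\<in>UNIV. e1 i y * y $ i) + 1 / 2 * (\<Sum>i\<in>UNIV. V i y * e1 i y)"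
      unfolding sum_distrib_left sum.distrib[symmetric]
      by (intro sum.cong refl) (simp add: e1_def algebra_simps)
    moreover have "w y * (\<Sum>i\<in>UNIV. B i y * J1 i y) + J y * (\<Sum>i\<in>UNIV. B i y * w1 i y) = (\<Sum>i\<in>UNIV. B i y * m1 i y)"
      unfolding sum_distrib_left sum.distrib[symmetric]
      by (intro sum.cong refl) (simp add: m1_def algebra_simps)
    moreover have "(\<Sum>i\<in>UNIV. V1 i y * e y) = 0" "(\<Sum>i\<in>UNIV. B1 i y * m y) = 0"
      using elim(3,4) by (simp_all add: sum_distrib_right[symmetric])
    moreover have "w y * (\<nu> * (\<Sum>i\<in>UNIV. w2 i y)) = \<nu> * (\<Sum>i\<in>UNIV. w y * w2 i y)"
      by (simp add: sum_distrib_left mult.left_commute)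
    ultimately show ?case
      unfolding sum.distrib e_def by (simp add: algebra_simps)
  qed
  have key: "(1 - real CARD('n) / 4) * (LINT y|lebesgue. e y * \<phi> y) + (LINT y|lebesgue. (P y * w y + R y * J y) * \<phi> y)
     \<le> 1 / 4 * (\<Sum>i\<in>UNIV. LINT y|lebesgue. e y * ((y \<bullet> axis i 1) * iter_deriv [axis i 1] \<phi> y))
      + 1 / 2 * (\<Sum>i\<in>UNIV. LINT y|lebesgue. V i y * e y * iter_deriv [axis i 1] \<phi> y)
      - \<nu> * (\<Sum>i\<in>UNIV. LINT y|lebesgue. w y * w1 i y * iter_deriv [axis i 1] \<phi> y)
      - (\<Sum>i\<in>UNIV. LINT y|lebesgue. B i y * m y * iter_deriv [axis i 1] \<phi> y)"
    if \<phi>: "test_function UNIV \<phi>" and pos: "\<And>y. 0 \<le> \<phi> y" for \<phi>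
  proof -
    have t: "test_function UNIV (\<lambda>y. y $ i * \<phi> y)" for i by (intro test_function_mult smooth_component \<phi>)
    have D: "test_function UNIV (iter_deriv [axis i 1] \<phi>)" for i
      using \<phi> axis_Basis by (intro test_function_iter_deriv) auto
    have xD: "test_function UNIV (\<lambda>y. y $ i * iter_deriv [axis i 1] \<phi> y)" for i by (intro test_function_mult smooth_component D)
    have Dt: "iter_deriv [axis i 1] (\<lambda>y. y $ i * \<phi> y) = (\<lambda>y. y $ i * iter_deriv [axis i 1] \<phi> y + 1 * \<phi> y)" for i
      using iter_deriv_mult[OF smooth_differentiable[OF smooth_component] smooth_differentiable[OF test_function_smooth[OF \<phi>]], of "axis i 1" i]
      unfolding iter_deriv_component .
    note lti = locally_integrable_test_integrable[OF integrable_locally_integrable[where \<Omega>=UNIV]]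
    have l1: "integrable lebesgue (\<lambda>y. e1 i y * (y $ i * \<phi> y))" for i
      by (rule locally_integrable_test_integrable[OF square_integrable_locally_integrable[OF se(2)] t])
    have ix: "(LINT y|lebesgue. e1 i y * (y $ i * \<phi> y)) =
        - (LINT y|lebesgue. e y * ((y \<bullet> axis i 1) * iter_deriv [axis i 1] \<phi> y)) - (LINT y|lebesgue. e y * \<phi> y)" for i
    proof -
      have "(LINT y|lebesgue. e1 i y * (y $ i * \<phi> y)) = - (LINT y|lebesgue. e y * (y $ i * iter_deriv [axis i 1] \<phi> y) + e y * \<phi> y)"
        using has_weak_derivD[OF de axis_Basis t[of i], of i] unfolding Dt by (simp add: distrib_left)
      also have "\<dots> = - (LINT y|lebesgue. e y * (y $ i * iter_deriv [axis i 1] \<phi> y)) - (LINT y|lebesgue. e y * \<phi> y)"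
        using lti[OF ie xD] lti[OF ie \<phi>] by simp
      finally show ?thesis by (simp add: inner_axis)
    qed
    have "0 = (LINT y|lebesgue. (e y + 1 / 4 * (\<Sum>i\<in>UNIV. e1 i y * y $ i) + 1 / 2 * (\<Sum>i\<in>UNIV. V1 i y * e y + V i y * e1 i y)
      + (P y * w y + R y * J y) - \<nu> * (\<Sum>i\<in>UNIV. w1 i y * w1 i y + w y * w2 i y) + \<nu> * (\<Sum>i\<in>UNIV. w1 i y * w1 i y)
      - (\<Sum>i\<in>UNIV. B1 i y * m y + B i y * m1 i y)) * \<phi> y)"
      by (rule sym, rule integral_eq_zero_AE) (use ae in \<open>auto elim: eventually_mono\<close>)
    also have "\<dots> = (LINT y|lebesgue. e y * \<phi> y + 1 / 4 * (\<Sum>i\<in>UNIV. e1 i y * (y $ i * \<phi> y))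
      + 1 / 2 * (\<Sum>i\<in>UNIV. (V1 i y * e y + V i y * e1 i y) * \<phi> y)
      + (P y * w y + R y * J y) * \<phi> y - \<nu> * (\<Sum>i\<in>UNIV. (w1 i y * w1 i y + w y * w2 i y) * \<phi> y) + \<nu> * (\<Sum>i\<in>UNIV. (w1 i y * w1 i y) * \<phi> y)
      - (\<Sum>i\<in>UNIV. (B1 i y * m y + B i y * m1 i y) * \<phi> y))"
      by (intro Bochner_Integration.integral_cong refl)
         (simp only: distrib_right left_diff_distrib mult.assoc sum_distrib_right)
    also have "\<dots> = (LINT y|lebesgue. e y * \<phi> y) + 1 / 4 * (\<Sum>i\<in>UNIV. LINT y|lebesgue. e1 i y * (y $ i * \<phi> y))
      + 1 / 2 * (\<Sum>i\<in>UNIV. LINT y|lebesgue. (V1 i y * e y + V i y * e1 i y) * \<phi> y)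
      + (LINT y|lebesgue. (P y * w y + R y * J y) * \<phi> y) - \<nu> * (\<Sum>i\<in>UNIV. LINT y|lebesgue. (w1 i y * w1 i y + w y * w2 i y) * \<phi> y)
      + \<nu> * (\<Sum>i\<in>UNIV. LINT y|lebesgue. (w1 i y * w1 i y) * \<phi> y)
      - (\<Sum>i\<in>UNIV. LINT y|lebesgue. (B1 i y * m y + B i y * m1 i y) * \<phi> y)"
      using l1 lti[OF ie \<phi>] lti[OF iVe1 \<phi>] lti[OF iPR \<phi>] lti[OF iww1 \<phi>] lti[OF iw1 \<phi>] lti[OF iBm1 \<phi>]
      by (simp only: Bochner_Integration.integral_add Bochner_Integration.integral_diff Bochner_Integration.integral_sum
          Bochner_Integration.integrable_add Bochner_Integration.integrable_diff Bochner_Integration.integrable_sum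
          integral_mult_right_zero integrable_mult_right)
    also have "(\<Sum>i\<in>UNIV. LINT y|lebesgue. e1 i y * (y $ i * \<phi> y)) =
        - (\<Sum>i\<in>UNIV. LINT y|lebesgue. e y * ((y \<bullet> axis i 1) * iter_deriv [axis i 1] \<phi> y)) - real CARD('n) * (LINT y|lebesgue. e y * \<phi> y)"
      unfolding ix by (simp add: sum_subtractf sum_negf)
    also have "(\<Sum>i\<in>UNIV. LINT y|lebesgue. (V1 i y * e y + V i y * e1 i y) * \<phi> y) = - (\<Sum>i\<in>UNIV. LINT y|lebesgue. V i y * e y * iter_deriv [axis i 1] \<phi> y)"
      using has_weak_derivD[OF dVe axis_Basis \<phi>] by (simp add: sum_negf)
    also have "(\<Sum>i\<in>UNIV. LINT y|lebesgue. (w1 i y * w1 i y + w y * w2 i y) * \<phi> y) = - (\<Sum>i\<in>UNIV. LINT y|lebesgue. w y * w1 i y * iter_deriv [axis i 1] \<phi> y)"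
      using has_weak_derivD[OF dww axis_Basis \<phi>] by (simp add: sum_negf)
    also have "(\<Sum>i\<in>UNIV. LINT y|lebesgue. (B1 i y * m y + B i y * m1 i y) * \<phi> y) = - (\<Sum>i\<in>UNIV. LINT y|lebesgue. B i y * m y * iter_deriv [axis i 1] \<phi> y)"
      using has_weak_derivD[OF dBm axis_Basis \<phi>] by (simp add: sum_negf)
    finally have id: "0 = (LINT y|lebesgue. e y * \<phi> y) + 1 / 4 * (- (\<Sum>i\<in>UNIV. LINT y|lebesgue. e y * ((y \<bullet> axis i 1) * iter_deriv [axis i 1] \<phi> y)) - real CARD('n) * (LINT y|lebesgue. e y * \<phi> y))
      + 1 / 2 * - (\<Sum>i\<in>UNIV. LINT y|lebesgue. V i y * e y * iter_deriv [axis i 1] \<phi> y)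
      + (LINT y|lebesgue. (P y * w y + R y * J y) * \<phi> y)
      - \<nu> * - (\<Sum>i\<in>UNIV. LINT y|lebesgue. w y * w1 i y * iter_deriv [axis i 1] \<phi> y)
      + \<nu> * (\<Sum>i\<in>UNIV. LINT y|lebesgue. (w1 i y * w1 i y) * \<phi> y)
      - - (\<Sum>i\<in>UNIV. LINT y|lebesgue. B i y * m y * iter_deriv [axis i 1] \<phi> y)" .
    have "0 \<le> \<nu> * (\<Sum>i\<in>UNIV. LINT y|lebesgue. (w1 i y * w1 i y) * \<phi> y)"
      using \<nu> pos by (intro mult_nonneg_nonneg sum_nonneg integral_nonneg_AE) auto
    with id show ?thesis by (simp add: algebra_simps)
  qed
  obtain \<kappa> :: "nat \<Rightarrow> real^'n \<Rightarrow> real" where \<kappa>: "\<And>n. test_function UNIV (\<kappa> n)" "\<And>n x. 0 \<le> \<kappa> n x"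
    and lim: "\<And>g. integrable lebesgue g \<Longrightarrow> (\<lambda>n. LINT x|lebesgue. g x * \<kappa> n x) \<longlonglongrightarrow> (LINT x|lebesgue. g x)"
    and lim1: "\<And>g e. integrable lebesgue g \<Longrightarrow> e \<in> Basis \<Longrightarrow> (\<lambda>n. LINT x|lebesgue. g x * iter_deriv [e] (\<kappa> n) x) \<longlonglongrightarrow> 0"
    and limx: "\<And>g e. integrable lebesgue g \<Longrightarrow> e \<in> Basis \<Longrightarrow>
      (\<lambda>n. LINT x|lebesgue. g x * ((x \<bullet> e) * iter_deriv [e] (\<kappa> n) x)) \<longlonglongrightarrow> 0"
    by (rule cutoff_functions) (rule that, assumption+)
  have "(\<lambda>n. (1 - real CARD('n) / 4) * (LINT y|lebesgue. e y * \<kappa> n y) + (LINT y|lebesgue. (P y * w y + R y * J y) * \<kappa> n y))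
    \<longlonglongrightarrow> (1 - real CARD('n) / 4) * (LINT y|lebesgue. e y) + (LINT y|lebesgue. P y * w y + R y * J y)"
    by (intro tendsto_add tendsto_mult tendsto_const lim ie iPR)
  moreover have "(\<lambda>n. 1 / 4 * (\<Sum>i\<in>UNIV. LINT y|lebesgue. e y * ((y \<bullet> axis i 1) * iter_deriv [axis i 1] (\<kappa> n) y))
      + 1 / 2 * (\<Sum>i\<in>UNIV. LINT y|lebesgue. V i y * e y * iter_deriv [axis i 1] (\<kappa> n) y)
      - \<nu> * (\<Sum>i\<in>UNIV. LINT y|lebesgue. w y * w1 i y * iter_deriv [axis i 1] (\<kappa> n) y)
      - (\<Sum>i\<in>UNIV. LINT y|lebesgue. B i y * m y * iter_deriv [axis i 1] (\<kappa> n) y))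
    \<longlonglongrightarrow> 1 / 4 * (\<Sum>i\<in>(UNIV :: 'n set). 0) + 1 / 2 * (\<Sum>i\<in>(UNIV :: 'n set). 0) - \<nu> * (\<Sum>i\<in>(UNIV :: 'n set). 0) - (\<Sum>i\<in>(UNIV :: 'n set). 0)"
    by (intro tendsto_add tendsto_diff tendsto_mult tendsto_const tendsto_sum limx lim1 ie iVe iww iBm axis_Basis)
  ultimately have "(1 - real CARD('n) / 4) * (LINT y|lebesgue. e y) + (LINT y|lebesgue. P y * w y + R y * J y)
    \<le> 1 / 4 * (\<Sum>i\<in>(UNIV :: 'n set). 0) + 1 / 2 * (\<Sum>i\<in>(UNIV :: 'n set). 0) - \<nu> * (\<Sum>i\<in>(UNIV :: 'n set). 0) - (\<Sum>i\<in>(UNIV :: 'n set). 0)"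
    by (rule LIMSEQ_le) (use key[OF \<kappa>] in blast)
  then show ?thesis unfolding e_def by simp
qed

section \<open>Rigidity of the profile equations\<close>

abbreviation pd :: "'n \<Rightarrow> (real^'n \<Rightarrow> real) \<Rightarrow> real^'n \<Rightarrow> real" where
  "pd i \<equiv> weak_deriv UNIV [axis i 1]"

lemma pd:
  assumes "f \<in> sobolev_H (Suc m)"
  shows "has_weak_deriv UNIV [axis i 1] f (pd i f)" "pd i f \<in> sobolev_H m"
  using sobolev_H_weak_deriv[OF assms axis_Basis] by auto

lemma pd_cong:
  assumes "f \<in> sobolev_H (Suc m)" "AE y in lebesgue. f y = g y" "g \<in> sobolev_H (Suc k)"
  shows "AE y in lebesgue. pd i f y = pd i g y"
proof -
  have "has_weak_deriv UNIV [axis i 1] g (pd i f)"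
    by (rule has_weak_deriv_cong[OF pd(1)[OF assms(1)] axis_Basis]) (use assms(2) in auto)
  from has_weak_deriv_unique[OF this pd(1)[OF assms(3)]] show ?thesis by (auto simp: axis_Basis)
qed

lemma pd_commute:
  assumes "f \<in> sobolev_H (Suc (Suc m))"
  shows "AE y in lebesgue. pd j (pd i f) y = pd i (pd j f) y"
  using mixed_weak_derivatives[OF pd(1)[OF assms] pd(1)[OF pd(2)[OF assms]] pd(1)[OF assms] pd(1)[OF pd(2)[OF assms]] axis_Basis axis_Basis open_UNIV]
  by simp

lemma pd_commute3:
  assumes "f \<in> sobolev_H (Suc (Suc (Suc m)))"
  shows "AE y in lebesgue. pd j (pd i (pd i f)) y = pd i (pd i (pd j f)) y"
proof -
  have "AE y in lebesgue. pd j (pd i (pd i f)) y = pd i (pd j (pd i f)) y"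
    by (rule pd_commute[OF pd(2)[OF assms]])
  moreover have "AE y in lebesgue. pd i (pd j (pd i f)) y = pd i (pd i (pd j f)) y"
    by (rule pd_cong[OF pd(2)[OF pd(2)[OF assms]] pd_commute[OF assms] pd(2)[OF pd(2)[OF assms]]])
  ultimately show ?thesis by eventually_elim simp
qed

lemma euler_generator_weak_deriv:
  assumes "f \<in> sobolev_H (Suc (Suc m))"
  shows "has_weak_deriv UNIV [axis j 1] (euler_generator f (\<lambda>i. pd i f))
    (\<lambda>y. pd j f y + (\<Sum>i\<in>UNIV. y $ i / 2 * pd j (pd i f) y))"
proof -
  have "has_weak_deriv UNIV [axis j 1] (\<lambda>y. (1 / 2) * (f y + (\<Sum>i\<in>UNIV. y $ i * pd i f y)))
    (\<lambda>y. (1 / 2) * (pd j f y + (\<Sum>i\<in>UNIV. iter_deriv [axis j 1] (\<lambda>x. x $ i) y * pd i f y + y $ i * pd j (pd i f) y)))"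
    by (intro has_weak_deriv_cmult has_weak_deriv_add has_weak_deriv_sum has_weak_deriv_smooth_mult
        smooth_component axis_Basis pd(1)[OF assms] pd(1)[OF pd(2)[OF assms]])
  moreover have "(1 / 2) * (pd j f y + (\<Sum>i\<in>UNIV. iter_deriv [axis j 1] (\<lambda>x. x $ i) y * pd i f y + y $ i * pd j (pd i f) y))
     = pd j f y + (\<Sum>i\<in>UNIV. y $ i / 2 * pd j (pd i f) y)" for y
    unfolding iter_deriv_component_delta
    by (simp add: sum.distrib if_distrib[of "\<lambda>u. u * _"] sum_divide_distrib[symmetric] cong: if_cong)
  ultimately show ?thesis unfolding euler_generator_def[abs_def] by (simp only:)
qed

lemma transport_weak_deriv:
  assumes X: "\<And>i. X i \<in> sobolev_H (Suc m)" and f: "f \<in> sobolev_H (Suc (Suc k))"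
  shows "has_weak_deriv UNIV [axis j 1] (\<lambda>y. \<Sum>i\<in>UNIV. X i y * pd i f y)
    (\<lambda>y. \<Sum>i\<in>UNIV. pd j (X i) y * pd i f y + X i y * pd j (pd i f) y)"
  by (intro has_weak_deriv_sum weak_product_rule axis_Basis pd(1)[OF X] pd(1)[OF pd(2)[OF f]]
      sobolev_H_square_integrable[OF X] sobolev_H_square_integrable[OF pd(2)[OF X]]
      sobolev_H_square_integrable[OF pd(2)[OF f]] sobolev_H_square_integrable[OF pd(2)[OF pd(2)[OF f]]])

text \<open>The velocity equation says that the momentum residual of the profiles is the gradient of a pressure,
  the magnetic one that their induction residual vanishes.  In the differentiated residuals \<open>j\<close> is
  the direction of differentiation.\<close>

definition momentum_residual :: "real \<Rightarrow> ('n \<Rightarrow> real^'n \<Rightarrow> real) \<Rightarrow> ('n \<Rightarrow> real^'n \<Rightarrow> real) \<Rightarrow> 'n \<Rightarrow> real^'n \<Rightarrow> real" where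
  "momentum_residual \<nu> V B k y = euler_generator (V k) (\<lambda>i. pd i (V k)) y + (\<Sum>i\<in>UNIV. V i y * pd i (V k) y)
     - \<nu> * (\<Sum>i\<in>UNIV. pd i (pd i (V k)) y) - (\<Sum>i\<in>UNIV. B i y * pd i (B k) y)"

definition momentum_residual_deriv :: "real \<Rightarrow> ('n \<Rightarrow> real^'n \<Rightarrow> real) \<Rightarrow> ('n \<Rightarrow> real^'n \<Rightarrow> real) \<Rightarrow> 'n \<Rightarrow> 'n \<Rightarrow> real^'n \<Rightarrow> real" where
  "momentum_residual_deriv \<nu> V B j k y = (pd j (V k) y + (\<Sum>i\<in>UNIV. y $ i / 2 * pd j (pd i (V k)) y))
     + (\<Sum>i\<in>UNIV. pd j (V i) y * pd i (V k) y + V i y * pd j (pd i (V k)) y)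
     - \<nu> * (\<Sum>i\<in>UNIV. pd j (pd i (pd i (V k))) y)
     - (\<Sum>i\<in>UNIV. pd j (B i) y * pd i (B k) y + B i y * pd j (pd i (B k)) y)"

definition induction_residual :: "('n \<Rightarrow> real^'n \<Rightarrow> real) \<Rightarrow> ('n \<Rightarrow> real^'n \<Rightarrow> real) \<Rightarrow> 'n \<Rightarrow> real^'n \<Rightarrow> real" where
  "induction_residual V B k y = euler_generator (B k) (\<lambda>i. pd i (B k)) y + (\<Sum>i\<in>UNIV. V i y * pd i (B k) y)
     - (\<Sum>i\<in>UNIV. B i y * pd i (V k) y)"

definition induction_residual_deriv :: "('n \<Rightarrow> real^'n \<Rightarrow> real) \<Rightarrow> ('n \<Rightarrow> real^'n \<Rightarrow> real) \<Rightarrow> 'n \<Rightarrow> 'n \<Rightarrow> real^'n \<Rightarrow> real" where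
  "induction_residual_deriv V B j k y = (pd j (B k) y + (\<Sum>i\<in>UNIV. y $ i / 2 * pd j (pd i (B k)) y))
     + (\<Sum>i\<in>UNIV. pd j (V i) y * pd i (B k) y + V i y * pd j (pd i (B k)) y)
     - (\<Sum>i\<in>UNIV. pd j (B i) y * pd i (V k) y + B i y * pd j (pd i (V k)) y)"

lemma sobolev_3: "f \<in> sobolev_H 3 \<Longrightarrow> f \<in> sobolev_H (Suc (Suc (Suc 0)))"
  by (simp add: numeral_3_eq_3)

lemma sobolev_3_2: "f \<in> sobolev_H 3 \<Longrightarrow> f \<in> sobolev_H (Suc (Suc 0))"
  by (erule sobolev_H_mono) simp

lemma has_weak_deriv_diff:
  assumes "has_weak_deriv \<Omega> [e] f f'" "has_weak_deriv \<Omega> [e] g g'" "e \<in> Basis"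
  shows "has_weak_deriv \<Omega> [e] (\<lambda>x. f x - g x) (\<lambda>x. f' x - g' x)"
  using has_weak_deriv_add[OF assms(1) has_weak_deriv_cmult[OF assms(2,3), of "-1"] assms(3)] by simp

lemma momentum_residual_weak_deriv:
  assumes "\<And>k. V k \<in> sobolev_H 3" "\<And>k. B k \<in> sobolev_H 3"
  shows "has_weak_deriv UNIV [axis j 1] (momentum_residual \<nu> V B k) (momentum_residual_deriv \<nu> V B j k)"
  unfolding momentum_residual_def[abs_def] momentum_residual_deriv_def[abs_def]
  by (intro has_weak_deriv_diff has_weak_deriv_add has_weak_deriv_cmult has_weak_deriv_sum axis_Basis
      euler_generator_weak_deriv[OF sobolev_3_2] transport_weak_deriv[OF sobolev_3 sobolev_3_2] assms
      pd(1)[OF pd(2)[OF pd(2)[OF sobolev_3]]])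

lemma induction_residual_weak_deriv:
  assumes "\<And>k. V k \<in> sobolev_H 3" "\<And>k. B k \<in> sobolev_H 3"
  shows "has_weak_deriv UNIV [axis j 1] (induction_residual V B k) (induction_residual_deriv V B j k)"
  unfolding induction_residual_def[abs_def] induction_residual_deriv_def[abs_def]
  by (intro has_weak_deriv_diff has_weak_deriv_add axis_Basis
      euler_generator_weak_deriv[OF sobolev_3_2] transport_weak_deriv[OF sobolev_3 sobolev_3_2] assms)

text \<open>Integrate by parts in \<open>\<partial>\<^sub>j\<close>; the sum over \<open>j\<close> of \<open>\<partial>\<^sub>j\<partial>\<^sub>kV\<^sub>j = \<partial>\<^sub>k\<partial>\<^sub>jV\<^sub>j\<close> is the
  derivative of the divergence.\<close>

lemma divergence_free_gradient_identity:
  fixes V :: "'n \<Rightarrow> real^'n \<Rightarrow> real"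
  assumes V: "\<And>k. V k \<in> sobolev_H (Suc (Suc 0))" and div: "AE y in lebesgue. (\<Sum>i\<in>UNIV. pd i (V i) y) = 0"
  shows "(\<Sum>j\<in>UNIV. \<Sum>k\<in>UNIV. LINT y|lebesgue. pd j (V k) y * pd k (V j) y) = 0"
proof -
  note si = sobolev_H_square_integrable
  have V1: "V k \<in> sobolev_H (Suc 0)" for k using V by (rule sobolev_H_mono) simp
  have s: "square_integrable (V k)" "square_integrable (pd i (V k))" "square_integrable (pd j (pd i (V k)))" for i j k
    using si[OF V] si[OF pd(2)[OF V]] si[OF pd(2)[OF pd(2)[OF V]]] by auto
  have i1: "integrable lebesgue (\<lambda>y. pd j (V k) y * pd k (V j) y)" for j k by (intro square_integrable_mult_integrable s)
  have i2: "integrable lebesgue (\<lambda>y. V k y * pd j (pd k (V j)) y)" for j k by (intro square_integrable_mult_integrable s)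
  have jk: "(LINT y|lebesgue. pd j (V k) y * pd k (V j) y) = - (LINT y|lebesgue. V k y * pd j (pd k (V j)) y)" for j k
  proof -
    have w: "has_weak_deriv UNIV [axis j 1] (\<lambda>y. V k y * pd k (V j) y) (\<lambda>y. pd j (V k) y * pd k (V j) y + V k y * pd j (pd k (V j)) y)"
      by (intro weak_product_rule s pd(1)[OF V] pd(1)[OF pd(2)[OF V]] axis_Basis)
    have "(LINT y|lebesgue. pd j (V k) y * pd k (V j) y + V k y * pd j (pd k (V j)) y) = 0"
      by (rule integral_weak_deriv_zero[OF w axis_Basis])
         (intro square_integrable_mult_integrable s Bochner_Integration.integrable_add)+
    then show ?thesis using i1 i2 by simp
  qed
  have dk: "AE y in lebesgue. (\<Sum>j\<in>UNIV. pd j (pd k (V j)) y) = 0" for k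
  proof -
    have "has_weak_deriv UNIV [axis k 1] (\<lambda>y. \<Sum>j\<in>UNIV. pd j (V j) y) (\<lambda>y. \<Sum>j\<in>UNIV. pd k (pd j (V j)) y)"
      by (intro has_weak_deriv_sum axis_Basis pd(1)[OF pd(2)[OF V]])
    then have "has_weak_deriv UNIV [axis k 1] (\<lambda>y. 0) (\<lambda>y. \<Sum>j\<in>UNIV. pd k (pd j (V j)) y)"
      by (rule has_weak_deriv_cong[OF _ axis_Basis]) (use div in auto)
    from has_weak_deriv_unique[OF this has_weak_deriv_const[OF axis_Basis]]
    have "AE y in lebesgue. (\<Sum>j\<in>UNIV. pd k (pd j (V j)) y) = 0" by (simp add: axis_Basis)
    moreover have "AE y in lebesgue. \<forall>j. pd j (pd k (V j)) y = pd k (pd j (V j)) y"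
      unfolding AE_all_countable using pd_commute[OF V] by blast
    ultimately show ?thesis by eventually_elim simp
  qed
  have vk: "(\<Sum>j\<in>UNIV. LINT y|lebesgue. V k y * pd j (pd k (V j)) y) = 0" for k
  proof -
    have "(\<Sum>j\<in>UNIV. LINT y|lebesgue. V k y * pd j (pd k (V j)) y) = (LINT y|lebesgue. V k y * (\<Sum>j\<in>UNIV. pd j (pd k (V j)) y))"
      unfolding sum_distrib_left using i2 by simp
    also have "\<dots> = 0" by (rule integral_eq_zero_AE) (use dk[of k] in \<open>auto elim: eventually_mono\<close>)
    finally show ?thesis .
  qed
  have "(\<Sum>j\<in>UNIV. \<Sum>k\<in>UNIV. LINT y|lebesgue. pd j (V k) y * pd k (V j) y)
    = - (\<Sum>k\<in>UNIV. \<Sum>j\<in>UNIV. LINT y|lebesgue. V k y * pd j (pd k (V j)) y)"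
    unfolding jk by (subst sum.swap) (simp add: sum_negf)
  then show ?thesis by (simp add: vk)
qed

text \<open>Every entry is at most \<open>r = sqrt N\<close> and at most \<open>\<eta>\<close>.  Each of the two large factors consists of \<open>4 n\<close>
  products, each bounded by \<open>\<eta> r\<close>, and is multiplied by a difference bounded by \<open>2 r\<close>.\<close>

lemma stretching_bound:
  fixes a b :: "'n::finite \<Rightarrow> 'n \<Rightarrow> real"
  assumes a: "\<And>i j. \<bar>a i j\<bar> \<le> \<eta>" and b: "\<And>i j. \<bar>b i j\<bar> \<le> \<eta>"
    and N: "N = (\<Sum>i\<in>UNIV. \<Sum>j\<in>UNIV. a i j * a i j + b i j * b i j)"
  shows "- (((\<Sum>i\<in>UNIV. a i j * a k i - a i k * a j i) - (\<Sum>i\<in>UNIV. b i j * b k i - b i k * b j i)) * (a k j - a j k)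
    + ((\<Sum>i\<in>UNIV. a i j * b k i - a i k * b j i) - (\<Sum>i\<in>UNIV. b i j * a k i - b i k * a j i)) * (b k j - b j k))
    \<le> 16 * real CARD('n) * \<eta> * N"
proof -
  have N0: "N \<ge> 0" unfolding N by (intro sum_nonneg) simp
  have \<eta>0: "\<eta> \<ge> 0" using a[of undefined undefined] by linarith
  define r where "r = sqrt N"
  have r: "r * r = N" "r \<ge> 0" using N0 by (simp_all add: r_def)
  have le: "a i j * a i j + b i j * b i j \<le> N" for i j
  proof -
    have "a i j * a i j + b i j * b i j \<le> (\<Sum>j\<in>UNIV. a i j * a i j + b i j * b i j)"
      by (rule member_le_sum) auto
    also have "\<dots> \<le> N" unfolding N by (rule member_le_sum) (auto intro: sum_nonneg)
    finally show ?thesis .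
  qed
  have ar: "\<bar>a i j\<bar> \<le> r" "\<bar>b i j\<bar> \<le> r" for i j
  proof -
    have "a i j * a i j \<le> N" "b i j * b i j \<le> N"
      using le[of i j] zero_le_square[of "a i j"] zero_le_square[of "b i j"] by linarith+
    then show "\<bar>a i j\<bar> \<le> r" "\<bar>b i j\<bar> \<le> r"
      unfolding r_def by (auto intro!: real_le_rsqrt simp: power2_eq_square)
  qed
  have m: "\<bar>x * y\<bar> \<le> \<eta> * r" if "\<bar>x\<bar> \<le> \<eta>" "\<bar>y\<bar> \<le> r" for x y :: real
    unfolding abs_mult using that \<eta>0 by (intro mult_mono) auto
  have S: "\<bar>\<Sum>i\<in>UNIV. x i * y i - x' i * y' i\<bar> \<le> real CARD('n) * (2 * (\<eta> * r))"
    if "\<And>i. \<bar>x i\<bar> \<le> \<eta>" "\<And>i. \<bar>y i\<bar> \<le> r" "\<And>i. \<bar>x' i\<bar> \<le> \<eta>" "\<And>i. \<bar>y' i\<bar> \<le> r" for x y x' y' :: "'n \<Rightarrow> real"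
  proof -
    have "\<bar>\<Sum>i\<in>UNIV. x i * y i - x' i * y' i\<bar> \<le> (\<Sum>i\<in>(UNIV :: 'n set). 2 * (\<eta> * r))"
    proof (rule order_trans[OF sum_abs], rule sum_mono)
      fix i
      show "\<bar>x i * y i - x' i * y' i\<bar> \<le> 2 * (\<eta> * r)"
        using m[OF that(1,2), of i i] m[OF that(3,4), of i i] by linarith
    qed
    then show ?thesis by simp
  qed
  have W: "\<bar>p - q\<bar> \<le> 2 * r" if "\<bar>p\<bar> \<le> r" "\<bar>q\<bar> \<le> r" for p q :: real using that by linarith
  have T: "\<bar>(s1 - s2) * d\<bar> \<le> 8 * real CARD('n) * \<eta> * N"
    if "\<bar>s1\<bar> \<le> real CARD('n) * (2 * (\<eta> * r))" "\<bar>s2\<bar> \<le> real CARD('n) * (2 * (\<eta> * r))" "\<bar>d\<bar> \<le> 2 * r" for s1 s2 d :: real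
  proof -
    have "\<bar>(s1 - s2) * d\<bar> \<le> (real CARD('n) * (4 * (\<eta> * r))) * (2 * r)"
      unfolding abs_mult using that r \<eta>0 by (intro mult_mono) (auto simp: abs_le_iff)
    also have "\<dots> = 8 * real CARD('n) * \<eta> * N" by (simp add: r(1)[symmetric])
    finally show ?thesis .
  qed
  have "\<bar>((\<Sum>i\<in>UNIV. a i j * a k i - a i k * a j i) - (\<Sum>i\<in>UNIV. b i j * b k i - b i k * b j i)) * (a k j - a j k)\<bar> \<le> 8 * real CARD('n) * \<eta> * N"
    by (intro T S W a b ar)
  moreover have "\<bar>((\<Sum>i\<in>UNIV. a i j * b k i - a i k * b j i) - (\<Sum>i\<in>UNIV. b i j * a k i - b i k * a j i)) * (b k j - b j k)\<bar> \<le> 8 * real CARD('n) * \<eta> * N"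
    by (intro T S W a b ar)
  ultimately show ?thesis by linarith
qed

text \<open>Let \<open>I\<close> be the integral of \<open>|\<nabla>V|\<^sup>2 + |\<nabla>B|\<^sup>2\<close>.  Summed over the \<open>n\<^sup>2\<close> pairs of indices, the enstrophy
  estimate and the stretching bound give \<open>2 (1 - n / 4) I \<le> 16 n\<^sup>3 I / 1000\<close>.  For \<open>n \<le> 3\<close> the
  coefficient on the left is at least \<open>1 / 2\<close> and the one on the right at most \<open>0.432\<close>, so \<open>I = 0\<close>.\<close>

proposition profile_rigidity:
  fixes V B :: "'n \<Rightarrow> real^'n \<Rightarrow> real"
  assumes V: "\<And>k. V k \<in> sobolev_H 3" and B: "\<And>k. B k \<in> sobolev_H 3"
    and n: "CARD('n) \<le> 3" and \<nu>: "\<nu> \<ge> 0"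
    and bdV: "\<And>i k. AE y in lebesgue. \<bar>pd i (V k) y\<bar> \<le> 1 / 1000"
    and bdB: "\<And>i k. AE y in lebesgue. \<bar>pd i (B k) y\<bar> \<le> 1 / 1000"
    and divV: "AE y in lebesgue. (\<Sum>i\<in>UNIV. pd i (V i) y) = 0"
    and divB: "AE y in lebesgue. (\<Sum>i\<in>UNIV. pd i (B i) y) = 0"
    and curl: "\<And>j k. AE y in lebesgue. momentum_residual_deriv \<nu> V B j k y = momentum_residual_deriv \<nu> V B k j y"
    and ind: "\<And>k. AE y in lebesgue. induction_residual V B k y = 0"
  shows "AE y in lebesgue. V k y = 0" "AE y in lebesgue. B k y = 0"
proof -
  note V3 = sobolev_3[OF V] and B3 = sobolev_3[OF B] and V2 = sobolev_3_2[OF V] and B2 = sobolev_3_2[OF B]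
  note si = sobolev_H_square_integrable
  have sV: "square_integrable (V k)" "square_integrable (pd i (V k))" "square_integrable (pd j (pd i (V k)))"
    "square_integrable (pd l (pd j (pd i (V k))))" for i j k l
    using si[OF V] si[OF pd(2)[OF V3]] si[OF pd(2)[OF pd(2)[OF V3]]] si[OF pd(2)[OF pd(2)[OF pd(2)[OF V3]]]] by auto
  have sB: "square_integrable (B k)" "square_integrable (pd i (B k))" "square_integrable (pd j (pd i (B k)))" for i j k
    using si[OF B] si[OF pd(2)[OF B3]] si[OF pd(2)[OF pd(2)[OF B3]]] by auto
  have meas: "pd i (V k) \<in> borel_measurable lebesgue" "pd i (B k) \<in> borel_measurable lebesgue" for i k
    using sV(2) sB(2) by (auto simp: square_integrable_def)
  have bdV': "AE y in lebesgue. \<forall>k i. \<bar>pd i (V k) y\<bar> \<le> 1 / 1000" and bdB': "AE y in lebesgue. \<forall>k i. \<bar>pd i (B k) y\<bar> \<le> 1 / 1000"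
    unfolding AE_all_countable using bdV bdB by blast+
  have symV: "AE y in lebesgue. \<forall>k i j. pd j (pd i (V k)) y = pd i (pd j (V k)) y"
    and symB: "AE y in lebesgue. \<forall>k i j. pd j (pd i (B k)) y = pd i (pd j (B k)) y"
    and symV3: "AE y in lebesgue. \<forall>k i j. pd j (pd i (pd i (V k))) y = pd i (pd i (pd j (V k))) y"
    unfolding AE_all_countable using pd_commute[OF V2] pd_commute[OF B2] pd_commute3[OF V3] by blast+
  have indd: "AE y in lebesgue. induction_residual_deriv V B j k y = 0" for j k
  proof -
    have "has_weak_deriv UNIV [axis j 1] (\<lambda>y. 0) (induction_residual_deriv V B j k)"
      by (rule has_weak_deriv_cong[OF induction_residual_weak_deriv[OF V B] axis_Basis]) (use ind in auto)
    from has_weak_deriv_unique[OF this has_weak_deriv_const[OF axis_Basis]] show ?thesis by (simp add: axis_Basis)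
  qed
  define w where "w j k y = pd j (V k) y - pd k (V j) y" for j k y
  define J where "J j k y = pd j (B k) y - pd k (B j) y" for j k y
  define P where "P j k y = (\<Sum>i\<in>UNIV. pd j (V i) y * pd i (V k) y - pd k (V i) y * pd i (V j) y)
    - (\<Sum>i\<in>UNIV. pd j (B i) y * pd i (B k) y - pd k (B i) y * pd i (B j) y)" for j k y
  define R where "R j k y = (\<Sum>i\<in>UNIV. pd j (V i) y * pd i (B k) y - pd k (V i) y * pd i (B j) y)
    - (\<Sum>i\<in>UNIV. pd j (B i) y * pd i (V k) y - pd k (B i) y * pd i (V j) y)" for j k y
  define N where "N y = (\<Sum>a\<in>UNIV. \<Sum>b\<in>UNIV. pd b (V a) y * pd b (V a) y + pd b (B a) y * pd b (B a) y)" for y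
  have sw: "square_integrable (w j k)" "square_integrable (J j k)" for j k
    unfolding w_def[abs_def] J_def[abs_def] by (intro square_integrable_diff sV sB)+
  have bm: "square_integrable (\<lambda>y. f y * pd i (V k) y)" "square_integrable (\<lambda>y. f y * pd i (B k) y)"
    if "square_integrable f" for f i k
    using square_integrable_bounded_mult[OF that meas(1) bdV] square_integrable_bounded_mult[OF that meas(2) bdB] by auto
  have sP: "square_integrable (P j k)" "square_integrable (R j k)" for j k
    unfolding P_def[abs_def] R_def[abs_def]
    by (intro square_integrable_diff square_integrable_sum bm sV sB)+
  have iN: "integrable lebesgue N"
    unfolding N_def[abs_def]
    by (intro Bochner_Integration.integrable_sum Bochner_Integration.integrable_add square_integrable_mult_integrable sV sB)
  have N0: "0 \<le> N y" for y unfolding N_def by (intro sum_nonneg) simp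
  have est: "(1 - real CARD('n) / 4) * (LINT y|lebesgue. w j k y * w j k y + J j k y * J j k y)
     \<le> 16 * real CARD('n) * (1 / 1000) * (LINT y|lebesgue. N y)" for j k
  proof -
    have "(1 - real CARD('n) / 4) * (LINT y|lebesgue. w j k y * w j k y + J j k y * J j k y)
      \<le> - (LINT y|lebesgue. P j k y * w j k y + R j k y * J j k y)"
    proof (rule enstrophy_estimate[where \<nu>=\<nu> and V=V and B=B and ?V1.0="\<lambda>i. pd i (V i)" and ?B1.0="\<lambda>i. pd i (B i)"
          and ?w1.0="\<lambda>i y. pd i (pd j (V k)) y - pd i (pd k (V j)) y" and ?w2.0="\<lambda>i y. pd i (pd i (pd j (V k))) y - pd i (pd i (pd k (V j))) y"
          and ?J1.0="\<lambda>i y. pd i (pd j (B k)) y - pd i (pd k (B j)) y" and M="2 / 1000"])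
      show "AE y in lebesgue. \<bar>w j k y\<bar> \<le> 2 / 1000"
        using bdV'
      proof eventually_elim
        case (elim y)
        then have "\<bar>pd j (V k) y\<bar> \<le> 1 / 1000" "\<bar>pd k (V j) y\<bar> \<le> 1 / 1000" by blast+
        then show ?case unfolding w_def by linarith
      qed
      show "AE y in lebesgue. \<bar>J j k y\<bar> \<le> 2 / 1000"
        using bdB'
      proof eventually_elim
        case (elim y)
        then have "\<bar>pd j (B k) y\<bar> \<le> 1 / 1000" "\<bar>pd k (B j) y\<bar> \<le> 1 / 1000" by blast+
        then show ?case unfolding J_def by linarith
      qed
      show "AE y in lebesgue. w j k y + (\<Sum>i\<in>UNIV. (y $ i / 2 + V i y) * (pd i (pd j (V k)) y - pd i (pd k (V j)) y)) + P j k y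
        - \<nu> * (\<Sum>i\<in>UNIV. pd i (pd i (pd j (V k))) y - pd i (pd i (pd k (V j))) y)
        - (\<Sum>i\<in>UNIV. B i y * (pd i (pd j (B k)) y - pd i (pd k (B j)) y)) = 0"
        using curl[of j k] symV symB symV3
      proof eventually_elim
        case (elim y)
        have s: "pd i (pd l (V h)) y = pd l (pd i (V h)) y" "pd i (pd l (B h)) y = pd l (pd i (B h)) y"
          "pd i (pd i (pd l (V h))) y = pd l (pd i (pd i (V h))) y" for i l h
          using elim(2,3,4) by simp_all
        show ?case
          unfolding s[of _ j] s[of _ k]
          using elim(1) unfolding momentum_residual_deriv_def w_def P_def
          by (simp add: sum.distrib sum_subtractf algebra_simps)
      qed
      show "AE y in lebesgue. J j k y + (\<Sum>i\<in>UNIV. (y $ i / 2 + V i y) * (pd i (pd j (B k)) y - pd i (pd k (B j)) y)) + R j k y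
        - (\<Sum>i\<in>UNIV. B i y * (pd i (pd j (V k)) y - pd i (pd k (V j)) y)) = 0"
        using indd[of j k] indd[of k j] symV symB
      proof eventually_elim
        case (elim y)
        have s: "pd i (pd l (V h)) y = pd l (pd i (V h)) y" "pd i (pd l (B h)) y = pd l (pd i (B h)) y" for i l h
          using elim(3,4) by simp_all
        show ?case
          unfolding s[of _ j] s[of _ k]
          using elim(1,2) unfolding induction_residual_deriv_def J_def R_def
          by (simp add: sum.distrib sum_subtractf algebra_simps)
      qed
    qed (auto simp: w_def[abs_def] J_def[abs_def] \<nu> divV divB
        intro!: has_weak_deriv_diff axis_Basis pd(1)[OF V3] pd(1)[OF B3] pd(1)[OF pd(2)[OF V3]] pd(1)[OF pd(2)[OF B3]]
          pd(1)[OF pd(2)[OF pd(2)[OF V3]]] square_integrable_diff sV sB sP)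
    also have "- (LINT y|lebesgue. P j k y * w j k y + R j k y * J j k y) = (LINT y|lebesgue. - (P j k y * w j k y + R j k y * J j k y))"
      by (rule integral_minus[symmetric])
    also have "\<dots> \<le> (LINT y|lebesgue. 16 * real CARD('n) * (1 / 1000) * N y)"
    proof (rule integral_mono_AE)
      show "integrable lebesgue (\<lambda>y. - (P j k y * w j k y + R j k y * J j k y))"
        by (intro Bochner_Integration.integrable_minus Bochner_Integration.integrable_add square_integrable_mult_integrable sP sw)
      show "integrable lebesgue (\<lambda>y. 16 * real CARD('n) * (1 / 1000) * N y)" using iN by simp
      show "AE y in lebesgue. - (P j k y * w j k y + R j k y * J j k y) \<le> 16 * real CARD('n) * (1 / 1000) * N y"
        using bdV' bdB'
      proof eventually_elim
        case (elim y)
        show ?case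
          unfolding P_def R_def w_def J_def
          by (rule stretching_bound[of "\<lambda>a b. pd b (V a) y" "1 / 1000" "\<lambda>a b. pd b (B a) y" "N y"]) (use elim in \<open>auto simp: N_def\<close>)
      qed
    qed
    finally show ?thesis by simp
  qed
  \<comment> \<open>The mixed products integrate to zero, since both fields are divergence-free.\<close>
  have tot: "(\<Sum>j\<in>UNIV. \<Sum>k\<in>UNIV. LINT y|lebesgue. w j k y * w j k y + J j k y * J j k y) = 2 * (LINT y|lebesgue. N y)"
  proof -
    have iv: "integrable lebesgue (\<lambda>y. pd i (V k) y * pd i' (V k') y)" "integrable lebesgue (\<lambda>y. pd i (B k) y * pd i' (B k') y)" for i k i' k'
      by (intro square_integrable_mult_integrable sV sB)+
    define a where "a j k = (LINT y|lebesgue. pd j (V k) y * pd j (V k) y) + (LINT y|lebesgue. pd j (B k) y * pd j (B k) y)" for j k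
    define c where "c j k = (LINT y|lebesgue. pd j (V k) y * pd k (V j) y)" for j k
    define d where "d j k = (LINT y|lebesgue. pd j (B k) y * pd k (B j) y)" for j k
    have "(LINT y|lebesgue. w j k y * w j k y + J j k y * J j k y) = a j k + a k j - 2 * c j k - 2 * d j k" for j k
    proof -
      have "(LINT y|lebesgue. w j k y * w j k y + J j k y * J j k y) = (LINT y|lebesgue. pd j (V k) y * pd j (V k) y + pd k (V j) y * pd k (V j) y
         - 2 * (pd j (V k) y * pd k (V j) y) + (pd j (B k) y * pd j (B k) y + pd k (B j) y * pd k (B j) y
         - 2 * (pd j (B k) y * pd k (B j) y)))"
        by (intro Bochner_Integration.integral_cong refl) (simp add: w_def J_def algebra_simps)
      also have "\<dots> = a j k + a k j - 2 * c j k - 2 * d j k"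
        unfolding a_def c_def d_def using iv by simp
      finally show ?thesis .
    qed
    then have "(\<Sum>j\<in>UNIV. \<Sum>k\<in>UNIV. LINT y|lebesgue. w j k y * w j k y + J j k y * J j k y)
      = (\<Sum>j\<in>UNIV. \<Sum>k\<in>UNIV. a j k) + (\<Sum>j\<in>UNIV. \<Sum>k\<in>UNIV. a k j) - 2 * (\<Sum>j\<in>UNIV. \<Sum>k\<in>UNIV. c j k) - 2 * (\<Sum>j\<in>UNIV. \<Sum>k\<in>UNIV. d j k)"
      by (simp add: sum.distrib sum_subtractf sum_distrib_left)
    also have "(\<Sum>j\<in>UNIV. \<Sum>k\<in>UNIV. c j k) = 0" unfolding c_def by (rule divergence_free_gradient_identity[OF V2 divV])
    also have "(\<Sum>j\<in>UNIV. \<Sum>k\<in>UNIV. d j k) = 0" unfolding d_def by (rule divergence_free_gradient_identity[OF B2 divB])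
    also have "(\<Sum>j\<in>UNIV. \<Sum>k\<in>UNIV. a j k) = (\<Sum>j\<in>UNIV. \<Sum>k\<in>UNIV. a k j)" by (rule sum.swap)
    also have "(\<Sum>j\<in>UNIV. \<Sum>k\<in>UNIV. a k j) = (LINT y|lebesgue. N y)"
      unfolding N_def a_def using iv by simp
    finally show ?thesis by simp
  qed
  define I where "I = (LINT y|lebesgue. N y)"
  have I0: "I \<ge> 0" unfolding I_def using N0 by simp
  have "(\<Sum>j\<in>UNIV. \<Sum>k\<in>UNIV. (1 - real CARD('n) / 4) * (LINT y|lebesgue. w j k y * w j k y + J j k y * J j k y))
     \<le> (\<Sum>j\<in>(UNIV :: 'n set). \<Sum>k\<in>(UNIV :: 'n set). 16 * real CARD('n) * (1 / 1000) * I)"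
    unfolding I_def by (intro sum_mono est)
  then have i1: "(1 - real CARD('n) / 4) * (2 * I) \<le> real CARD('n) * (real CARD('n) * (16 * real CARD('n) * (1 / 1000) * I))"
    unfolding sum_distrib_left[symmetric] tot I_def by simp
  have i2: "(1 / 2) * I \<le> (1 - real CARD('n) / 4) * (2 * I)"
  proof -
    have "1 / 2 \<le> (1 - real CARD('n) / 4) * 2" using n by simp
    from mult_right_mono[OF this I0] show ?thesis by (simp only: mult.assoc)
  qed
  have i3: "real CARD('n) * (real CARD('n) * (16 * real CARD('n) * (1 / 1000) * I)) \<le> 3 * (3 * (16 * 3 * (1 / 1000) * I))"
    using n I0 by (intro mult_mono) auto
  have "I = 0" using order_trans[OF order_trans[OF i2 i1] i3] I0 by simp
  then have "AE y in lebesgue. N y = 0"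
    unfolding I_def using iN N0 by (subst (asm) integral_nonneg_eq_0_iff_AE) auto
  then have z: "AE y in lebesgue. pd i (V k) y = 0" "AE y in lebesgue. pd i (B k) y = 0" for i k
  proof -
    have le: "pd i (V k) y * pd i (V k) y + pd i (B k) y * pd i (B k) y \<le> N y" for y
    proof -
      have "pd i (V k) y * pd i (V k) y + pd i (B k) y * pd i (B k) y \<le> (\<Sum>b\<in>UNIV. pd b (V k) y * pd b (V k) y + pd b (B k) y * pd b (B k) y)"
        by (rule member_le_sum) auto
      also have "\<dots> \<le> N y" unfolding N_def by (rule member_le_sum) (auto intro: sum_nonneg)
      finally show ?thesis .
    qed
    have "pd i (V k) y = 0 \<and> pd i (B k) y = 0" if "N y = 0" for y
      using le[of y] that by (simp add: sum_squares_le_zero_iff)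
    with \<open>AE y in lebesgue. N y = 0\<close> show "AE y in lebesgue. pd i (V k) y = 0" "AE y in lebesgue. pd i (B k) y = 0"
      by (auto elim: eventually_mono)
  qed
  show "AE y in lebesgue. V k y = 0" by (rule square_integrable_eq_zero[OF sV(1) pd(1)[OF V3] z(1)])
  show "AE y in lebesgue. B k y = 0" by (rule square_integrable_eq_zero[OF sB(1) pd(1)[OF B3] z(2)])
qed

section \<open>From the space-time system to the profile equations\<close>

lemma AE_slab_imp:
  assumes "AE z in lebesgue. z \<in> slab T \<longrightarrow> Q z"
    and "\<And>t x. 0 < t \<Longrightarrow> t < T \<Longrightarrow> Q (t, x) \<Longrightarrow> P (dilation T t *\<^sub>R x)" and "T > 0"
  shows "AE y in lebesgue. P y"
proof (rule AE_slab_scaledD[OF _ \<open>T > 0\<close>])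
  show "AE z in lebesgue. z \<in> slab T \<longrightarrow> P (dilation T (fst z) *\<^sub>R snd z)"
    using assms(1) by eventually_elim (use assms(2) in \<open>auto simp: slab_def\<close>)
qed

lemma self_similar_derivatives:
  fixes f :: "real^'n \<Rightarrow> real"
  assumes f: "f \<in> sobolev_H 3" and T: "T > 0"
    and c: "\<And>t x. 0 < t \<Longrightarrow> t < T \<Longrightarrow> c (t, x) = dilation T t * f (dilation T t *\<^sub>R x)"
  shows "AE z in lebesgue. z \<in> slab T \<longrightarrow> weak_deriv (slab T) [e_t] c z
      = dilated T 3 (euler_generator f (\<lambda>i. pd i f)) z" (is ?t)
    and "AE z in lebesgue. z \<in> slab T \<longrightarrow> weak_deriv (slab T) [e_x i] c z
      = dilated T 2 (pd i f) z" (is ?x)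
    and "AE z in lebesgue. z \<in> slab T \<longrightarrow> weak_deriv (slab T) [e_x i, e_x i] c z
      = dilated T 3 (pd i (pd i f)) z" (is ?xx)
proof -
  note f3 = sobolev_3[OF f]
  have c': "AE z in lebesgue. z \<in> slab T \<longrightarrow> dilated T 1 f z = c z"
    using c by (intro AE_I2) (auto simp: slab_def)
  have t: "has_weak_deriv (slab T) [e_t] c (dilated T 3 (euler_generator f (\<lambda>i. pd i f)))"
    by (rule has_weak_deriv_cong[OF slab_time_derivative[OF pd(1)[OF f3] T] e_t_Basis c']) simp
  have x: "has_weak_deriv (slab T) [e_x i] c (dilated T 2 (pd i f))"
    by (rule has_weak_deriv_cong[OF slab_spatial_derivative[OF pd(1)[OF f3] T, of i 1, unfolded one_add_one] e_x_Basis c']) simp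
  have xx: "has_weak_deriv (slab T) [e_x i, e_x i] c (dilated T 3 (pd i (pd i f)))"
  proof -
    have "(2::nat) + 1 = 3" by simp
    from has_weak_deriv_compose[OF x slab_spatial_derivative[OF pd(1)[OF pd(2)[OF f3]] T, of i 2, unfolded this] e_x_Basis e_x_Basis]
    show ?thesis .
  qed
  show ?t by (rule weak_deriv_eq[OF t open_slab]) (simp add: e_t_Basis)
  show ?x by (rule weak_deriv_eq[OF x open_slab]) (simp add: e_x_Basis)
  show ?xx by (rule weak_deriv_eq[OF xx open_slab]) (simp add: e_x_Basis)
qed

text \<open>After the derivatives of the self-similar fields are inserted, a power of the dilation factor splits
  off from every equation.  The \<open>k\<close>-th derivative of the total pressure \<open>q\<close> is a dilation of the momentum
  residual, hence weakly differentiable again; the two mixed second derivatives of \<open>q\<close> coincide.\<close>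

lemma self_similar_profile_equations:
  fixes V B :: "real^'n \<Rightarrow> real^'n"
  defines "Vk \<equiv> \<lambda>k y. V y $ k" and "Bk \<equiv> \<lambda>k y. B y $ k"
  assumes sol: "mhd_solution \<nu> T v0 b0 v b" and T: "T > 0"
    and ssV: "self_similar T V v" and ssB: "self_similar T B b"
    and HV: "\<And>k. Vk k \<in> sobolev_H 3" and HB: "\<And>k. Bk k \<in> sobolev_H 3"
  shows "AE y in lebesgue. (\<Sum>i\<in>UNIV. pd i (Vk i) y) = 0" (is ?divV)
    and "AE y in lebesgue. (\<Sum>i\<in>UNIV. pd i (Bk i) y) = 0" (is ?divB)
    and "AE y in lebesgue. induction_residual Vk Bk k y = 0" (is ?ind)
    and "AE y in lebesgue. momentum_residual_deriv \<nu> Vk Bk j k y = momentum_residual_deriv \<nu> Vk Bk k j y" (is ?curl)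
proof -
  let ?D = "weak_deriv (slab T)"
  define vc where "vc = (\<lambda>k (t, x). v t x $ k)"
  define bc where "bc = (\<lambda>k (t, x). b t x $ k)"
  obtain p where p0: "let q = (\<lambda>(t, x). p t x + (norm (b t x))\<^sup>2 / 2) in
          (\<forall>k. weakly_differentiable (slab T) [e_x k] q) \<and>
          (AE z in lebesgue. z \<in> slab T \<longrightarrow>
             (\<forall>k. ?D [e_t] (vc k) z + (\<Sum>i\<in>UNIV. vc i z * ?D [e_x i] (vc k) z)
                  = \<nu> * (\<Sum>i\<in>UNIV. ?D [e_x i, e_x i] (vc k) z) - ?D [e_x k] q z
                    + (\<Sum>i\<in>UNIV. bc i z * ?D [e_x i] (bc k) z)) \<and>
             (\<forall>k. ?D [e_t] (bc k) z + (\<Sum>i\<in>UNIV. vc i z * ?D [e_x i] (bc k) z)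
                  = (\<Sum>i\<in>UNIV. bc i z * ?D [e_x i] (vc k) z)) \<and>
             (\<Sum>i\<in>UNIV. ?D [e_x i] (vc i) z) = 0 \<and>
             (\<Sum>i\<in>UNIV. ?D [e_x i] (bc i) z) = 0)"
    using sol unfolding mhd_solution_def Let_def vc_def bc_def by blast
  define q where "q = (\<lambda>(t, x). p t x + (norm (b t x))\<^sup>2 / 2)"
  note p = p0[folded q_def, unfolded Let_def]
  have vcs: "vc k (t, x) = dilation T t * Vk k (dilation T t *\<^sub>R x)" if "0 < t" "t < T" for k t x
    using ssV that unfolding self_similar_def vc_def Vk_def by simp
  have bcs: "bc k (t, x) = dilation T t * Bk k (dilation T t *\<^sub>R x)" if "0 < t" "t < T" for k t x
    using ssB that unfolding self_similar_def bc_def Bk_def by simp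
  have dvt: "AE z in lebesgue. \<forall>k. z \<in> slab T \<longrightarrow> ?D [e_t] (vc k) z
      = dilation T (fst z) ^ 3 * euler_generator (Vk k) (\<lambda>i. pd i (Vk k)) (dilation T (fst z) *\<^sub>R snd z)"
    unfolding AE_all_countable by (intro allI self_similar_derivatives(1)[OF HV T vcs])
  have dvx: "AE z in lebesgue. \<forall>k i. z \<in> slab T \<longrightarrow> ?D [e_x i] (vc k) z
      = dilation T (fst z) ^ 2 * pd i (Vk k) (dilation T (fst z) *\<^sub>R snd z)"
    unfolding AE_all_countable by (intro allI self_similar_derivatives(2)[OF HV T vcs])
  have dvxx: "AE z in lebesgue. \<forall>k i. z \<in> slab T \<longrightarrow> ?D [e_x i, e_x i] (vc k) z
      = dilation T (fst z) ^ 3 * pd i (pd i (Vk k)) (dilation T (fst z) *\<^sub>R snd z)"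
    unfolding AE_all_countable by (intro allI self_similar_derivatives(3)[OF HV T vcs])
  have dbt: "AE z in lebesgue. \<forall>k. z \<in> slab T \<longrightarrow> ?D [e_t] (bc k) z
      = dilation T (fst z) ^ 3 * euler_generator (Bk k) (\<lambda>i. pd i (Bk k)) (dilation T (fst z) *\<^sub>R snd z)"
    unfolding AE_all_countable by (intro allI self_similar_derivatives(1)[OF HB T bcs])
  have dbx: "AE z in lebesgue. \<forall>k i. z \<in> slab T \<longrightarrow> ?D [e_x i] (bc k) z
      = dilation T (fst z) ^ 2 * pd i (Bk k) (dilation T (fst z) *\<^sub>R snd z)"
    unfolding AE_all_countable by (intro allI self_similar_derivatives(2)[OF HB T bcs])
  have eqs: "AE z in lebesgue. z \<in> slab T \<longrightarrow>
      (\<forall>k. ?D [e_x k] q z = dilation T (fst z) ^ 3 * ((- 1) * momentum_residual \<nu> Vk Bk k (dilation T (fst z) *\<^sub>R snd z))) \<and>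
      (\<forall>k. induction_residual Vk Bk k (dilation T (fst z) *\<^sub>R snd z) = 0) \<and>
      (\<Sum>i\<in>UNIV. pd i (Vk i) (dilation T (fst z) *\<^sub>R snd z)) = 0 \<and>
      (\<Sum>i\<in>UNIV. pd i (Bk i) (dilation T (fst z) *\<^sub>R snd z)) = 0"
    using p[THEN conjunct2] dvt dvx dvxx dbt dbx
  proof eventually_elim
    case (elim z)
    show ?case
    proof
      assume z: "z \<in> slab T"
      obtain t x where tx: "z = (t, x)" by fastforce
      have t: "0 < t" "t < T" using z by (auto simp: slab_def tx)
      define l where "l = dilation T t"
      have l0: "l > 0" using t by (simp add: l_def)
      define y where "y = l *\<^sub>R x"
      have D: "?D [e_t] (vc k) z = l ^ 3 * euler_generator (Vk k) (\<lambda>i. pd i (Vk k)) y"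
        "?D [e_x i] (vc k) z = l ^ 2 * pd i (Vk k) y"
        "?D [e_x i, e_x i] (vc k) z = l ^ 3 * pd i (pd i (Vk k)) y"
        "?D [e_t] (bc k) z = l ^ 3 * euler_generator (Bk k) (\<lambda>i. pd i (Bk k)) y"
        "?D [e_x i] (bc k) z = l ^ 2 * pd i (Bk k) y"
        "vc k z = l * Vk k y" "bc k z = l * Bk k y" for i k
        using elim(2-6) z vcs[OF t] bcs[OF t] by (simp_all add: tx l_def y_def)
      have s: "(\<Sum>i\<in>UNIV. (l * F i) * (l ^ 2 * G i)) = l ^ 3 * (\<Sum>i\<in>UNIV. F i * G i)" for F G :: "'n \<Rightarrow> real"
        unfolding sum_distrib_left by (intro sum.cong refl) (simp add: power2_eq_square power3_eq_cube)
      have s': "(\<Sum>i\<in>UNIV. l ^ m * F i) = l ^ m * (\<Sum>i\<in>UNIV. F i)" for m and F :: "'n \<Rightarrow> real"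
        by (simp add: sum_distrib_left)
      note e = elim(1)[rule_format, OF z, unfolded D s s']
      have "?D [e_x k] q z = l ^ 3 * ((- 1) * momentum_residual \<nu> Vk Bk k y)" for k
        using e[THEN conjunct1, rule_format, of k] unfolding momentum_residual_def by (simp add: algebra_simps)
      moreover have "induction_residual Vk Bk k y = 0" for k
      proof -
        have "l ^ 3 * induction_residual Vk Bk k y = 0"
          using e[THEN conjunct2, THEN conjunct1, rule_format, of k] unfolding induction_residual_def by (simp add: algebra_simps)
        then show ?thesis using l0 by simp
      qed
      moreover have "(\<Sum>i\<in>UNIV. pd i (Vk i) y) = 0" "(\<Sum>i\<in>UNIV. pd i (Bk i) y) = 0"
        using e l0 by auto
      ultimately show "(\<forall>k. ?D [e_x k] q z = dilation T (fst z) ^ 3 * ((- 1) * momentum_residual \<nu> Vk Bk k (dilation T (fst z) *\<^sub>R snd z))) \<and>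
        (\<forall>k. induction_residual Vk Bk k (dilation T (fst z) *\<^sub>R snd z) = 0) \<and>
        (\<Sum>i\<in>UNIV. pd i (Vk i) (dilation T (fst z) *\<^sub>R snd z)) = 0 \<and>
        (\<Sum>i\<in>UNIV. pd i (Bk i) (dilation T (fst z) *\<^sub>R snd z)) = 0"
        unfolding y_def l_def tx fst_conv snd_conv by blast
    qed
  qed
  show ?divV by (rule AE_slab_imp[OF eqs _ T]) simp
  show ?divB by (rule AE_slab_imp[OF eqs _ T]) simp
  show ?ind by (rule AE_slab_imp[OF eqs _ T]) simp
  have q1: "has_weak_deriv (slab T) [e_x k] q
      (\<lambda>z. dilation T (fst z) ^ 3 * ((- 1) * momentum_residual \<nu> Vk Bk k (dilation T (fst z) *\<^sub>R snd z)))" for k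
  proof (rule has_weak_deriv_cong[OF _ e_x_Basis])
    show "has_weak_deriv (slab T) [e_x k] q (?D [e_x k] q)"
      using p by (intro weak_deriv_works) blast
    show "AE z in lebesgue. z \<in> slab T \<longrightarrow> ?D [e_x k] q z
        = dilation T (fst z) ^ 3 * ((- 1) * momentum_residual \<nu> Vk Bk k (dilation T (fst z) *\<^sub>R snd z))"
      using eqs by eventually_elim blast
  qed simp
  have q2: "has_weak_deriv (slab T) [e_x j]
      (\<lambda>z. dilation T (fst z) ^ 3 * ((- 1) * momentum_residual \<nu> Vk Bk k (dilation T (fst z) *\<^sub>R snd z)))
      (\<lambda>z. dilation T (fst z) ^ (3 + 1) * ((- 1) * momentum_residual_deriv \<nu> Vk Bk j k (dilation T (fst z) *\<^sub>R snd z)))" for j k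
    by (rule slab_spatial_derivative[OF has_weak_deriv_cmult[OF momentum_residual_weak_deriv[OF HV HB] axis_Basis] T])
  have "AE z in lebesgue. z \<in> slab T \<longrightarrow>
      dilation T (fst z) ^ (3 + 1) * ((- 1) * momentum_residual_deriv \<nu> Vk Bk j k (dilation T (fst z) *\<^sub>R snd z)) =
      dilation T (fst z) ^ (3 + 1) * ((- 1) * momentum_residual_deriv \<nu> Vk Bk k j (dilation T (fst z) *\<^sub>R snd z))"
    by (rule mixed_weak_derivatives[OF q1 q2 q1 q2 e_x_Basis e_x_Basis open_slab])
  then show ?curl by (rule AE_slab_imp[OF _ _ T]) simp
qed

lemma grad_Linf_norm_nonneg:
  fixes V :: "real^'n \<Rightarrow> real^'n"
  shows "0 \<le> grad_Linf_norm V"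
proof (rule ccontr)
  assume "\<not> ?thesis"
  then have neg: "grad_Linf_norm V < 0" by simp
  have "AE y in lebesgue. ereal (norm (weak_gradient V y)) < 0"
    using esssup_AE[where M=lebesgue and f="\<lambda>y. ereal (norm (weak_gradient V y))"]
  proof eventually_elim
    case (elim y)
    then show ?case using neg unfolding grad_Linf_norm_def by (rule le_less_trans)
  qed
  then have "AE y in (lebesgue :: (real^'n) measure). False" by (rule eventually_mono) (simp add: zero_ereal_def)
  then show False
    using open_not_negligible[of "UNIV :: (real^'n) set"]
    by (simp add: negligible_iff_null_sets AE_iff_null_sets)
qed

lemma grad_Linf_norm_bound:
  assumes "grad_Linf_norm V < ereal \<eta>"
  shows "AE y in lebesgue. \<bar>pd i (\<lambda>y. V y $ k) y\<bar> \<le> \<eta>"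
  using esssup_AE[where M=lebesgue and f="\<lambda>y. ereal (norm (weak_gradient V y))"]
proof eventually_elim
  case (elim y)
  then have "ereal (norm (weak_gradient V y)) < ereal \<eta>"
    using assms unfolding grad_Linf_norm_def by (rule le_less_trans)
  moreover have "\<bar>weak_gradient V y $ k $ i\<bar> \<le> norm (weak_gradient V y)"
    by (rule order_trans[OF component_le_norm_cart Finite_Cartesian_Product.norm_nth_le])
  ultimately show ?case by (simp add: weak_gradient_def)
qed

proposition self_similar_rigidity:
  fixes V B :: "real^'n \<Rightarrow> real^'n"
  assumes n: "CARD('n) \<le> 3" and \<nu>: "\<nu> > 0" and m: "m \<ge> 3" and T: "T > 0"
    and sol: "mhd_solution \<nu> T v0 b0 v b" and ss: "self_similar T V v" "self_similar T B b"
    and H: "V \<in> sobolev_H_vec m" "B \<in> sobolev_H_vec m"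
    and small: "grad_Linf_norm V + grad_Linf_norm B < ereal (1 / 1000)"
  shows "AE y in lebesgue. V y = 0" "AE y in lebesgue. B y = 0"
proof -
  have HV: "(\<lambda>y. V y $ k) \<in> sobolev_H 3" and HB: "(\<lambda>y. B y $ k) \<in> sobolev_H 3" for k
    using H m sobolev_H_mono unfolding sobolev_H_vec_def by blast+
  have "grad_Linf_norm V \<le> grad_Linf_norm V + grad_Linf_norm B" "grad_Linf_norm B \<le> grad_Linf_norm V + grad_Linf_norm B"
    using add_mono[OF order_refl grad_Linf_norm_nonneg[of B], of "grad_Linf_norm V"]
      add_mono[OF grad_Linf_norm_nonneg[of V] order_refl, of "grad_Linf_norm B"] by simp_all
  then have "grad_Linf_norm V < ereal (1 / 1000)" "grad_Linf_norm B < ereal (1 / 1000)"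
    using small by (auto intro: le_less_trans)
  note bd = this[THEN grad_Linf_norm_bound]
  note eq = self_similar_profile_equations[OF sol T ss HV HB]
  note R = profile_rigidity[OF HV HB n less_imp_le[OF \<nu>] bd eq(1,2,4,3)]
  have "AE y in lebesgue. \<forall>k. V y $ k = 0" "AE y in lebesgue. \<forall>k. B y $ k = 0"
    unfolding AE_all_countable using R by blast+
  then show "AE y in lebesgue. V y = 0" "AE y in lebesgue. B y = 0"
    by (auto elim!: eventually_mono simp: vec_eq_iff)
qed

theorem theorem1p2:
  shows "\<exists>\<eta>::real. \<eta> > 0 \<and>
      (\<forall>\<nu>>0. \<forall>m::nat. real m > 2 / 2 + 1 \<longrightarrow>
         (\<forall>T>0. \<forall>(V :: real^2 \<Rightarrow> real^2) (B :: real^2 \<Rightarrow> real^2) v0 b0 v b.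
            mhd_solution \<nu> T v0 b0 v b \<longrightarrow>
            self_similar T V v \<longrightarrow> self_similar T B b \<longrightarrow>
            V \<in> sobolev_H_vec m \<longrightarrow> B \<in> sobolev_H_vec m \<longrightarrow>
            grad_Linf_norm V + grad_Linf_norm B < ereal \<eta> \<longrightarrow>
            (AE y in lebesgue. V y = 0) \<and> (AE y in lebesgue. B y = 0))) \<and>
      (\<forall>\<nu>>0. \<forall>m::nat. real m > 3 / 2 + 1 \<longrightarrow>
         (\<forall>T>0. \<forall>(V :: real^3 \<Rightarrow> real^3) (B :: real^3 \<Rightarrow> real^3) v0 b0 v b.
            mhd_solution \<nu> T v0 b0 v b \<longrightarrow>
            self_similar T V v \<longrightarrow> self_similar T B b \<longrightarrow>
            V \<in> sobolev_H_vec m \<longrightarrow> B \<in> sobolev_H_vec m \<longrightarrow>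
            grad_Linf_norm V + grad_Linf_norm B < ereal \<eta> \<longrightarrow>
            (AE y in lebesgue. V y = 0) \<and> (AE y in lebesgue. B y = 0)))"
proof (rule exI[of _ "1 / 1000"], intro conjI allI impI)
  show "(1 / 1000 :: real) > 0" by simp
next
  fix \<nu> T :: real and m :: nat and V B :: "real^2 \<Rightarrow> real^2" and v0 b0 v b
  assume a: "\<nu> > 0" "real m > 2 / 2 + 1" "T > 0" "mhd_solution \<nu> T v0 b0 v b" "self_similar T V v" "self_similar T B b"
    "V \<in> sobolev_H_vec m" "B \<in> sobolev_H_vec m" "grad_Linf_norm V + grad_Linf_norm B < ereal (1 / 1000)"
  have "m \<ge> 3" "CARD(2) \<le> 3" using a(2) by simp_all
  note R = self_similar_rigidity[OF this(2) a(1) this(1) a(3-9)]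
  show "AE y in lebesgue. V y = 0" "AE y in lebesgue. B y = 0" by (rule R)+
next
  fix \<nu> T :: real and m :: nat and V B :: "real^3 \<Rightarrow> real^3" and v0 b0 v b
  assume a: "\<nu> > 0" "real m > 3 / 2 + 1" "T > 0" "mhd_solution \<nu> T v0 b0 v b" "self_similar T V v" "self_similar T B b"
    "V \<in> sobolev_H_vec m" "B \<in> sobolev_H_vec m" "grad_Linf_norm V + grad_Linf_norm B < ereal (1 / 1000)"
  have "m \<ge> 3" "CARD(3) \<le> 3" using a(2) by simp_all
  note R = self_similar_rigidity[OF this(2) a(1) this(1) a(3-9)]
  show "AE y in lebesgue. V y = 0" "AE y in lebesgue. B y = 0" by (rule R)+
qed

end
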